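(* Let $(X_t,V_t)_{t\ge0}$ be the solution of the SDE system of the context with friction parameter $\mu$. Let $L>0$, $C_L^*=\max(C_L,\tfrac98L)$ and $0<\sigma<4\frac{L}{\sqrt{C_L^*}}$. Let $\mathcal D\subset\mathbb R^d$ be an open set such that for all $x\in\mathcal D$ $$|\nabla f(x)|^2\ge 2Lf(x)\quad\text{and}\quad\|\Sigma(x)\|_F^2\le\sigma f(x),$$ and choose $$\mu=2\sqrt{C_L^*}-\sqrt{C_L^*-L+\tfrac14\sqrt{C_L^*}\,\sigma}.$$ Then there exists $C\ge0$ such that $$\mathbb E[\mathbf 1_{\{T>t\}}f(X_t)]\le C\exp(-mt)\quad\text{for all }t\ge0,$$ where $T=\inf\{t\ge0:X_t\notin\mathcal D\}$ and $$m=2\Bigl(\sqrt{C_L^*}-\sqrt{C_L^*-L+\tfrac14\sqrt{C_L^*}\,\sigma}\Bigr).$$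
   Context: Setting. $f:\mathbb R^d\to\mathbb R$ is twice continuously differentiable with $C_L$-Lipschitz continuous gradient for some constant $C_L\ge0$, and $\inf_{x\in\mathbb R^d}f(x)=0$. $\Sigma:\mathbb R^d\to\mathbb R^{d\times d'}$ is Lipschitz continuous. $(\Omega,(\mathcal F_t)_{t\ge0},\mathcal F,\mathbb P)$ is a filtered probability space satisfying the usual conditions, $(W_t)_{t\ge0}$ is a standard $\mathbb R^{d'}$-valued $(\mathcal F_t)$-Brownian motion, $X_0,V_0\in L^4(\Omega,\mathcal F_0)$ are $\mathbb R^d$-valued, $\mu>0$, and $(X_t,V_t)_{t\ge0}$ is the unique continuous $\mathbb R^{2d}$-valued semimartingale satisfying $$dX_t=V_t\,dt,\qquad dV_t=-(\mu V_t+\nabla f(X_t))\,dt+\Sigma(X_t)\,dW_t.$$ $\|\cdot\|_F$ denotes the Frobenius norm. *)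

theory Defs
  imports "HOL-Probability.Probability"
begin

text \<open>
  Time is \<^typ>\<open>real\<close>; processes and filtrations are only constrained at times \<open>t \<ge> 0\<close>.
  A \<open>d \<times> d'\<close> matrix has type \<open>real^'e^'d\<close> (\<open>CARD('d) = d\<close> rows, \<open>CARD('e) = d'\<close> columns).
  On this type \<^const>\<open>norm\<close> is the Euclidean norm of the vector of row norms, which is the
  Frobenius norm.
\<close>

subsection \<open>The potential\<close>

definition gradient :: "('a::euclidean_space \<Rightarrow> real) \<Rightarrow> 'a \<Rightarrow> 'a" where
  "gradient f x = (THE D. GDERIV f x :> D)"

definition twice_continuously_differentiable :: "('a::euclidean_space \<Rightarrow> real) \<Rightarrow> bool" where
  "twice_continuously_differentiable f \<longleftrightarrow>
     (\<forall>x. GDERIV f x :> gradient f x) \<and>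
     (\<exists>H :: 'a \<Rightarrow> 'a \<Rightarrow>\<^sub>L 'a. continuous_on UNIV H \<and>
        (\<forall>x. (gradient f has_derivative blinfun_apply (H x)) (at x)))"

subsection \<open>Filtrations and processes\<close>

definition filtered_prob_space :: "'w measure \<Rightarrow> (real \<Rightarrow> 'w measure) \<Rightarrow> bool" where
  "filtered_prob_space M F \<longleftrightarrow>
     prob_space M \<and> (\<forall>t\<ge>0. subalgebra M (F t)) \<and>
     (\<forall>s t. 0 \<le> s \<longrightarrow> s \<le> t \<longrightarrow> sets (F s) \<subseteq> sets (F t))"

definition usual_conditions :: "'w measure \<Rightarrow> (real \<Rightarrow> 'w measure) \<Rightarrow> bool" where
  "usual_conditions M F \<longleftrightarrow>
     complete_measure M \<and> null_sets M \<subseteq> sets (F 0) \<and>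
     (\<forall>t\<ge>0. sets (F t) = (\<Inter>s\<in>{t<..}. sets (F s)))"

definition adapted :: "(real \<Rightarrow> 'w measure) \<Rightarrow> (real \<Rightarrow> 'w \<Rightarrow> 'a::topological_space) \<Rightarrow> bool" where
  "adapted F Y \<longleftrightarrow> (\<forall>t\<ge>0. Y t \<in> borel_measurable (F t))"

definition continuous_process ::
    "'w measure \<Rightarrow> (real \<Rightarrow> 'w \<Rightarrow> 'a::topological_space) \<Rightarrow> bool" where
  "continuous_process M Y \<longleftrightarrow> (\<forall>\<omega>\<in>space M. continuous_on {0..} (\<lambda>t. Y t \<omega>))"

definition progressively_measurable ::
    "(real \<Rightarrow> 'w measure) \<Rightarrow> (real \<Rightarrow> 'w \<Rightarrow> 'a::topological_space) \<Rightarrow> bool" where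
  "progressively_measurable F H \<longleftrightarrow>
     (\<forall>t\<ge>0. (\<lambda>(s, \<omega>). H s \<omega>) \<in> borel_measurable (restrict_space borel {0..t} \<Otimes>\<^sub>M F t))"

definition in_Lp :: "real \<Rightarrow> 'w measure \<Rightarrow> 'w measure \<Rightarrow> ('w \<Rightarrow> 'a::euclidean_space) \<Rightarrow> bool" where
  "in_Lp p M G Z \<longleftrightarrow> Z \<in> borel_measurable G \<and> integrable M (\<lambda>\<omega>. norm (Z \<omega>) powr p)"

text \<open>The infimum is taken in \<^typ>\<open>ereal\<close>, so that the exit time is \<open>\<infinity>\<close> if \<open>D\<close> is never left.\<close>

definition exit_time :: "(real \<Rightarrow> 'w \<Rightarrow> 'a) \<Rightarrow> 'a set \<Rightarrow> 'w \<Rightarrow> ereal" where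
  "exit_time X D \<omega> = Inf {ereal t | t. 0 \<le> t \<and> X t \<omega> \<notin> D}"

definition standard_brownian_motion ::
    "'w measure \<Rightarrow> (real \<Rightarrow> 'w measure) \<Rightarrow> (real \<Rightarrow> 'w \<Rightarrow> real^'e) \<Rightarrow> bool" where
  "standard_brownian_motion M F W \<longleftrightarrow>
     adapted F W \<and>
     (AE \<omega> in M. W 0 \<omega> = 0) \<and>
     (AE \<omega> in M. continuous_on {0..} (\<lambda>t. W t \<omega>)) \<and>
     (\<forall>s t. 0 \<le> s \<longrightarrow> s < t \<longrightarrow>
        prob_space.indep_set M (sets (F s))
          {(\<lambda>\<omega>. W t \<omega> - W s \<omega>) -` A \<inter> space M | A. A \<in> sets borel} \<and>
        prob_space.indep_vars M (\<lambda>_. borel) (\<lambda>i \<omega>. (W t \<omega> - W s \<omega>) $ i) UNIV \<and>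
        (\<forall>i. distributed M lborel (\<lambda>\<omega>. (W t \<omega> - W s \<omega>) $ i) (normal_density 0 (sqrt (t - s)))))"

subsection \<open>The Ito integral\<close>

text \<open>
  The triple \<open>(n, \<tau>, \<xi>)\<close> represents the elementary process
  \<open>\<Sum>i<n. \<xi> i * indicator {\<tau> i<..\<tau> (Suc i)}\<close>.
\<close>

definition elementary_process ::
    "'w measure \<Rightarrow> (real \<Rightarrow> 'w measure) \<Rightarrow> nat \<Rightarrow> (nat \<Rightarrow> real) \<Rightarrow>
     (nat \<Rightarrow> 'w \<Rightarrow> 'a::real_normed_vector) \<Rightarrow> bool" where
  "elementary_process M F n \<tau> \<xi> \<longleftrightarrow>
     0 \<le> \<tau> 0 \<and>
     (\<forall>i<n. \<tau> i \<le> \<tau> (Suc i) \<and> \<xi> i \<in> borel_measurable (F (\<tau> i)) \<and>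
        (\<exists>B. \<forall>\<omega>\<in>space M. norm (\<xi> i \<omega>) \<le> B))"

definition elementary_value ::
    "nat \<Rightarrow> (nat \<Rightarrow> real) \<Rightarrow> (nat \<Rightarrow> 'w \<Rightarrow> 'a::real_normed_vector) \<Rightarrow> real \<Rightarrow> 'w \<Rightarrow> 'a" where
  "elementary_value n \<tau> \<xi> s \<omega> = (\<Sum>i<n. indicator {\<tau> i<..\<tau> (Suc i)} s *\<^sub>R \<xi> i \<omega>)"

definition elementary_integral ::
    "(real \<Rightarrow> 'w \<Rightarrow> real^'e) \<Rightarrow> nat \<Rightarrow> (nat \<Rightarrow> real) \<Rightarrow> (nat \<Rightarrow> 'w \<Rightarrow> real^'e^'d) \<Rightarrow>
     real \<Rightarrow> 'w \<Rightarrow> real^'d" where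
  "elementary_integral W n \<tau> \<xi> t \<omega> =
     (\<Sum>i<n. \<xi> i \<omega> *v (W (min t (\<tau> (Suc i))) \<omega> - W (min t (\<tau> i)) \<omega>))"

text \<open>
  \<open>J\<close> is (a continuous version of) the process \<open>t \<mapsto> \<integral>\<^sub>0\<^sup>t H dW\<close>, obtained as the limit in
  probability of the integrals of elementary processes which approximate \<open>H\<close> in
  \<open>L\<^sup>2([0,t])\<close> in probability. The squared distance is an \<^typ>\<open>ennreal\<close>-valued integral, so
  the existence of an approximating sequence forces \<open>\<integral>\<^sub>0\<^sup>t \<bar>H\<bar>\<^sup>2 ds < \<infinity>\<close> almost surely.
\<close>

definition ito_integral_process ::
    "'w measure \<Rightarrow> (real \<Rightarrow> 'w measure) \<Rightarrow> (real \<Rightarrow> 'w \<Rightarrow> real^'e) \<Rightarrow>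
     (real \<Rightarrow> 'w \<Rightarrow> real^'e^'d) \<Rightarrow> (real \<Rightarrow> 'w \<Rightarrow> real^'d) \<Rightarrow> bool" where
  "ito_integral_process M F W H J \<longleftrightarrow>
     progressively_measurable F H \<and> adapted F J \<and> continuous_process M J \<and>
     (\<exists>n \<tau> \<xi>. (\<forall>k. elementary_process M F (n k) (\<tau> k) (\<xi> k)) \<and>
        (\<forall>t\<ge>0. \<forall>\<epsilon>>0.
           (\<lambda>k. measure M {\<omega>\<in>space M.
              (\<integral>\<^sup>+s\<in>{0..t}. ennreal ((norm (elementary_value (n k) (\<tau> k) (\<xi> k) s \<omega> - H s \<omega>))\<^sup>2) \<partial>lborel)
                > ennreal \<epsilon>}) \<longlonglongrightarrow> 0 \<and>
           (\<lambda>k. measure M {\<omega>\<in>space M.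
              norm (elementary_integral W (n k) (\<tau> k) (\<xi> k) t \<omega> - J t \<omega>) > \<epsilon>}) \<longlonglongrightarrow> 0))"

subsection \<open>The system of stochastic differential equations\<close>

text \<open>
  An adapted continuous \<open>(X, V)\<close> satisfying the integral equations is automatically a
  semimartingale.
\<close>

definition sde_solution ::
    "'w measure \<Rightarrow> (real \<Rightarrow> 'w measure) \<Rightarrow> (real \<Rightarrow> 'w \<Rightarrow> real^'e) \<Rightarrow> real \<Rightarrow>
     (real^'d \<Rightarrow> real) \<Rightarrow> (real^'d \<Rightarrow> real^'e^'d) \<Rightarrow>
     (real \<Rightarrow> 'w \<Rightarrow> real^'d) \<Rightarrow> (real \<Rightarrow> 'w \<Rightarrow> real^'d) \<Rightarrow> bool" where
  "sde_solution M F W \<mu> f S X V \<longleftrightarrow>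
     adapted F X \<and> continuous_process M X \<and> adapted F V \<and> continuous_process M V \<and>
     (\<exists>J. ito_integral_process M F W (\<lambda>t \<omega>. S (X t \<omega>)) J \<and>
        (AE \<omega> in M. \<forall>t\<ge>0.
           X t \<omega> = X 0 \<omega> + integral {0..t} (\<lambda>s. V s \<omega>) \<and>
           V t \<omega> = V 0 \<omega> - integral {0..t} (\<lambda>s. \<mu> *\<^sub>R V s \<omega> + gradient f (X s \<omega>)) + J t \<omega>))"

end

theory Submission
  imports Defs
begin

text \<open>
  With \<open>s = sqrt CLstar\<close> and \<open>r = sqrt (CLstar - L + s * \<sigma> / 4)\<close>, so that \<open>\<mu> = 2 * s - r\<close> and
  \<open>m = 2 * (s - r)\<close>, the energy \<open>Y x v = (s + r) * f x + \<langle>\<nabla>f x, v\<rangle> + s / 2 * \<bar>v\<bar>\<^sup>2\<close> dominates \<open>r * f x\<close>, and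
  the hypotheses on \<open>D\<close> bound its drift along the equation by \<open>- m * Y\<close>.

  The Ito formula is avoided by comparing with one Euler step on each cell of a time grid of mesh \<open>h\<close>:
  a step with a noise increment of conditional mean zero and the right conditional second moment
  changes the expected energy by the factor \<open>1 - m * h\<close> up to \<open>h * o(1)\<close>, and only the Lipschitz
  bound on \<open>\<nabla>f\<close> is used. The comparison is made on decreasing adapted events \<open>chain\<close> on which the path is
  bounded, meets \<open>D\<close> at the grid points and oscillates by at most \<open>\<epsilon>\<close> on each cell. Because the energy
  is nonnegative, it may be dropped where the next event fails, so stopped processes and moment
  estimates for the solution are not needed. Fatou's lemma removes the restrictions.
\<close>

subsection \<open>The energy function\<close>

text \<open>The constants solve a matching problem. With \<open>F = f x\<close>,
  \<open>P = g x \<bullet> v\<close>, \<open>Q = (norm v)^2\<close> and \<open>CLstar = s^2\<close>,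
  the drift of \<open>a F + P + b Q\<close> in \<open>D\<close> is at most \<open>(b \<sigma> - 2 L)
  F + (a - \<mu> - 2 b) P + (s^2 - 2 b \<mu>) Q\<close>. Since
  \<open>\<bar>P\<bar> \<le> s F + (s / 2) Q\<close>, the choice \<open>b = s / 2\<close>,
  \<open>a = s + r\<close> leaves \<open>r F\<close> as a lower bound of the energy. Asking that
  each drift coefficient be \<open>- m\<close> times the coefficient in the energy then forces
  \<open>\<mu> = 2 s - r\<close>, \<open>m = 2 (s - r)\<close> and
  \<open>r^2 = s^2 - L + s \<sigma> / 4\<close>. The obstacle is the noise: the Ito integral is
  given only as a limit in probability of elementary integrals, whose second moments need not stay
  bounded. On each cell the elementary integrands are therefore projected to a small ball around
  \<open>S (X t)\<close>. The projected sums satisfy the isometry with an explicit bound and still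
  converge to the Ito increment where the path stays in the cell. The event on which they are not
  yet close costs its probability times a deterministic bound of the energy.\<close>

lemma descent_inequality:
  fixes f :: "'a::euclidean_space \<Rightarrow> real"
  assumes f: "\<And>x. GDERIV f x :> g x" and g: "C-lipschitz_on UNIV g"
  shows "f y \<le> f x + g x \<bullet> (y - x) + C / 2 * (norm (y - x))\<^sup>2"
proof -
  define d where "d = y - x"
  \<comment> \<open>\<open>f\<close> along the segment, minus its first-order part and the largest
    quadratic growth that the Lipschitz bound permits; this makes the derivative of \<open>p\<close>
    nonpositive on \<open>[0, 1]\<close>.\<close>
  define p where "p = (\<lambda>t. f (x + t *\<^sub>R d) - t * (g x \<bullet> d) - C / 2 * t\<^sup>2 * (norm d)\<^sup>2)"
  have fd: "(f has_derivative (\<lambda>h. h \<bullet> g z)) (at z)" for z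
    using f[of z] by (simp add: gderiv_def)
  have "p 1 \<le> p 0"
  proof (rule DERIV_nonpos_imp_nonincreasing[of 0 1])
    fix t :: real assume t: "0 \<le> t" "t \<le> 1"
    have "((\<lambda>t. f (x + t *\<^sub>R d)) has_derivative (\<lambda>h. (h *\<^sub>R d) \<bullet> g (x + t *\<^sub>R d))) (at t)"
      by (rule has_derivative_compose[where g = f, OF _ fd]) (auto intro!: derivative_eq_intros)
    then have "((\<lambda>t. f (x + t *\<^sub>R d)) has_real_derivative (d \<bullet> g (x + t *\<^sub>R d))) (at t)"
      by (simp add: has_field_derivative_def mult_commute_abs)
    then have D: "(p has_real_derivative
        (d \<bullet> g (x + t *\<^sub>R d) - g x \<bullet> d - C / 2 * (2 * t) * (norm d)\<^sup>2)) (at t)"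
      unfolding p_def by (auto intro!: derivative_eq_intros)
    have "d \<bullet> g (x + t *\<^sub>R d) - g x \<bullet> d = (g (x + t *\<^sub>R d) - g x) \<bullet> d"
      by (simp add: inner_diff_left inner_diff_right inner_commute)
    also have "\<dots> \<le> norm (g (x + t *\<^sub>R d) - g x) * norm d"
      by (rule norm_cauchy_schwarz)
    also have "\<dots> \<le> (C * norm (t *\<^sub>R d)) * norm d"
      using lipschitz_onD[OF g, of "x + t *\<^sub>R d" x]
      by (intro mult_right_mono) (auto simp: dist_norm)
    also have "\<dots> = C / 2 * (2 * t) * (norm d)\<^sup>2"
      using t by (simp add: power2_eq_square)
    finally show "\<exists>y. (p has_real_derivative y) (at t) \<and> y \<le> 0"
      using D by (intro exI[of _ "d \<bullet> g (x + t *\<^sub>R d) - g x \<bullet> d - C / 2 * (2 * t) * (norm d)\<^sup>2"]) auto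
  qed simp
  then show ?thesis by (simp add: p_def d_def)
qed

text \<open>The gradient step \<open>x - (1 / C) *\<^sub>R g x\<close> minimizes the quadratic upper
  bound of \<open>f\<close>, and \<open>f\<close> is still nonnegative at that point. With
  \<open>C = s^2\<close> this controls the cross term of the energy.\<close>

lemma norm_gradient_sq_le:
  fixes f :: "'a::euclidean_space \<Rightarrow> real"
  assumes f: "\<And>x y. f y \<le> f x + g x \<bullet> (y - x) + C / 2 * (norm (y - x))\<^sup>2"
    and nonneg: "\<And>x. 0 \<le> f x" and "C > 0"
  shows "(norm (g x))\<^sup>2 \<le> 2 * C * f x"
proof -
  have "0 \<le> f (x - (1 / C) *\<^sub>R g x)" by (rule nonneg)
  also have "\<dots> \<le> f x - (1 / C) * (norm (g x))\<^sup>2 + C / 2 * ((1 / C) * norm (g x))\<^sup>2"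
    using f[of "x - (1 / C) *\<^sub>R g x" x] \<open>C > 0\<close> by (simp add: power2_norm_eq_inner)
  also have "\<dots> = f x - (norm (g x))\<^sup>2 / (2 * C)"
    using \<open>C > 0\<close> by (simp add: field_simps power2_eq_square)
  finally show ?thesis using \<open>C > 0\<close> by (simp add: field_simps)
qed

text \<open>A Lyapunov function of hypocoercive type: friction damps only \<open>v\<close>, and the
  cross term passes the dissipation on to \<open>f\<close>, because its drift contains
  \<open>- (norm (g x))^2\<close>.\<close>

definition energy :: "real \<Rightarrow> real \<Rightarrow> ('a::real_inner \<Rightarrow> real) \<Rightarrow> ('a \<Rightarrow> 'a) \<Rightarrow> 'a \<Rightarrow> 'a \<Rightarrow> real" where
  "energy a b f g x v = a * f x + g x \<bullet> v + b * (norm v)\<^sup>2"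

text \<open>Exact because the energy is quadratic in the velocity: a centred noise increment
  \<open>z\<close> contributes through its second moment alone, with no Taylor remainder.\<close>

lemma energy_add:
  "energy a b f g x (u + z) = energy a b f g x u + (g x + (2 * b) *\<^sub>R u) \<bullet> z + b * (norm z)\<^sup>2"
  by (simp add: energy_def power2_norm_eq_inner algebra_simps inner_commute)

text \<open>Completing the square: \<open>(norm (s *\<^sub>R v + g x))^2 \<ge> 0\<close> together
  with the gradient bound shows that the energy minus \<open>r * f x\<close> is nonnegative.\<close>

lemma energy_lower_bound:
  assumes "(norm (g x))\<^sup>2 \<le> 2 * s\<^sup>2 * f x" "s > 0"
  shows "r * f x \<le> energy (s + r) (s / 2) f g x v"
proof -
  have "0 \<le> (norm (s *\<^sub>R v + g x))\<^sup>2" by simp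
  also have "\<dots> = s\<^sup>2 * (norm v)\<^sup>2 + 2 * s * (g x \<bullet> v) + (norm (g x))\<^sup>2"
    unfolding power2_norm_eq_inner by (simp add: power2_eq_square algebra_simps inner_commute)
  also have "\<dots> \<le> s\<^sup>2 * (norm v)\<^sup>2 + 2 * s * (g x \<bullet> v) + 2 * s\<^sup>2 * f x"
    using assms by simp
  also have "\<dots> = (2 * s) * (s * f x + g x \<bullet> v + s / 2 * (norm v)\<^sup>2)"
    by (simp add: algebra_simps power2_eq_square)
  finally have "0 \<le> s * f x + g x \<bullet> v + s / 2 * (norm v)\<^sup>2"
    using \<open>s > 0\<close> by (simp add: zero_le_mult_iff)
  then show ?thesis by (simp add: energy_def algebra_simps)
qed

text \<open>Compares the true endpoint \<open>(x, v)\<close> of a cell with its Euler prediction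
  \<open>(y, w)\<close>. Sizes are assumed at the endpoint, where the events give them; those at
  \<open>y\<close> and \<open>w\<close> follow from \<open>e \<le> 1\<close>.\<close>

lemma energy_local_lipschitz:
  fixes f :: "'a::euclidean_space \<Rightarrow> real"
  assumes f: "\<And>x y. f y \<le> f x + g x \<bullet> (y - x) + C / 2 * (norm (y - x))\<^sup>2"
    and g: "C-lipschitz_on UNIV g" and "a \<ge> 0" "b \<ge> 0"
    and R: "norm v \<le> R" "norm (g x) \<le> R" and "norm (x - y) \<le> e" "norm (v - w) \<le> e" "e \<le> 1"
  shows "energy a b f g x v
    \<le> energy a b f g y w + (a * (R + 2 * C) + C * (R + 1) + R + 2 * b * R) * e"
proof -
  have C: "0 \<le> C" using g by (rule lipschitz_on_nonneg)
  have e: "0 \<le> e" using assms(7) norm_ge_zero order_trans by blast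
  have R0: "0 \<le> R" using R norm_ge_zero order_trans by blast
  have gd: "norm (g x - g y) \<le> C * e"
    using lipschitz_onD[OF g, of x y] assms(7) C
    by (simp add: dist_norm) (meson mult_left_mono order_trans)
  have gy: "norm (g y) \<le> R + C"
    using norm_triangle_ineq2[of "g y" "g x"] gd R C e \<open>e \<le> 1\<close> mult_left_le[of e C]
    by (simp add: norm_minus_commute)
  have "g y \<bullet> (x - y) \<le> (R + C) * e"
    using norm_cauchy_schwarz[of "g y" "x - y"] mult_mono[OF gy assms(7)] R0 C by simp
  moreover have "C / 2 * (norm (x - y))\<^sup>2 \<le> C * e"
  proof -
    have "(norm (x - y))\<^sup>2 \<le> e * 1"
      unfolding power2_eq_square using assms(7) e \<open>e \<le> 1\<close> by (intro mult_mono) auto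
    then show ?thesis using mult_left_mono[of "(norm (x - y))\<^sup>2" e C] C e
      by (simp add: mult_nonneg_nonneg)
        (smt (verit) mult_nonneg_nonneg zero_le_power2)
  qed
  ultimately have "f x \<le> f y + (R + 2 * C) * e"
    using f[of x y] by (simp add: algebra_simps)
  then have 1: "a * f x \<le> a * f y + a * (R + 2 * C) * e"
    using mult_left_mono[of _ _ a] \<open>a \<ge> 0\<close> by (fastforce simp: algebra_simps)
  have "g x \<bullet> v - g y \<bullet> w = g x \<bullet> (v - w) + (g x - g y) \<bullet> w"
    by (simp add: algebra_simps)
  also have "\<dots> \<le> R * e + (C * e) * (R + 1)"
  proof (rule add_mono)
    show "g x \<bullet> (v - w) \<le> R * e"
      using norm_cauchy_schwarz[of "g x" "v - w"] mult_mono[OF R(2) assms(8)] R0 by simp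
    have "norm w \<le> R + 1"
      using norm_triangle_ineq2[of w v] R assms(8) \<open>e \<le> 1\<close> by (simp add: norm_minus_commute)
    then show "(g x - g y) \<bullet> w \<le> (C * e) * (R + 1)"
      using norm_cauchy_schwarz[of "g x - g y" w] mult_mono[OF gd, of "norm w" "R + 1"] C e by simp
  qed
  finally have 2: "g x \<bullet> v \<le> g y \<bullet> w + (C * (R + 1) + R) * e" by (simp add: algebra_simps)
  have "(norm v)\<^sup>2 - (norm w)\<^sup>2 = 2 * (v \<bullet> (v - w)) - (norm (v - w))\<^sup>2"
    by (simp add: power2_norm_eq_inner algebra_simps inner_commute)
  also have "\<dots> \<le> 2 * (R * e)"
    using norm_cauchy_schwarz[of v "v - w"] mult_mono[OF R(1) assms(8)] R0
    by (smt (verit) norm_ge_zero zero_le_power2)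
  finally have 3: "b * (norm v)\<^sup>2 \<le> b * (norm w)\<^sup>2 + 2 * b * R * e"
    using mult_left_mono[of "(norm v)\<^sup>2 - (norm w)\<^sup>2" "2 * (R * e)" b] \<open>b \<ge> 0\<close>
    by (simp add: algebra_simps)
  show ?thesis using 1 2 3 by (simp add: energy_def algebra_simps)
qed

text \<open>\<open>c\<close> stands for the noise level at the left end of a cell and
  \<open>\<rho>\<close> for its oscillation on the cell, so that \<open>h * (c + \<rho>)^2\<close>
  bounds the second moment of the noise increment. The coefficients of order \<open>h\<close> must
  come out without loss; only terms of order \<open>h * (h + \<rho>)\<close> may go into the
  error.\<close>

lemma energy_drift:
  fixes f :: "'a::euclidean_space \<Rightarrow> real"
  assumes f: "\<And>x y. f y \<le> f x + g x \<bullet> (y - x) + s\<^sup>2 / 2 * (norm (y - x))\<^sup>2"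
    and g: "(s\<^sup>2)-lipschitz_on UNIV g" and "s > 0" "r \<ge> 0"
    and r: "r\<^sup>2 = s\<^sup>2 - L + s * \<sigma> / 4"
    and x: "2 * L * f x \<le> (norm (g x))\<^sup>2" "c\<^sup>2 \<le> \<sigma> * f x" "0 \<le> c" "c \<le> R"
    and R: "norm v \<le> R" "norm (g x) \<le> R"
    and h: "0 \<le> h" and \<rho>: "0 \<le> \<rho>" "\<rho> \<le> 1" and "0 \<le> \<mu>"
    and \<mu>: "\<mu> = 2 * s - r" and m: "m = 2 * (s - r)"
  shows "energy (s + r) (s / 2) f g (x + h *\<^sub>R v) (v - h *\<^sub>R (\<mu> *\<^sub>R v + g x))
      + s / 2 * (h * (c + \<rho>)\<^sup>2)
    \<le> (1 - m * h) * energy (s + r) (s / 2) f g x v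
      + h * ((s + r) * s\<^sup>2 * R\<^sup>2 + s\<^sup>2 * (\<mu> + 1) * R\<^sup>2 + s * (\<mu> + 1)\<^sup>2 * R\<^sup>2 + s * (2 * R + 1)) * (h + \<rho>)"
proof -
  define y where "y = x + h *\<^sub>R v"
  define w where "w = \<mu> *\<^sub>R v + g x"
  have R0: "0 \<le> R" using R norm_ge_zero order_trans by blast
  have v2: "(norm v)\<^sup>2 \<le> R\<^sup>2" using R by (simp add: power_mono)
  have w: "norm w \<le> (\<mu> + 1) * R"
  proof -
    have "norm w \<le> \<mu> * norm v + norm (g x)"
      using norm_triangle_ineq[of "\<mu> *\<^sub>R v" "g x"] \<open>0 \<le> \<mu>\<close> by (simp add: w_def)
    also have "\<dots> \<le> \<mu> * R + R" using R \<open>0 \<le> \<mu>\<close> by (intro add_mono mult_left_mono)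
    finally show ?thesis by (simp add: algebra_simps)
  qed
  have gd: "norm (g y - g x) \<le> s\<^sup>2 * (h * norm v)"
    using lipschitz_onD[OF g, of y x] h by (simp add: dist_norm y_def)
  have "f y \<le> f x + h * (g x \<bullet> v) + s\<^sup>2 / 2 * (h\<^sup>2 * (norm v)\<^sup>2)"
    using f[of y x] h by (simp add: y_def power_mult_distrib)
  also have "\<dots> \<le> f x + h * (g x \<bullet> v) + s\<^sup>2 * (h\<^sup>2 * R\<^sup>2)"
  proof -
    have "s\<^sup>2 / 2 * (h\<^sup>2 * (norm v)\<^sup>2) \<le> s\<^sup>2 * (h\<^sup>2 * R\<^sup>2)"
      using v2 by (intro mult_mono) auto
    then show ?thesis by simp
  qed
  finally have 1: "(s + r) * f y \<le> (s + r) * (f x + h * (g x \<bullet> v) + s\<^sup>2 * (h\<^sup>2 * R\<^sup>2))"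
    using assms(3,4) by (intro mult_left_mono) auto
  have "g y \<bullet> (v - h *\<^sub>R w)
      = g x \<bullet> v + (g y - g x) \<bullet> v - h * (g x \<bullet> w) - h * ((g y - g x) \<bullet> w)"
    by (simp add: algebra_simps)
  \<comment> \<open>Tested against \<open>v\<close>, the change of the gradient is of order
    \<open>h\<close> and uses the full constant \<open>s^2\<close>, so it cannot go into the error;
    tested against \<open>h *\<^sub>R w\<close> it has a second factor \<open>h\<close>.\<close>
  also have "\<dots> \<le> g x \<bullet> v + s\<^sup>2 * h * (norm v)\<^sup>2 - h * (g x \<bullet> w) + h * (s\<^sup>2 * h * R * ((\<mu> + 1) * R))"
  proof -
    have "(g y - g x) \<bullet> v \<le> s\<^sup>2 * (h * norm v) * norm v"
      using norm_cauchy_schwarz[of "g y - g x" v] mult_right_mono[OF gd, of "norm v"] by simp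
    moreover have "- ((g y - g x) \<bullet> w) \<le> s\<^sup>2 * h * R * ((\<mu> + 1) * R)"
    proof -
      have "norm (g y - g x) \<le> s\<^sup>2 * h * R"
        using gd mult_left_mono[OF R(1), of "s\<^sup>2 * h"] h by (simp add: mult.assoc)
      then have "norm (g y - g x) * norm w \<le> s\<^sup>2 * h * R * ((\<mu> + 1) * R)"
        using w h R0 by (intro mult_mono) auto
      then show ?thesis using Cauchy_Schwarz_ineq2[of "g y - g x" w] by linarith
    qed
    from mult_left_mono[OF this h] have "- (h * ((g y - g x) \<bullet> w)) \<le> h * (s\<^sup>2 * h * R * ((\<mu> + 1) * R))"
      by simp
    ultimately show ?thesis by (simp add: power2_eq_square algebra_simps)
  qed
  finally have 2: "g y \<bullet> (v - h *\<^sub>R w)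
    \<le> g x \<bullet> v + s\<^sup>2 * h * (norm v)\<^sup>2 - h * (g x \<bullet> w) + h * (s\<^sup>2 * h * R * ((\<mu> + 1) * R))" .
  have "(norm (v - h *\<^sub>R w))\<^sup>2 = (norm v)\<^sup>2 - 2 * h * (v \<bullet> w) + h\<^sup>2 * (norm w)\<^sup>2"
    unfolding power2_norm_eq_inner by (simp add: power2_eq_square algebra_simps inner_commute)
  also have "\<dots> \<le> (norm v)\<^sup>2 - 2 * h * (v \<bullet> w) + h\<^sup>2 * ((\<mu> + 1) * R)\<^sup>2"
    using w by (intro add_left_mono mult_left_mono power_mono) auto
  finally have 3: "s / 2 * (norm (v - h *\<^sub>R w))\<^sup>2
      \<le> s / 2 * ((norm v)\<^sup>2 - 2 * h * (v \<bullet> w) + h\<^sup>2 * ((\<mu> + 1) * R)\<^sup>2)"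
    using \<open>s > 0\<close> by (intro mult_left_mono) auto
  have "(c + \<rho>)\<^sup>2 \<le> \<sigma> * f x + (2 * R + 1) * \<rho>"
  proof -
    have "(c + \<rho>)\<^sup>2 = c\<^sup>2 + (2 * c + \<rho>) * \<rho>" by (simp add: power2_eq_square algebra_simps)
    also have "\<dots> \<le> \<sigma> * f x + (2 * R + 1) * \<rho>"
      using x \<rho> by (intro add_mono mult_right_mono) auto
    finally show ?thesis .
  qed
  then have 4: "s / 2 * (h * (c + \<rho>)\<^sup>2) \<le> s / 2 * (h * (\<sigma> * f x + (2 * R + 1) * \<rho>))"
    using \<open>s > 0\<close> h by (intro mult_left_mono) auto
  have gw: "g x \<bullet> w = \<mu> * (g x \<bullet> v) + (norm (g x))\<^sup>2" "v \<bullet> w = \<mu> * (norm v)\<^sup>2 + g x \<bullet> v"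
    by (simp_all add: w_def power2_norm_eq_inner algebra_simps inner_commute)
  have 5: "h * (norm (g x))\<^sup>2 \<ge> h * (2 * L * f x)" using x h by (intro mult_left_mono)
  define F where "F = f x"
  define P where "P = g x \<bullet> v"
  define Q where "Q = (norm v)\<^sup>2"
  define N where "N = (norm (g x))\<^sup>2"
  have L: "L = s\<^sup>2 + s * \<sigma> / 4 - r\<^sup>2" using r by simp
  have "energy (s + r) (s / 2) f g y (v - h *\<^sub>R w) + s / 2 * (h * (c + \<rho>)\<^sup>2)
    \<le> (s + r) * (F + h * P + s\<^sup>2 * (h\<^sup>2 * R\<^sup>2))
      + (P + s\<^sup>2 * h * Q - h * (\<mu> * P) - h * (2 * L * F) + h * (s\<^sup>2 * h * R * ((\<mu> + 1) * R)))
      + s / 2 * (Q - 2 * h * (\<mu> * Q + P) + h\<^sup>2 * ((\<mu> + 1) * R)\<^sup>2)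
      + s / 2 * (h * (\<sigma> * F + (2 * R + 1) * \<rho>))"
    using 1 2 3 4 5 unfolding energy_def gw F_def P_def Q_def by (simp add: algebra_simps)
  \<comment> \<open>At order \<open>h\<close> the coefficients agree exactly: \<open>P\<close> has
    \<open>(s + r) - \<mu> - s = - m\<close>, \<open>Q\<close> has
    \<open>s^2 - s * \<mu> = - m * s / 2\<close>, and \<open>F\<close> has
    \<open>s * \<sigma> / 2 - 2 * L = - m * (s + r)\<close>.\<close>
  also have "\<dots> = (1 - m * h) * ((s + r) * F + P + s / 2 * Q)
      + h * ((s + r) * s\<^sup>2 * R\<^sup>2 * h + s\<^sup>2 * (\<mu> + 1) * R\<^sup>2 * h + s / 2 * (\<mu> + 1)\<^sup>2 * R\<^sup>2 * h + s / 2 * (2 * R + 1) * \<rho>)"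
    unfolding m \<mu> L by (simp add: field_simps power2_eq_square)
  also have "\<dots> \<le> (1 - m * h) * ((s + r) * F + P + s / 2 * Q)
      + h * ((s + r) * s\<^sup>2 * R\<^sup>2 * (h + \<rho>) + s\<^sup>2 * (\<mu> + 1) * R\<^sup>2 * (h + \<rho>) + s * (\<mu> + 1)\<^sup>2 * R\<^sup>2 * (h + \<rho>) + s * (2 * R + 1) * (h + \<rho>))"
    using h \<rho> R0 assms(3,4) \<open>0 \<le> \<mu>\<close> by (intro add_left_mono mult_left_mono add_mono mult_mono) auto
  also have "\<dots> = (1 - m * h) * energy (s + r) (s / 2) f g x v
      + h * ((s + r) * s\<^sup>2 * R\<^sup>2 + s\<^sup>2 * (\<mu> + 1) * R\<^sup>2 + s * (\<mu> + 1)\<^sup>2 * R\<^sup>2 + s * (2 * R + 1)) * (h + \<rho>)"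
    unfolding energy_def F_def P_def Q_def by (simp add: algebra_simps)
  finally show ?thesis unfolding y_def w_def .
qed

subsection \<open>Brownian increments\<close>

lemma borel_measurable_vec_nth' [measurable]:
  fixes h :: "'w \<Rightarrow> 'a::topological_space ^ 'n"
  assumes "h \<in> borel_measurable N" shows "(\<lambda>\<omega>. h \<omega> $ i) \<in> borel_measurable N"
  using assms
  by (rule measurable_compose) (intro borel_measurable_continuous_onI continuous_intros)

lemma borel_measurable_matrix_vector_mult [measurable]:
  fixes h :: "'w \<Rightarrow> real^'e^'d" and w :: "'w \<Rightarrow> real^'e"
  assumes "h \<in> borel_measurable N" "w \<in> borel_measurable N"
  shows "(\<lambda>\<omega>. h \<omega> *v w \<omega>) \<in> borel_measurable N"
proof -
  have hw: "(\<lambda>\<omega>. (h \<omega>, w \<omega>)) \<in> borel_measurable N"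
    using assms by simp
  have "(\<lambda>p. fst p *v snd p :: real^'d) \<in> borel_measurable (borel :: ((real^'e^'d) \<times> (real^'e)) measure)"
    unfolding matrix_vector_mult_def by (intro borel_measurable_continuous_onI continuous_intros)
  from measurable_compose[OF hw this] show ?thesis by simp
qed

lemma norm_matrix_eq_sum: "(norm (A :: real^'e^'d))\<^sup>2 = (\<Sum>i\<in>UNIV. \<Sum>j\<in>UNIV. (A $ i $ j)\<^sup>2)"
  by (simp add: norm_vec_def L2_set_def sum_nonneg)

lemma component_le_norm_matrix: "\<bar>A $ i $ j\<bar> \<le> norm (A :: real^'e^'d)"
  using component_le_norm_cart[of "A $ i" j] Finite_Cartesian_Product.norm_nth_le[of A i] by linarith

lemma inner_matrix_vector_mult:
  "u \<bullet> ((A :: real^'e^'d) *v w) = (\<Sum>i\<in>UNIV. \<Sum>j\<in>UNIV. u $ i * A $ i $ j * w $ j)"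
  by (simp add: inner_vec_def matrix_vector_mult_def sum_distrib_left mult.assoc)

lemma norm_matrix_vector_mult_sq:
  "(norm ((A :: real^'e^'d) *v w))\<^sup>2
    = (\<Sum>i\<in>UNIV. \<Sum>j\<in>UNIV. \<Sum>l\<in>UNIV. A $ i $ j * A $ i $ l * (w $ j * w $ l))"
proof -
  have "(norm (A *v w))\<^sup>2 = (\<Sum>i\<in>UNIV. (\<Sum>j\<in>UNIV. A $ i $ j * w $ j) * (\<Sum>l\<in>UNIV. A $ i $ l * w $ l))"
    by (simp add: power2_norm_eq_inner inner_vec_def matrix_vector_mult_def)
  also have "\<dots> = (\<Sum>i\<in>UNIV. \<Sum>j\<in>UNIV. \<Sum>l\<in>UNIV. A $ i $ j * A $ i $ l * (w $ j * w $ l))"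
    unfolding sum_product by (intro sum.cong refl) (simp only: mult_ac)
  finally show ?thesis .
qed

locale filtered_brownian_motion =
  fixes M :: "'w measure" and F :: "real \<Rightarrow> 'w measure" and W :: "real \<Rightarrow> 'w \<Rightarrow> real^'e"
  assumes fil: "filtered_prob_space M F" and bm: "standard_brownian_motion M F W"
begin

sublocale prob_space M
  using fil by (simp add: filtered_prob_space_def)

lemma subalg: "0 \<le> t \<Longrightarrow> subalgebra M (F t)"
  using fil by (simp add: filtered_prob_space_def)

lemma space_F: "0 \<le> t \<Longrightarrow> space (F t) = space M"
  using subalg by (simp add: subalgebra_def)

lemma sets_F_subset: "0 \<le> t \<Longrightarrow> sets (F t) \<subseteq> sets M"
  using subalg by (simp add: subalgebra_def)

lemma sets_F_mono: "0 \<le> s \<Longrightarrow> s \<le> t \<Longrightarrow> sets (F s) \<subseteq> sets (F t)"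
  using fil by (simp add: filtered_prob_space_def)

lemma measurable_FD: "h \<in> measurable (F t) N \<Longrightarrow> 0 \<le> t \<Longrightarrow> h \<in> measurable M N"
  using subalg measurable_from_subalg by blast

lemma measurable_F_mono: "h \<in> measurable (F s) N \<Longrightarrow> 0 \<le> s \<Longrightarrow> s \<le> t \<Longrightarrow> h \<in> measurable (F t) N"
  using sets_F_mono space_F unfolding measurable_def by fastforce

lemma W_measurable: "0 \<le> t \<Longrightarrow> W t \<in> borel_measurable (F t)"
  using bm by (simp add: standard_brownian_motion_def adapted_def)

lemma increment_measurable: "0 \<le> s \<Longrightarrow> s \<le> t \<Longrightarrow> (\<lambda>\<omega>. W t \<omega> - W s \<omega>) \<in> borel_measurable (F t)"
  using measurable_F_mono[OF W_measurable, of s t] W_measurable[of t] by (intro borel_measurable_diff) auto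

text \<open>Both generated sigma-algebras are contained in the two families whose independence is
  part of the definition of Brownian motion.\<close>

lemma increment_indep:
  assumes st: "0 \<le> s" "s < t" and U: "(U :: 'w \<Rightarrow> real) \<in> borel_measurable (F s)"
    and p: "(p :: real^'e \<Rightarrow> real) \<in> borel_measurable borel"
  shows "indep_var borel U borel (\<lambda>\<omega>. p (W t \<omega> - W s \<omega>))"
proof -
  let ?D = "\<lambda>\<omega>. W t \<omega> - W s \<omega>"
  let ?A = "{?D -` A \<inter> space M | A. A \<in> sets borel}"
  have ind: "indep_set (sets (F s)) ?A"
    using bm st by (simp add: standard_brownian_motion_def)
  have mU: "U \<in> borel_measurable M" using U st measurable_FD by auto
  have mD: "?D \<in> borel_measurable M" using measurable_FD[OF increment_measurable[of s t]] st by auto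
  have 1: "sigma_sets (space M) {U -` A \<inter> space M | A. A \<in> sets borel} \<subseteq> sets (F s)"
  proof -
    have "{U -` A \<inter> space M | A. A \<in> sets borel} \<subseteq> sets (F s)"
      using measurable_sets[OF U] space_F[of s] st by auto
    then show ?thesis using sets.sigma_sets_subset[of _ "F s"] space_F[of s] st by simp
  qed
  have 2: "sigma_sets (space M) {(\<lambda>\<omega>. p (?D \<omega>)) -` A \<inter> space M | A. A \<in> sets borel} \<subseteq> ?A"
  proof -
    \<comment> \<open>The preimages under the increment already form a sigma-algebra, so generating
      one from a subfamily stays inside.\<close>
    have sa: "?A = sets (vimage_algebra (space M) ?D borel)"
      by (auto simp: sets_vimage_algebra2)
    have "{(\<lambda>\<omega>. p (?D \<omega>)) -` A \<inter> space M | A. A \<in> sets borel} \<subseteq> ?A"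
    proof safe
      fix A :: "real set" assume "A \<in> sets borel"
      then have "p -` A \<in> sets borel" using measurable_sets[OF p] by simp
      then show "\<exists>B. (\<lambda>\<omega>. p (?D \<omega>)) -` A \<inter> space M = ?D -` B \<inter> space M \<and> B \<in> sets borel"
        by (intro exI[of _ "p -` A"]) auto
    qed
    then show ?thesis
      using sets.sigma_sets_subset[of _ "vimage_algebra (space M) ?D borel"] unfolding sa by simp
  qed
  show ?thesis
    unfolding indep_var_eq indep_set_def
    using mU mD p indep_sets_mono_sets[OF ind[unfolded indep_set_def]] 1 2
    by (auto split: bool.split simp: subset_iff)
qed

lemma increment_moments:
  assumes st: "0 \<le> s" "s < t"
  shows "integrable M (\<lambda>\<omega>. (W t \<omega> - W s \<omega>) $ i)" "expectation (\<lambda>\<omega>. (W t \<omega> - W s \<omega>) $ i) = 0"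
    and "integrable M (\<lambda>\<omega>. (W t \<omega> - W s \<omega>) $ i * (W t \<omega> - W s \<omega>) $ j)"
    and "expectation (\<lambda>\<omega>. (W t \<omega> - W s \<omega>) $ i * (W t \<omega> - W s \<omega>) $ j) = (if i = j then t - s else 0)"
proof -
  let ?D = "\<lambda>i \<omega>. (W t \<omega> - W s \<omega>) $ i"
  let ?\<sigma> = "sqrt (t - s)"
  have \<sigma>: "0 < ?\<sigma>" using st by simp
  have dist: "distributed M lborel (?D i) (normal_density 0 ?\<sigma>)" for i
    using bm st by (auto simp: standard_brownian_motion_def)
  have ind: "indep_vars (\<lambda>_. borel) ?D UNIV"
    using bm st by (auto simp: standard_brownian_motion_def)
  have int: "integrable M (?D i)" for i
    using distributed_integrable[OF dist[of i], of "\<lambda>x. x"] integrable_normal_moment_nz_1[OF \<sigma>, of 0]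
    by simp
  have e: "expectation (?D i) = 0" for i
    using normal_distributed_expectation[OF \<sigma> dist[of i]] .
  show "integrable M (?D i)" "expectation (?D i) = 0" by (rule int, rule e)
  have sq: "integrable M (\<lambda>\<omega>. (?D i \<omega>)\<^sup>2)" for i
    using distributed_integrable[OF dist[of i], of "\<lambda>x. x\<^sup>2"] integrable_normal_moment[OF \<sigma>, of 0 2]
    by simp
  have sqe: "expectation (\<lambda>\<omega>. (?D i \<omega>)\<^sup>2) = t - s" for i
    using normal_distributed_variance[OF \<sigma> dist[of i]] e[of i] st by simp
  have "integrable M (\<lambda>\<omega>. ?D i \<omega> * ?D j \<omega>) \<and> expectation (\<lambda>\<omega>. ?D i \<omega> * ?D j \<omega>) = (if i = j then t - s else 0)"
  proof (cases "i = j")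
    case True
    then show ?thesis using sq[of i] sqe[of i] by (simp add: power2_eq_square)
  next
    case False
    have ind2: "indep_vars (\<lambda>_. borel) ?D {i, j}"
      using ind by (rule indep_vars_subset) simp
    have "integrable M (\<lambda>\<omega>. \<Prod>k\<in>{i,j}. ?D k \<omega>)"
      by (rule indep_vars_integrable[OF _ ind2]) (use int in auto)
    moreover have "expectation (\<lambda>\<omega>. \<Prod>k\<in>{i,j}. ?D k \<omega>) = (\<Prod>k\<in>{i,j}. expectation (?D k))"
      by (rule indep_vars_lebesgue_integral[OF _ ind2]) (use int in auto)
    ultimately show ?thesis using False e by simp
  qed
  then show "integrable M (\<lambda>\<omega>. ?D i \<omega> * ?D j \<omega>)"
    "expectation (\<lambda>\<omega>. ?D i \<omega> * ?D j \<omega>) = (if i = j then t - s else 0)" by auto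
qed

text \<open>Conditional mean zero and conditional covariance \<open>t - s\<close> times the
  identity, expressed through integrable test variables \<open>U\<close> of the past instead of
  conditional expectations.\<close>

lemma increment_mult:
  assumes st: "0 \<le> s" "s \<le> t" and U: "(U :: 'w \<Rightarrow> real) \<in> borel_measurable (F s)" "integrable M U"
  shows "integrable M (\<lambda>\<omega>. U \<omega> * (W t \<omega> - W s \<omega>) $ i)"
    "expectation (\<lambda>\<omega>. U \<omega> * (W t \<omega> - W s \<omega>) $ i) = 0"
    "integrable M (\<lambda>\<omega>. U \<omega> * ((W t \<omega> - W s \<omega>) $ i * (W t \<omega> - W s \<omega>) $ j))"
    "expectation (\<lambda>\<omega>. U \<omega> * ((W t \<omega> - W s \<omega>) $ i * (W t \<omega> - W s \<omega>) $ j))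
      = (if i = j then (t - s) * expectation U else 0)"
proof -
  let ?P = "integrable M (\<lambda>\<omega>. U \<omega> * (W t \<omega> - W s \<omega>) $ i)
      \<and> expectation (\<lambda>\<omega>. U \<omega> * (W t \<omega> - W s \<omega>) $ i) = 0
      \<and> integrable M (\<lambda>\<omega>. U \<omega> * ((W t \<omega> - W s \<omega>) $ i * (W t \<omega> - W s \<omega>) $ j))
      \<and> expectation (\<lambda>\<omega>. U \<omega> * ((W t \<omega> - W s \<omega>) $ i * (W t \<omega> - W s \<omega>) $ j))
      = (if i = j then (t - s) * expectation U else 0)"
  have "?P"
  \<comment> \<open>The definition of Brownian motion speaks of \<open>s < t\<close> only, but cells
    of length zero do occur once a grid is clipped to an interval.\<close>
  proof (cases "s = t")
    case True then show ?thesis by simp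
  next
    case False
    then have that: "s < t" using st by simp
    note m = increment_moments[OF st(1) that]
    have i1: "indep_var borel U borel (\<lambda>\<omega>. (W t \<omega> - W s \<omega>) $ i)"
      by (rule increment_indep[OF st(1) that U(1), of "\<lambda>w. w $ i"]) simp
    have i2: "indep_var borel U borel (\<lambda>\<omega>. (W t \<omega> - W s \<omega>) $ i * (W t \<omega> - W s \<omega>) $ j)"
      by (rule increment_indep[OF st(1) that U(1), of "\<lambda>w. w $ i * w $ j"]) simp
    show ?thesis
      using indep_var_integrable[OF i1 U(2) m(1)] indep_var_lebesgue_integral[OF i1 U(2) m(1)]
        indep_var_integrable[OF i2 U(2) m(3)] indep_var_lebesgue_integral[OF i2 U(2) m(3)] m(2,4)
      by auto
  qed
  then show "integrable M (\<lambda>\<omega>. U \<omega> * (W t \<omega> - W s \<omega>) $ i)"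
    "expectation (\<lambda>\<omega>. U \<omega> * (W t \<omega> - W s \<omega>) $ i) = 0"
    "integrable M (\<lambda>\<omega>. U \<omega> * ((W t \<omega> - W s \<omega>) $ i * (W t \<omega> - W s \<omega>) $ j))"
    "expectation (\<lambda>\<omega>. U \<omega> * ((W t \<omega> - W s \<omega>) $ i * (W t \<omega> - W s \<omega>) $ j))
      = (if i = j then (t - s) * expectation U else 0)" by auto
qed

lemma matrix_increment_mean:
  fixes \<eta> :: "'w \<Rightarrow> real^'e^'d" and U :: "'w \<Rightarrow> real^'d"
  assumes st: "0 \<le> s" "s \<le> t" and \<eta>: "\<eta> \<in> borel_measurable (F s)" "\<And>\<omega>. \<omega> \<in> space M \<Longrightarrow> norm (\<eta> \<omega>) \<le> K"
    and U: "U \<in> borel_measurable (F s)" "integrable M (\<lambda>\<omega>. norm (U \<omega>))"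
  shows "integrable M (\<lambda>\<omega>. U \<omega> \<bullet> (\<eta> \<omega> *v (W t \<omega> - W s \<omega>)))"
    and "expectation (\<lambda>\<omega>. U \<omega> \<bullet> (\<eta> \<omega> *v (W t \<omega> - W s \<omega>))) = 0"
proof -
  have meas: "(\<lambda>\<omega>. U \<omega> $ i * \<eta> \<omega> $ i $ j) \<in> borel_measurable (F s)" for i j
    using U(1) \<eta>(1) by measurable
  have int: "integrable M (\<lambda>\<omega>. U \<omega> $ i * \<eta> \<omega> $ i $ j)" for i j
  proof (rule Bochner_Integration.integrable_bound[OF integrable_mult_right[OF U(2), of K]])
    show "(\<lambda>\<omega>. U \<omega> $ i * \<eta> \<omega> $ i $ j) \<in> borel_measurable M"
      using meas st(1) by (rule measurable_FD)
    show "AE \<omega> in M. norm (U \<omega> $ i * \<eta> \<omega> $ i $ j) \<le> norm (K * norm (U \<omega>))"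
    proof (rule AE_I2)
      fix \<omega> assume w: "\<omega> \<in> space M"
      have "\<bar>U \<omega> $ i\<bar> * \<bar>\<eta> \<omega> $ i $ j\<bar> \<le> norm (U \<omega>) * K"
        using component_le_norm_cart[of "U \<omega>" i] component_le_norm_matrix[of "\<eta> \<omega>" i j] \<eta>(2)[OF w]
        by (intro mult_mono) auto
      then show "norm (U \<omega> $ i * \<eta> \<omega> $ i $ j) \<le> norm (K * norm (U \<omega>))"
        by (simp add: abs_mult mult.commute)
          (smt (verit) abs_ge_self mult_right_mono norm_ge_zero)
    qed
  qed
  note * = increment_mult[OF st meas int]
  show "integrable M (\<lambda>\<omega>. U \<omega> \<bullet> (\<eta> \<omega> *v (W t \<omega> - W s \<omega>)))"
    unfolding inner_matrix_vector_mult by (intro Bochner_Integration.integrable_sum *(1))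
  show "expectation (\<lambda>\<omega>. U \<omega> \<bullet> (\<eta> \<omega> *v (W t \<omega> - W s \<omega>))) = 0"
    unfolding inner_matrix_vector_mult
    by (simp only: Bochner_Integration.integral_sum Bochner_Integration.integrable_sum *(1,2) sum.neutral_const)
qed

text \<open>The bounded weight \<open>\<beta>\<close> of the past takes the place of conditioning.
  Distinct coordinates of the increment are uncorrelated, and the diagonal terms add up to the
  Frobenius norm.\<close>

lemma matrix_increment_variance:
  fixes \<eta> :: "'w \<Rightarrow> real^'e^'d" and \<beta> :: "'w \<Rightarrow> real"
  assumes st: "0 \<le> s" "s \<le> t" and \<eta>: "\<eta> \<in> borel_measurable (F s)" "\<And>\<omega>. \<omega> \<in> space M \<Longrightarrow> norm (\<eta> \<omega>) \<le> K"
    and \<beta>: "\<beta> \<in> borel_measurable (F s)" "\<And>\<omega>. \<omega> \<in> space M \<Longrightarrow> \<bar>\<beta> \<omega>\<bar> \<le> 1"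
  shows "integrable M (\<lambda>\<omega>. \<beta> \<omega> * (norm (\<eta> \<omega> *v (W t \<omega> - W s \<omega>)))\<^sup>2)"
    and "expectation (\<lambda>\<omega>. \<beta> \<omega> * (norm (\<eta> \<omega> *v (W t \<omega> - W s \<omega>)))\<^sup>2)
      = (t - s) * expectation (\<lambda>\<omega>. \<beta> \<omega> * (norm (\<eta> \<omega>))\<^sup>2)"
proof -
  let ?w = "\<lambda>\<omega>. W t \<omega> - W s \<omega>"
  let ?u = "\<lambda>i j l \<omega>. \<beta> \<omega> * (\<eta> \<omega> $ i $ j * \<eta> \<omega> $ i $ l)"
  have meas: "?u i j l \<in> borel_measurable (F s)" for i j l
    using \<beta>(1) \<eta>(1) by measurable
  have int: "integrable M (?u i j l)" for i j l
  proof (rule integrable_const_bound[where B = "K\<^sup>2"])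
    show "?u i j l \<in> borel_measurable M"
      using meas st(1) by (rule measurable_FD)
    show "AE \<omega> in M. norm (?u i j l \<omega>) \<le> K\<^sup>2"
    proof (rule AE_I2)
      fix \<omega> assume w: "\<omega> \<in> space M"
      have ee: "\<bar>\<eta> \<omega> $ i $ j\<bar> * \<bar>\<eta> \<omega> $ i $ l\<bar> \<le> K * K"
        using component_le_norm_matrix[of "\<eta> \<omega>" i j] component_le_norm_matrix[of "\<eta> \<omega>" i l] \<eta>(2)[OF w]
        by (intro mult_mono) auto
      then have "\<bar>\<beta> \<omega>\<bar> * (\<bar>\<eta> \<omega> $ i $ j\<bar> * \<bar>\<eta> \<omega> $ i $ l\<bar>) \<le> 1 * (K * K)"
        using mult_mono[OF \<beta>(2)[OF w] ee] by simp
      then show "norm (?u i j l \<omega>) \<le> K\<^sup>2"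
        by (simp add: abs_mult power2_eq_square)
    qed
  qed
  note * = increment_mult[OF st meas int]
  have eq: "\<beta> \<omega> * (norm (\<eta> \<omega> *v ?w \<omega>))\<^sup>2
      = (\<Sum>i\<in>UNIV. \<Sum>j\<in>UNIV. \<Sum>l\<in>UNIV. ?u i j l \<omega> * (?w \<omega> $ j * ?w \<omega> $ l))" for \<omega>
    unfolding norm_matrix_vector_mult_sq by (simp add: sum_distrib_left mult.assoc)
  show "integrable M (\<lambda>\<omega>. \<beta> \<omega> * (norm (\<eta> \<omega> *v (W t \<omega> - W s \<omega>)))\<^sup>2)"
    unfolding eq by (intro Bochner_Integration.integrable_sum *(3))
  have "expectation (\<lambda>\<omega>. \<beta> \<omega> * (norm (\<eta> \<omega> *v (W t \<omega> - W s \<omega>)))\<^sup>2)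
      = (\<Sum>i\<in>UNIV. \<Sum>j\<in>UNIV. \<Sum>l\<in>UNIV. if j = l then (t - s) * expectation (?u i j l) else 0)"
    unfolding eq
    by (simp only: Bochner_Integration.integral_sum Bochner_Integration.integrable_sum *(3,4))
  also have "\<dots> = (t - s) * (\<Sum>i\<in>UNIV. \<Sum>j\<in>UNIV. expectation (?u i j j))"
    by (simp add: sum_distrib_left)
  also have "(\<Sum>i\<in>UNIV. \<Sum>j\<in>UNIV. expectation (?u i j j)) = expectation (\<lambda>\<omega>. \<beta> \<omega> * (norm (\<eta> \<omega>))\<^sup>2)"
    unfolding norm_matrix_eq_sum
    by (simp add: sum_distrib_left power2_eq_square Bochner_Integration.integral_sum
        Bochner_Integration.integrable_sum int)
  finally show "expectation (\<lambda>\<omega>. \<beta> \<omega> * (norm (\<eta> \<omega> *v (W t \<omega> - W s \<omega>)))\<^sup>2)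
      = (t - s) * expectation (\<lambda>\<omega>. \<beta> \<omega> * (norm (\<eta> \<omega>))\<^sup>2)" .
qed

end

subsection \<open>Integrals of elementary processes\<close>

lemma borel_measurable_Pair_swap':
  "(\<lambda>(s, \<omega>). f s \<omega>) \<in> borel_measurable (A \<Otimes>\<^sub>M B) \<Longrightarrow> (\<lambda>(\<omega>, s). f s \<omega>) \<in> borel_measurable (B \<Otimes>\<^sub>M A)"
  using measurable_pair_swap_iff[of "\<lambda>(s, \<omega>). f s \<omega>" A B borel] by (simp add: split_beta')

lemma mono_on_steps:
  fixes \<tau> :: "nat \<Rightarrow> real"
  assumes "\<And>i. i < n \<Longrightarrow> \<tau> i \<le> \<tau> (Suc i)" "i \<le> j" "j \<le> n"
  shows "\<tau> i \<le> \<tau> j"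
  using assms(2,3)
proof (induction j rule: dec_induct)
  case (step j)
  then show ?case using assms(1)[of j] by simp
qed simp

lemma elementary_value_in_cell:
  assumes "\<And>i. i < n \<Longrightarrow> \<tau> i \<le> \<tau> (Suc i)" "i < n" "u \<in> {\<tau> i<..\<tau> (Suc i)}"
  shows "elementary_value n \<tau> \<xi> u \<omega> = \<xi> i \<omega>"
proof -
  have "indicator {\<tau> j<..\<tau> (Suc j)} u *\<^sub>R \<xi> j \<omega> = (if j = i then \<xi> i \<omega> else 0)" if "j < n" for j
  proof (cases j i rule: linorder_cases)
    case less
    then show ?thesis using mono_on_steps[of n \<tau> "Suc j" i] assms by (auto simp: indicator_def)
  next
    case greater
    then show ?thesis using mono_on_steps[of n \<tau> "Suc i" j] assms that by (auto simp: indicator_def)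
  qed (use assms in auto)
  then show ?thesis using assms(2) by (simp add: elementary_value_def sum.delta)
qed

lemma nn_integral_elementary_value:
  assumes mono: "\<And>i. i < n \<Longrightarrow> \<tau> i \<le> \<tau> (Suc i)" and nonneg: "\<And>i. i < n \<Longrightarrow> 0 \<le> a i \<omega>"
  shows "(\<integral>\<^sup>+u. ennreal (elementary_value n \<tau> a u \<omega>) \<partial>lborel)
    = ennreal (\<Sum>i<n. (\<tau> (Suc i) - \<tau> i) * a i \<omega>)"
proof -
  have "ennreal (elementary_value n \<tau> a u \<omega>)
      = (\<Sum>i<n. ennreal (a i \<omega>) * indicator {\<tau> i<..\<tau> (Suc i)} u)" for u
  proof -
    have "ennreal (elementary_value n \<tau> a u \<omega>)
        = (\<Sum>i<n. ennreal (indicator {\<tau> i<..\<tau> (Suc i)} u *\<^sub>R a i \<omega>))"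
      unfolding elementary_value_def by (rule sum_ennreal[symmetric]) (use nonneg in auto)
    also have "\<dots> = (\<Sum>i<n. ennreal (a i \<omega>) * indicator {\<tau> i<..\<tau> (Suc i)} u)"
      by (intro sum.cong refl) (auto simp: indicator_def)
    finally show ?thesis .
  qed
  then have "(\<integral>\<^sup>+u. ennreal (elementary_value n \<tau> a u \<omega>) \<partial>lborel)
      = (\<Sum>i<n. \<integral>\<^sup>+u. ennreal (a i \<omega>) * indicator {\<tau> i<..\<tau> (Suc i)} u \<partial>lborel)"
    by (simp only:) (rule nn_integral_sum, simp)
  also have "\<dots> = (\<Sum>i<n. ennreal (a i \<omega>) * ennreal (\<tau> (Suc i) - \<tau> i))"
    using mono by (intro sum.cong refl) (subst nn_integral_cmult_indicator, auto)
  also have "\<dots> = (\<Sum>i<n. ennreal ((\<tau> (Suc i) - \<tau> i) * a i \<omega>))"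
    using mono nonneg by (intro sum.cong refl) (simp add: ennreal_mult'' mult.commute)
  also have "\<dots> = ennreal (\<Sum>i<n. (\<tau> (Suc i) - \<tau> i) * a i \<omega>)"
    by (rule sum_ennreal) (use mono nonneg in auto)
  finally show ?thesis .
qed

section \<open>Radial projection onto a closed ball\<close>

definition proj_ball :: "'a::euclidean_space \<Rightarrow> real \<Rightarrow> 'a \<Rightarrow> 'a" where
  "proj_ball c \<rho> z = c + min 1 (\<rho> / norm (z - c)) *\<^sub>R (z - c)"

lemma proj_ball_dist:
  assumes "0 \<le> \<rho>"
  shows "norm (proj_ball c \<rho> z - c) \<le> \<rho>"
proof (cases "z = c")
  case False
  have "norm (proj_ball c \<rho> z - c) = min 1 (\<rho> / norm (z - c)) * norm (z - c)"
    using assms by (simp add: proj_ball_def)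
  also have "\<dots> \<le> \<rho> / norm (z - c) * norm (z - c)"
    by (intro mult_right_mono) auto
  finally show ?thesis using False by simp
qed (use assms in \<open>simp add: proj_ball_def\<close>)

lemma proj_ball_norm: "0 \<le> \<rho> \<Longrightarrow> norm (proj_ball c \<rho> z) \<le> norm c + \<rho>"
  using proj_ball_dist[of \<rho> c z] norm_triangle_ineq2[of "proj_ball c \<rho> z" c] by simp

text \<open>A point \<open>z\<close> outside the ball has distance
  \<open>norm (z - c) - \<rho>\<close> from it. With the true integrand as \<open>y\<close>, what
  the projection removes is bounded by the approximation error.\<close>

lemma proj_ball_nearest:
  assumes "norm (y - c) \<le> \<rho>"
  shows "norm (z - proj_ball c \<rho> z) \<le> norm (z - y)"
proof (cases "norm (z - c) \<le> \<rho>")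
  case True
  then show ?thesis by (cases "z = c") (auto simp: proj_ball_def min_def field_simps)
next
  case False
  have \<rho>: "0 \<le> \<rho>" using assms norm_ge_zero order_trans by blast
  let ?d = "norm (z - c)"
  have d: "0 < ?d" "\<rho> < ?d" using False \<rho> by linarith+
  have "z - proj_ball c \<rho> z = (1 - \<rho> / ?d) *\<^sub>R (z - c)"
    using d by (simp add: proj_ball_def min_def algebra_simps)
  then have "norm (z - proj_ball c \<rho> z) = (1 - \<rho> / ?d) * ?d"
    using d by (simp only: norm_scaleR) simp
  also have "\<dots> = ?d - \<rho>" using d by (simp add: field_simps)
  also have "\<dots> \<le> norm (z - y)"
    using norm_triangle_ineq[of "z - y" "y - c"] assms by simp
  finally show ?thesis .
qed

lemma borel_measurable_proj_ball [measurable]: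
  fixes c z :: "'w \<Rightarrow> 'a::euclidean_space"
  assumes [measurable]: "c \<in> borel_measurable N" "z \<in> borel_measurable N"
  shows "(\<lambda>\<omega>. proj_ball (c \<omega>) \<rho> (z \<omega>)) \<in> borel_measurable N"
  unfolding proj_ball_def by measurable

section \<open>Stochastic sums over a grid of deterministic times\<close>

definition brownian_sum ::
  "(real \<Rightarrow> 'w \<Rightarrow> real^'e) \<Rightarrow> nat \<Rightarrow> (nat \<Rightarrow> real) \<Rightarrow> (nat \<Rightarrow> 'w \<Rightarrow> real^'e^'d) \<Rightarrow> 'w \<Rightarrow> real^'d" where
  "brownian_sum W n \<sigma> \<eta> \<omega> = (\<Sum>i<n. \<eta> i \<omega> *v (W (\<sigma> (Suc i)) \<omega> - W (\<sigma> i) \<omega>))"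

context filtered_brownian_motion
begin

text \<open>In this part \<open>\<sigma>\<close> is a grid of times, not the noise constant of the
  theorem.\<close>

definition predictable_step :: "nat \<Rightarrow> (nat \<Rightarrow> real) \<Rightarrow> (nat \<Rightarrow> 'w \<Rightarrow> real^'e^'d) \<Rightarrow> bool" where
  "predictable_step n \<sigma> \<eta> \<longleftrightarrow> 0 \<le> \<sigma> 0 \<and> (\<forall>i<n. \<sigma> i \<le> \<sigma> (Suc i) \<and> \<eta> i \<in> borel_measurable (F (\<sigma> i)) \<and>
     (\<exists>K. \<forall>\<omega>\<in>space M. norm (\<eta> i \<omega>) \<le> K))"

lemma predictable_stepD:
  assumes "predictable_step n \<sigma> \<eta>"
  shows "i \<le> n \<Longrightarrow> 0 \<le> \<sigma> i" and "i \<le> n \<Longrightarrow> \<sigma> 0 \<le> \<sigma> i"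
    and "i < n \<Longrightarrow> \<sigma> i \<le> \<sigma> (Suc i)" and "i < n \<Longrightarrow> \<eta> i \<in> borel_measurable (F (\<sigma> i))"
    and "i < n \<Longrightarrow> \<exists>K. \<forall>\<omega>\<in>space M. norm (\<eta> i \<omega>) \<le> K"
proof -
  show mono: "i \<le> n \<Longrightarrow> \<sigma> 0 \<le> \<sigma> i"
    using assms mono_on_steps[of n \<sigma> 0 i] by (auto simp: predictable_step_def)
  then show "i \<le> n \<Longrightarrow> 0 \<le> \<sigma> i" using assms by (auto simp: predictable_step_def)
qed (use assms in \<open>auto simp: predictable_step_def\<close>)

lemma brownian_sum_measurable:
  assumes "predictable_step n \<sigma> \<eta>"
  shows "brownian_sum W n \<sigma> \<eta> \<in> borel_measurable (F (\<sigma> n))"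
proof -
  note P = predictable_stepD[OF assms]
  have "\<sigma> i \<le> \<sigma> n" if "i \<le> n" for i
    by (rule mono_on_steps[of n]) (use P(3) that in auto)
  then have "(\<lambda>\<omega>. \<eta> i \<omega> *v (W (\<sigma> (Suc i)) \<omega> - W (\<sigma> i) \<omega>)) \<in> borel_measurable (F (\<sigma> n))" if "i < n" for i
    using that P
    by (intro borel_measurable_matrix_vector_mult measurable_F_mono[OF P(4)]
        measurable_F_mono[OF increment_measurable]) auto
  then show ?thesis unfolding brownian_sum_def by (intro borel_measurable_sum) auto
qed

lemma brownian_sum_mean:
  fixes \<eta> :: "nat \<Rightarrow> 'w \<Rightarrow> real^'e^'d" and U :: "'w \<Rightarrow> real^'d"
  assumes P: "predictable_step n \<sigma> \<eta>" and s: "0 \<le> s" "s \<le> \<sigma> 0"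
    and U: "U \<in> borel_measurable (F s)" "integrable M (\<lambda>\<omega>. norm (U \<omega>))"
  shows "integrable M (\<lambda>\<omega>. U \<omega> \<bullet> brownian_sum W n \<sigma> \<eta> \<omega>)" "expectation (\<lambda>\<omega>. U \<omega> \<bullet> brownian_sum W n \<sigma> \<eta> \<omega>) = 0"
proof -
  note P' = predictable_stepD[OF P]
  have *: "integrable M (\<lambda>\<omega>. U \<omega> \<bullet> (\<eta> i \<omega> *v (W (\<sigma> (Suc i)) \<omega> - W (\<sigma> i) \<omega>))) \<and>
      expectation (\<lambda>\<omega>. U \<omega> \<bullet> (\<eta> i \<omega> *v (W (\<sigma> (Suc i)) \<omega> - W (\<sigma> i) \<omega>))) = 0" if i: "i < n" for i
  proof -
    obtain K where K: "\<And>\<omega>. \<omega> \<in> space M \<Longrightarrow> norm (\<eta> i \<omega>) \<le> K" using P'(5)[OF i] by blast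
    have "s \<le> \<sigma> i" using P'(2)[of i] i s by simp
    then have "U \<in> borel_measurable (F (\<sigma> i))" using U(1) s(1) measurable_F_mono by blast
    then show ?thesis
      using matrix_increment_mean[OF P'(1)[of i] P'(3)[OF i] P'(4)[OF i] K _ U(2)] i by simp
  qed
  have eq: "U \<omega> \<bullet> brownian_sum W n \<sigma> \<eta> \<omega> = (\<Sum>i<n. U \<omega> \<bullet> (\<eta> i \<omega> *v (W (\<sigma> (Suc i)) \<omega> - W (\<sigma> i) \<omega>)))" for \<omega>
    by (simp add: brownian_sum_def inner_sum_right)
  show "integrable M (\<lambda>\<omega>. U \<omega> \<bullet> brownian_sum W n \<sigma> \<eta> \<omega>)"
    unfolding eq by (intro Bochner_Integration.integrable_sum) (use * in auto)
  show "expectation (\<lambda>\<omega>. U \<omega> \<bullet> brownian_sum W n \<sigma> \<eta> \<omega>) = 0"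
    unfolding eq by (subst Bochner_Integration.integral_sum) (use * in auto)
qed

text \<open>Ito isometry with a weight known at the initial time. When the square of the sum is
  expanded at its last summand, the cross term has mean zero because \<open>\<beta>\<close> times
  the preceding sum is known when the last increment begins.\<close>

lemma brownian_sum_variance:
  fixes \<eta> :: "nat \<Rightarrow> 'w \<Rightarrow> real^'e^'d"
  assumes "predictable_step n \<sigma> \<eta>" and s: "0 \<le> s" "s \<le> \<sigma> 0"
    and \<beta>: "\<beta> \<in> borel_measurable (F s)" "\<And>\<omega>. \<omega> \<in> space M \<Longrightarrow> \<bar>\<beta> \<omega>\<bar> \<le> (1::real)"
  shows "integrable M (\<lambda>\<omega>. \<beta> \<omega> * (norm (brownian_sum W n \<sigma> \<eta> \<omega>))\<^sup>2) \<and>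
    expectation (\<lambda>\<omega>. \<beta> \<omega> * (norm (brownian_sum W n \<sigma> \<eta> \<omega>))\<^sup>2)
      = (\<Sum>i<n. (\<sigma> (Suc i) - \<sigma> i) * expectation (\<lambda>\<omega>. \<beta> \<omega> * (norm (\<eta> i \<omega>))\<^sup>2))"
  using assms(1) \<beta>
proof (induction n arbitrary: \<beta>)
  case 0
  then show ?case by (simp add: brownian_sum_def)
next
  case (Suc n)
  note P = predictable_stepD[OF Suc.prems(1)]
  have P0: "predictable_step n \<sigma> \<eta>" using Suc.prems(1) by (simp add: predictable_step_def)
  let ?N = "brownian_sum W n \<sigma> \<eta>"
  let ?D = "\<lambda>\<omega>. \<eta> n \<omega> *v (W (\<sigma> (Suc n)) \<omega> - W (\<sigma> n) \<omega>)"
  obtain K where K: "\<And>\<omega>. \<omega> \<in> space M \<Longrightarrow> norm (\<eta> n \<omega>) \<le> K" using P(5)[of n] by blast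
  have sn: "s \<le> \<sigma> n" using P(2)[of n] s by simp
  have \<beta>n: "\<beta> \<in> borel_measurable (F (\<sigma> n))" using Suc.prems(2) s(1) sn measurable_F_mono by blast
  have Nn: "?N \<in> borel_measurable (F (\<sigma> n))" by (rule brownian_sum_measurable[OF P0])
  \<comment> \<open>The induction runs over all weights because the weight \<open>1\<close> provides
    the square integrability that makes the cross term integrable.\<close>
  have "integrable M (\<lambda>\<omega>. 1 * (norm (?N \<omega>))\<^sup>2)"
    using Suc.IH[OF P0, of "\<lambda>_. 1"] by simp
  then have N2: "integrable M (\<lambda>\<omega>. (norm (?N \<omega>))\<^sup>2)" by simp
  have mU: "(\<lambda>\<omega>. \<beta> \<omega> *\<^sub>R ?N \<omega>) \<in> borel_measurable (F (\<sigma> n))"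
    using \<beta>n Nn by (rule borel_measurable_scaleR)
  have iU: "integrable M (\<lambda>\<omega>. norm (\<beta> \<omega> *\<^sub>R ?N \<omega>))"
  proof (rule Bochner_Integration.integrable_bound)
    show "integrable M (\<lambda>\<omega>. 1 + (norm (?N \<omega>))\<^sup>2)" using N2 by simp
    show "(\<lambda>\<omega>. norm (\<beta> \<omega> *\<^sub>R ?N \<omega>)) \<in> borel_measurable M"
      by (rule measurable_compose[OF measurable_FD[OF mU P(1)] borel_measurable_norm]) simp
    show "AE \<omega> in M. norm (norm (\<beta> \<omega> *\<^sub>R ?N \<omega>)) \<le> norm (1 + (norm (?N \<omega>))\<^sup>2)"
    proof (rule AE_I2)
      fix \<omega> assume "\<omega> \<in> space M"
      then have "\<bar>\<beta> \<omega>\<bar> * norm (?N \<omega>) \<le> 1 * norm (?N \<omega>)"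
        using Suc.prems(3) by (intro mult_right_mono) auto
      moreover have "norm (?N \<omega>) \<le> 1 + (norm (?N \<omega>))\<^sup>2"
      proof -
        have "2 * norm (?N \<omega>) \<le> 1 + (norm (?N \<omega>))\<^sup>2"
          using sum_squares_bound[of "norm (?N \<omega>)" 1] by simp
        then show ?thesis using norm_ge_zero[of "?N \<omega>"] by linarith
      qed
      ultimately show "norm (norm (\<beta> \<omega> *\<^sub>R ?N \<omega>)) \<le> norm (1 + (norm (?N \<omega>))\<^sup>2)" by simp
    qed
  qed
  note A = Suc.IH[OF P0 Suc.prems(2,3)]
  note B = matrix_increment_mean[OF P(1)[of n] P(3)[of n] P(4)[of n] K mU iU]
  note C = matrix_increment_variance[OF P(1)[of n] P(3)[of n] P(4)[of n] K \<beta>n Suc.prems(3)]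
  have eq: "\<beta> \<omega> * (norm (brownian_sum W (Suc n) \<sigma> \<eta> \<omega>))\<^sup>2
      = \<beta> \<omega> * (norm (?N \<omega>))\<^sup>2 + 2 * ((\<beta> \<omega> *\<^sub>R ?N \<omega>) \<bullet> ?D \<omega>) + \<beta> \<omega> * (norm (?D \<omega>))\<^sup>2" for \<omega>
  proof -
    have "brownian_sum W (Suc n) \<sigma> \<eta> \<omega> = ?N \<omega> + ?D \<omega>" by (simp add: brownian_sum_def)
    then show ?thesis
      by (simp only: power2_norm_eq_inner) (simp add: algebra_simps inner_commute)
  qed
  show ?case unfolding eq using A B C by simp
qed

text \<open>The integrand is stopped before its accumulated square exceeds \<open>\<delta>\<close>. This is predictable
  because the contribution of a step is known at the start of the step.\<close>
lemma brownian_sum_tail: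
  fixes \<zeta> :: "nat \<Rightarrow> 'w \<Rightarrow> real^'e^'d"
  assumes P: "predictable_step n \<sigma> \<zeta>" and A: "A \<in> events" and "0 < \<delta>" "0 < \<epsilon>"
  shows "prob {\<omega>\<in>A. norm (brownian_sum W n \<sigma> \<zeta> \<omega>) > \<epsilon>}
    \<le> \<delta> / \<epsilon>\<^sup>2 + prob {\<omega>\<in>A. (\<Sum>i<n. (\<sigma> (Suc i) - \<sigma> i) * (norm (\<zeta> i \<omega>))\<^sup>2) > \<delta>}"
proof -
  note P' = predictable_stepD[OF P]
  define Q where "Q = (\<lambda>k \<omega>. \<Sum>i<k. (\<sigma> (Suc i) - \<sigma> i) * (norm (\<zeta> i \<omega>))\<^sup>2)"
  define \<zeta>' where "\<zeta>' = (\<lambda>i \<omega>. if Q (Suc i) \<omega> \<le> \<delta> then \<zeta> i \<omega> else 0)"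
  have mono: "\<sigma> i \<le> \<sigma> j" if "i \<le> j" "j \<le> n" for i j
    using mono_on_steps[of n \<sigma> i j] P'(3) that by blast
  have Qm: "Q (Suc i) \<in> borel_measurable (F (\<sigma> i))" if "i < n" for i
    unfolding Q_def
  proof (intro borel_measurable_sum)
    fix j assume "j \<in> {..<Suc i}"
    then have "\<zeta> j \<in> borel_measurable (F (\<sigma> i))"
      using that P'(1,4)[of j] mono[of j i] measurable_F_mono by auto
    then show "(\<lambda>\<omega>. (\<sigma> (Suc j) - \<sigma> j) * (norm (\<zeta> j \<omega>))\<^sup>2) \<in> borel_measurable (F (\<sigma> i))" by simp
  qed
  have P2: "predictable_step n \<sigma> \<zeta>'"
    unfolding predictable_step_def
  proof (intro conjI allI impI)
    show "0 \<le> \<sigma> 0" using P'(1) by simp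
    fix i assume i: "i < n"
    show "\<sigma> i \<le> \<sigma> (Suc i)" using P'(3) i .
    show "\<zeta>' i \<in> borel_measurable (F (\<sigma> i))"
      unfolding \<zeta>'_def using Qm[OF i] P'(4)[OF i] by measurable
    show "\<exists>K. \<forall>\<omega>\<in>space M. norm (\<zeta>' i \<omega>) \<le> K"
    proof -
      obtain K where "\<forall>\<omega>\<in>space M. norm (\<zeta> i \<omega>) \<le> K" using P'(5)[OF i] by blast
      then have "\<forall>\<omega>\<in>space M. norm (\<zeta>' i \<omega>) \<le> max 0 K" unfolding \<zeta>'_def by (auto simp: le_max_iff_disj)
      then show ?thesis by blast
    qed
  qed
  have Qle: "Q i \<omega> \<le> Q j \<omega>" if "i \<le> j" "j \<le> n" for i j \<omega>
    unfolding Q_def using that P'(3) by (intro sum_mono2) auto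
  \<comment> \<open>The bound by \<open>Q k\<close> is carried along for the induction: a step is
    kept only if \<open>Q (Suc k) \<omega> \<le> \<delta>\<close>, and then the bound by
    \<open>Q\<close> implies the one by \<open>\<delta>\<close>.\<close>
  have small: "(\<Sum>i<k. (\<sigma> (Suc i) - \<sigma> i) * (norm (\<zeta>' i \<omega>))\<^sup>2) \<le> min \<delta> (Q k \<omega>)" if "k \<le> n" for k \<omega>
    using that
  proof (induction k)
    case 0
    then show ?case using \<open>0 < \<delta>\<close> by (simp add: Q_def)
  next
    case (Suc k)
    have "0 \<le> (\<sigma> (Suc k) - \<sigma> k) * (norm (\<zeta> k \<omega>))\<^sup>2" using P'(3)[of k] Suc.prems by simp
    then show ?case using Suc by (auto simp: \<zeta>'_def Q_def)
  qed
  have eq: "brownian_sum W n \<sigma> \<zeta>' \<omega> = brownian_sum W n \<sigma> \<zeta> \<omega>" if "Q n \<omega> \<le> \<delta>" for \<omega>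
    unfolding brownian_sum_def
  proof (intro sum.cong refl)
    fix i assume "i \<in> {..<n}"
    then have "Q (Suc i) \<omega> \<le> \<delta>" using Qle[of "Suc i" n \<omega>] that by simp
    then show "\<zeta>' i \<omega> *v (W (\<sigma> (Suc i)) \<omega> - W (\<sigma> i) \<omega>) = \<zeta> i \<omega> *v (W (\<sigma> (Suc i)) \<omega> - W (\<sigma> i) \<omega>)"
      by (simp add: \<zeta>'_def)
  qed
  let ?N = "brownian_sum W n \<sigma> \<zeta>'"
  have Nm[measurable]: "?N \<in> borel_measurable M" "brownian_sum W n \<sigma> \<zeta> \<in> borel_measurable M"
    using measurable_FD[OF brownian_sum_measurable] P P2 P'(1)[of n] by auto
  have Qn[measurable]: "Q n \<in> borel_measurable M"
  proof (cases n)
    case (Suc k)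
    then show ?thesis using measurable_FD[OF Qm[of k]] P'(1)[of k] by simp
  qed (simp add: Q_def)
  note V = brownian_sum_variance[OF P2 P'(1)[of 0], of "\<lambda>_. 1", simplified]
  have int: "integrable M (\<lambda>\<omega>. (norm (\<zeta>' i \<omega>))\<^sup>2)" if i: "i < n" for i
  proof -
    obtain K where K: "\<And>\<omega>. \<omega> \<in> space M \<Longrightarrow> norm (\<zeta>' i \<omega>) \<le> K"
      using predictable_stepD(5)[OF P2 i] by blast
    have "\<zeta>' i \<in> borel_measurable M"
      using measurable_FD[OF predictable_stepD(4)[OF P2 i]] P'(1)[of i] i by simp
    then show ?thesis
      using K by (intro integrable_const_bound[of _ "K\<^sup>2"] AE_I2) (auto intro!: power_mono)
  qed
  have "expectation (\<lambda>\<omega>. (norm (?N \<omega>))\<^sup>2) = expectation (\<lambda>\<omega>. \<Sum>i<n. (\<sigma> (Suc i) - \<sigma> i) * (norm (\<zeta>' i \<omega>))\<^sup>2)"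
    using V int by (subst Bochner_Integration.integral_sum) auto
  also have "\<dots> \<le> expectation (\<lambda>\<omega>. \<delta>)"
    by (rule integral_mono) (use int small[of n] in \<open>auto intro!: Bochner_Integration.integrable_sum\<close>)
  finally have E: "expectation (\<lambda>\<omega>. (norm (?N \<omega>))\<^sup>2) \<le> \<delta>" by (simp add: prob_space)
  have "prob {\<omega>\<in>space M. norm (?N \<omega>) > \<epsilon>} \<le> prob {\<omega>\<in>space M. (norm (?N \<omega>))\<^sup>2 \<ge> \<epsilon>\<^sup>2}"
    using \<open>0 < \<epsilon>\<close> by (intro finite_measure_mono) (auto intro!: power_mono)
  also have "\<dots> \<le> expectation (\<lambda>\<omega>. (norm (?N \<omega>))\<^sup>2) / \<epsilon>\<^sup>2"
    by (rule integral_Markov_inequality_measure[where A = "{}"])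
      (use V \<open>0 < \<epsilon>\<close> in auto)
  also have "\<dots> \<le> \<delta> / \<epsilon>\<^sup>2"
    using E by (intro divide_right_mono) auto
  finally have 1: "prob {\<omega>\<in>space M. norm (?N \<omega>) > \<epsilon>} \<le> \<delta> / \<epsilon>\<^sup>2" .
  have sub: "A \<subseteq> space M" using A sets.sets_into_space by blast
  have Aev: "{\<omega>\<in>A. Q n \<omega> > \<delta>} \<in> events"
  proof -
    have "{\<omega>\<in>A. Q n \<omega> > \<delta>} = A \<inter> {\<omega>\<in>space M. Q n \<omega> > \<delta>}" using sub by auto
    then show ?thesis using A by simp
  qed
  have "prob {\<omega>\<in>A. norm (brownian_sum W n \<sigma> \<zeta> \<omega>) > \<epsilon>}
      \<le> prob ({\<omega>\<in>space M. norm (?N \<omega>) > \<epsilon>} \<union> {\<omega>\<in>A. Q n \<omega> > \<delta>})"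
    using Aev eq sub by (intro finite_measure_mono) (force simp: not_le[symmetric])+
  also have "\<dots> \<le> prob {\<omega>\<in>space M. norm (?N \<omega>) > \<epsilon>} + prob {\<omega>\<in>A. Q n \<omega> > \<delta>}"
    using Aev by (intro measure_Un_le) auto
  finally show ?thesis using 1 unfolding Q_def by linarith
qed

end

text \<open>A clipped cell that is not empty lies in the original cell and begins no earlier, so the
  value of the integrand on it is already known at its left end.\<close>

lemma clip_step:
  fixes s t x y :: real
  assumes "max s (min t x) < max s (min t y)" "s \<le> t"
  shows "x \<le> max s (min t x)" and "u \<in> {max s (min t x)<..max s (min t y)} \<Longrightarrow> u \<in> {x<..y} \<and> s \<le> u \<and> u \<le> t"
  using assms by (auto simp: max_def min_def split: if_splits)

text \<open>At a clipped time \<open>W\<close> equals \<open>W (min t a) - W (min s a)\<close> plus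
  \<open>W s\<close>, and the last term cancels in every increment.\<close>

lemma elementary_integral_increment:
  assumes "s \<le> t"
  shows "elementary_integral W n \<tau> \<xi> t \<omega> - elementary_integral W n \<tau> \<xi> s \<omega>
    = brownian_sum W n (\<lambda>i. max s (min t (\<tau> i))) \<xi> \<omega>"
proof -
  have *: "W (max s (min t a)) \<omega> = W (min t a) \<omega> - W (min s a) \<omega> + W s \<omega>" for a
    using assms by (auto simp: max_def min_def)
  show ?thesis
    unfolding elementary_integral_def brownian_sum_def sum_subtractf[symmetric]
      matrix_vector_mult_diff_distrib[symmetric]
  proof (intro sum.cong refl arg_cong2[of _ _ _ _ "(*v)"])
    fix i
    show "W (min t (\<tau> (Suc i))) \<omega> - W (min t (\<tau> i)) \<omega> - (W (min s (\<tau> (Suc i))) \<omega> - W (min s (\<tau> i)) \<omega>)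
      = W (max s (min t (\<tau> (Suc i)))) \<omega> - W (max s (min t (\<tau> i))) \<omega>"
      by (simp add: *)
  qed
qed

section \<open>Increments of the Ito integral, localized to an event\<close>

context filtered_brownian_motion
begin

text \<open>Tonelli applies because progressive measurability is joint measurability on
  \<open>[0, t]\<close>. The error sets in the definition of the Ito integral are thereby events,
  which monotonicity of \<open>prob\<close> requires of the larger set.\<close>

lemma elementary_error_measurable:
  fixes \<xi> :: "nat \<Rightarrow> 'w \<Rightarrow> 'a::euclidean_space"
  assumes H: "progressively_measurable F H" and e: "elementary_process M F n \<tau> \<xi>" and t: "0 \<le> t"
  shows "(\<lambda>\<omega>. \<integral>\<^sup>+u\<in>{0..t}. ennreal ((norm (elementary_value n \<tau> \<xi> u \<omega> - H u \<omega>))\<^sup>2) \<partial>lborel)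
    \<in> borel_measurable M"
proof -
  let ?R = "restrict_space lborel {0..t}"
  interpret R: sigma_finite_measure ?R
    by (rule sigma_finite_measure_restrict_space) (auto simp: sigma_finite_lborel)
  have "(\<lambda>(u, \<omega>). H u \<omega>) \<in> borel_measurable (restrict_space borel {0..t} \<Otimes>\<^sub>M F t)"
    using H t by (simp add: progressively_measurable_def)
  moreover have "id \<in> measurable (?R \<Otimes>\<^sub>M M) (restrict_space borel {0..t} \<Otimes>\<^sub>M F t)"
  proof (rule measurable_pair)
    show "fst \<circ> id \<in> measurable (?R \<Otimes>\<^sub>M M) (restrict_space borel {0..t})"
      using measurable_fst[of ?R M] by (simp add: measurable_def space_restrict_space sets_restrict_space)
    show "snd \<circ> id \<in> measurable (?R \<Otimes>\<^sub>M M) (F t)"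
      using measurable_snd[of ?R M] measurable_from_subalg[OF subalg[OF t]]
      using measurable_compose[OF measurable_snd[of ?R M] measurable_FD[OF measurable_ident_sets t]]
      by auto
  qed
  ultimately have "(\<lambda>(u, \<omega>). H u \<omega>) \<circ> id \<in> borel_measurable (?R \<Otimes>\<^sub>M M)"
    by (rule measurable_comp[rotated])
  then have [measurable]: "(\<lambda>(u, \<omega>). H u \<omega>) \<in> borel_measurable (?R \<Otimes>\<^sub>M M)" by simp
  have [measurable]: "\<xi> i \<in> borel_measurable M" if "i < n" for i
  proof -
    have "0 \<le> \<tau> i" "\<xi> i \<in> borel_measurable (F (\<tau> i))"
      using e that mono_on_steps[of n \<tau> 0 i] by (auto simp: elementary_process_def)
    then show ?thesis by (simp add: measurable_FD)
  qed
  have [measurable]: "(\<lambda>u. indicator {\<tau> i<..\<tau> (Suc i)} u :: real) \<in> borel_measurable ?R" for i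
    by (intro measurable_restrict_space1) simp
  have "(\<lambda>(u, \<omega>). elementary_value n \<tau> \<xi> u \<omega>) \<in> borel_measurable (?R \<Otimes>\<^sub>M M)"
    unfolding elementary_value_def split_beta'
    by (intro borel_measurable_sum borel_measurable_scaleR) measurable
  then have "(\<lambda>(u, \<omega>). ennreal ((norm (elementary_value n \<tau> \<xi> u \<omega> - H u \<omega>))\<^sup>2)) \<in> borel_measurable (?R \<Otimes>\<^sub>M M)"
    by measurable
  then have "(\<lambda>(\<omega>, u). ennreal ((norm (elementary_value n \<tau> \<xi> u \<omega> - H u \<omega>))\<^sup>2)) \<in> borel_measurable (M \<Otimes>\<^sub>M ?R)"
    by (rule borel_measurable_Pair_swap')
  then have "(\<lambda>\<omega>. \<integral>\<^sup>+u. ennreal ((norm (elementary_value n \<tau> \<xi> u \<omega> - H u \<omega>))\<^sup>2) \<partial>?R) \<in> borel_measurable M"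
    by (rule R.borel_measurable_nn_integral)
  then show ?thesis by (simp add: nn_integral_restrict_space)
qed

text \<open>On the event that \<open>H\<close> stays in the ball around \<open>c\<close>, projecting the approximating elementary
  integrands to this ball does not change the limit, by Lenglart domination (\<open>brownian_sum_tail\<close>);
  the projected integrands are bounded pointwise by \<open>norm c + \<rho>\<close>.\<close>
lemma ito_increment_localized:
  fixes H :: "real \<Rightarrow> 'w \<Rightarrow> real^'e^'d"
  assumes J: "ito_integral_process M F W H J" and st: "0 \<le> s" "s \<le> t" and \<rho>: "0 \<le> \<rho>"
    and c: "c \<in> borel_measurable (F s)" "\<And>\<omega>. \<omega> \<in> space M \<Longrightarrow> norm (c \<omega>) \<le> K"
  obtains G :: "nat \<Rightarrow> 'w \<Rightarrow> real^'d" where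
    "\<And>k. G k \<in> borel_measurable M" "\<And>k. integrable M (\<lambda>\<omega>. (norm (G k \<omega>))\<^sup>2)"
    "\<And>k U. U \<in> borel_measurable (F s) \<Longrightarrow> integrable M (\<lambda>\<omega>. norm (U \<omega>)) \<Longrightarrow>
      integrable M (\<lambda>\<omega>. U \<omega> \<bullet> G k \<omega>) \<and> expectation (\<lambda>\<omega>. U \<omega> \<bullet> G k \<omega>) = 0"
    "\<And>k B. B \<in> sets (F s) \<Longrightarrow> expectation (\<lambda>\<omega>. indicator B \<omega> * (norm (G k \<omega>))\<^sup>2)
      \<le> (t - s) * expectation (\<lambda>\<omega>. indicator B \<omega> * (norm (c \<omega>) + \<rho>)\<^sup>2)"
    "\<And>A \<delta>. A \<in> events \<Longrightarrow> (\<And>\<omega> u. \<omega> \<in> A \<Longrightarrow> u \<in> {s..t} \<Longrightarrow> norm (H u \<omega> - c \<omega>) \<le> \<rho>) \<Longrightarrow> 0 < \<delta> \<Longrightarrow>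
      (\<lambda>k. prob {\<omega>\<in>A. norm (G k \<omega> - (J t \<omega> - J s \<omega>)) > \<delta>}) \<longlonglongrightarrow> 0"
proof -
  obtain n \<tau> \<xi> where el: "\<And>k. elementary_process M F (n k) (\<tau> k) (\<xi> k)"
    and conv: "\<And>t \<epsilon>. 0 \<le> t \<Longrightarrow> 0 < \<epsilon> \<Longrightarrow>
      (\<lambda>k. prob {\<omega>\<in>space M.
        (\<integral>\<^sup>+u\<in>{0..t}. ennreal ((norm (elementary_value (n k) (\<tau> k) (\<xi> k) u \<omega> - H u \<omega>))\<^sup>2) \<partial>lborel)
          > ennreal \<epsilon>}) \<longlonglongrightarrow> 0 \<and>
      (\<lambda>k. prob {\<omega>\<in>space M.
        norm (elementary_integral W (n k) (\<tau> k) (\<xi> k) t \<omega> - J t \<omega>) > \<epsilon>}) \<longlonglongrightarrow> 0"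
    and pm: "progressively_measurable F H" and aJ: "adapted F J"
    using J unfolding ito_integral_process_def by blast
  define \<sigma> where "\<sigma> = (\<lambda>k i. max s (min t (\<tau> k i)))"
  \<comment> \<open>The values are split into the part in the ball and the part cut off. On a cell
    that clipping makes empty, \<open>\<xi> k i\<close> may become known only after
    \<open>\<sigma> k i\<close>; the value \<open>0\<close> keeps both parts adapted and changes
    nothing, since the increment of \<open>W\<close> vanishes there.\<close>
  define \<eta> where "\<eta> = (\<lambda>k i \<omega>. if \<sigma> k i < \<sigma> k (Suc i) then proj_ball (c \<omega>) \<rho> (\<xi> k i \<omega>) else 0)"
  define \<zeta> where "\<zeta> = (\<lambda>k i \<omega>. if \<sigma> k i < \<sigma> k (Suc i) then \<xi> k i \<omega> - proj_ball (c \<omega>) \<rho> (\<xi> k i \<omega>) else 0)"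
  have K0: "0 \<le> K" using c(2) not_empty norm_ge_zero order_trans by blast
  have \<tau>mono: "\<tau> k i \<le> \<tau> k (Suc i)" if "i < n k" for k i
    using el[of k] that by (auto simp: elementary_process_def)
  have \<tau>0: "0 \<le> \<tau> k i" if "i \<le> n k" for k i
    using el[of k] that mono_on_steps[of "n k" "\<tau> k" 0 i] by (auto simp: elementary_process_def)
  have \<sigma>mono: "\<sigma> k i \<le> \<sigma> k (Suc i)" if "i < n k" for k i
    using \<tau>mono[OF that] by (auto simp: \<sigma>_def)
  have \<sigma>s: "s \<le> \<sigma> k i" "\<sigma> k i \<le> t" for k i using st by (auto simp: \<sigma>_def)
  have cF: "c \<in> borel_measurable (F (\<sigma> k i))" for k i
    using measurable_F_mono[OF c(1) st(1) \<sigma>s(1)] .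
  have \<xi>F: "\<xi> k i \<in> borel_measurable (F (\<sigma> k i))" if "i < n k" "\<sigma> k i < \<sigma> k (Suc i)" for k i
  proof -
    have "\<tau> k i \<le> \<sigma> k i" using clip_step(1)[of s t "\<tau> k i" "\<tau> k (Suc i)"] that st by (simp add: \<sigma>_def)
    moreover have "\<xi> k i \<in> borel_measurable (F (\<tau> k i))"
      using el[of k] that by (auto simp: elementary_process_def)
    ultimately show ?thesis using measurable_F_mono \<tau>0[of i k] that by auto
  qed
  have \<eta>b: "norm (\<eta> k i \<omega>) \<le> norm (c \<omega>) + \<rho>" for k i \<omega>
    using \<rho> by (simp add: \<eta>_def proj_ball_norm)
  have P: "predictable_step (n k) (\<sigma> k) (\<eta> k)" for k
    unfolding predictable_step_def
  proof (intro conjI allI impI)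
    show "0 \<le> \<sigma> k 0" using \<sigma>s(1) st(1) order_trans by blast
    fix i assume i: "i < n k"
    show "\<sigma> k i \<le> \<sigma> k (Suc i)" using \<sigma>mono[OF i] .
    show "\<eta> k i \<in> borel_measurable (F (\<sigma> k i))"
      using borel_measurable_proj_ball[OF cF \<xi>F[OF i]]
      by (cases "\<sigma> k i < \<sigma> k (Suc i)") (simp_all add: \<eta>_def)
    show "\<exists>K. \<forall>\<omega>\<in>space M. norm (\<eta> k i \<omega>) \<le> K"
      using \<eta>b[of k i] c(2) by (intro exI[of _ "K + \<rho>"]) (meson add_right_mono order_trans)
  qed
  have PZ: "predictable_step (n k) (\<sigma> k) (\<zeta> k)" for k
    unfolding predictable_step_def
  proof (intro conjI allI impI)
    show "0 \<le> \<sigma> k 0" using \<sigma>s(1) st(1) order_trans by blast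
    fix i assume i: "i < n k"
    show "\<sigma> k i \<le> \<sigma> k (Suc i)" using \<sigma>mono[OF i] .
    show "\<zeta> k i \<in> borel_measurable (F (\<sigma> k i))"
      using borel_measurable_diff[OF \<xi>F[OF i] borel_measurable_proj_ball[OF cF \<xi>F[OF i]]]
      by (cases "\<sigma> k i < \<sigma> k (Suc i)") (simp_all add: \<zeta>_def)
    have "\<exists>B. \<forall>\<omega>\<in>space M. norm (\<xi> k i \<omega>) \<le> B"
      using el[of k] i by (auto simp: elementary_process_def)
    then obtain B where B: "\<And>\<omega>. \<omega> \<in> space M \<Longrightarrow> norm (\<xi> k i \<omega>) \<le> B" by blast
    have "norm (\<zeta> k i \<omega>) \<le> \<bar>B\<bar> + (K + \<rho>)" if "\<omega> \<in> space M" for \<omega>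
    proof -
      have "norm (\<xi> k i \<omega> - proj_ball (c \<omega>) \<rho> (\<xi> k i \<omega>)) \<le> B + (K + \<rho>)"
        using norm_triangle_ineq4[of "\<xi> k i \<omega>" "proj_ball (c \<omega>) \<rho> (\<xi> k i \<omega>)"] B[OF that] c(2)[OF that]
          proj_ball_norm[OF \<rho>, of "c \<omega>" "\<xi> k i \<omega>"] by linarith
      then show ?thesis using K0 \<rho> by (auto simp: \<zeta>_def)
    qed
    then show "\<exists>K. \<forall>\<omega>\<in>space M. norm (\<zeta> k i \<omega>) \<le> K" by blast
  qed
  have s0: "s \<le> \<sigma> k 0" for k using \<sigma>s(1) .
  define G where "G = (\<lambda>k. brownian_sum W (n k) (\<sigma> k) (\<eta> k))"
  define Z where "Z = (\<lambda>k. brownian_sum W (n k) (\<sigma> k) (\<zeta> k))"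
  let ?I = "\<lambda>k. elementary_integral W (n k) (\<tau> k) (\<xi> k)"
  let ?e = "\<lambda>k \<omega>. \<integral>\<^sup>+u\<in>{0..t}. ennreal ((norm (elementary_value (n k) (\<tau> k) (\<xi> k) u \<omega> - H u \<omega>))\<^sup>2) \<partial>lborel"
  have split: "?I k t \<omega> - ?I k s \<omega> = G k \<omega> + Z k \<omega>" for k \<omega>
  proof -
    have "(\<lambda>i. max s (min t (\<tau> k i))) = \<sigma> k" by (simp add: \<sigma>_def)
    then have "?I k t \<omega> - ?I k s \<omega> = brownian_sum W (n k) (\<sigma> k) (\<xi> k) \<omega>"
      by (simp add: elementary_integral_increment[OF st(2)])
    also have "\<dots> = G k \<omega> + Z k \<omega>"
      unfolding G_def Z_def brownian_sum_def sum.distrib[symmetric]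
    proof (intro sum.cong refl)
      fix i assume "i \<in> {..<n k}"
      then have "\<sigma> k i < \<sigma> k (Suc i) \<or> \<sigma> k i = \<sigma> k (Suc i)" using \<sigma>mono by (simp add: le_less)
      then show "\<xi> k i \<omega> *v (W (\<sigma> k (Suc i)) \<omega> - W (\<sigma> k i) \<omega>)
        = \<eta> k i \<omega> *v (W (\<sigma> k (Suc i)) \<omega> - W (\<sigma> k i) \<omega>) + \<zeta> k i \<omega> *v (W (\<sigma> k (Suc i)) \<omega> - W (\<sigma> k i) \<omega>)"
        by (auto simp: \<eta>_def \<zeta>_def matrix_vector_mult_add_rdistrib[symmetric])
    qed
    finally show ?thesis .
  qed
  have Gm: "G k \<in> borel_measurable M" for k
    unfolding G_def using measurable_FD[OF brownian_sum_measurable[OF P]] predictable_stepD(1)[OF P] by blast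
  have Zm: "Z k \<in> borel_measurable M" for k
    unfolding Z_def using measurable_FD[OF brownian_sum_measurable[OF PZ]] predictable_stepD(1)[OF PZ] by blast
  have G2: "integrable M (\<lambda>\<omega>. (norm (G k \<omega>))\<^sup>2)" for k
    using brownian_sum_variance[OF P st(1) s0, of "\<lambda>_. 1" k] by (simp add: G_def)
  show ?thesis
  proof (rule that[of G])
    show "G k \<in> borel_measurable M" "integrable M (\<lambda>\<omega>. (norm (G k \<omega>))\<^sup>2)" for k
      by (rule Gm, rule G2)
    show "integrable M (\<lambda>\<omega>. U \<omega> \<bullet> G k \<omega>) \<and> expectation (\<lambda>\<omega>. U \<omega> \<bullet> G k \<omega>) = 0"
      if "U \<in> borel_measurable (F s)" "integrable M (\<lambda>\<omega>. norm (U \<omega>))" for k U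
      using brownian_sum_mean[OF P st(1) s0 that] by (simp add: G_def)
    show "expectation (\<lambda>\<omega>. indicator B \<omega> * (norm (G k \<omega>))\<^sup>2)
      \<le> (t - s) * expectation (\<lambda>\<omega>. indicator B \<omega> * (norm (c \<omega>) + \<rho>)\<^sup>2)" if B: "B \<in> sets (F s)" for k B
    proof -
      define E where "E = expectation (\<lambda>\<omega>. indicator B \<omega> * (norm (c \<omega>) + \<rho>)\<^sup>2)"
      have BM: "B \<in> events" using B sets_F_subset st(1) by blast
      have cM: "c \<in> borel_measurable M" using measurable_FD[OF c(1) st(1)] .
      have intE: "integrable M (\<lambda>\<omega>. indicator B \<omega> * (norm (c \<omega>) + \<rho>)\<^sup>2)"
      proof (rule integrable_const_bound[of _ "(K + \<rho>)\<^sup>2"])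
        show "AE \<omega> in M. norm (indicator B \<omega> * (norm (c \<omega>) + \<rho>)\<^sup>2) \<le> (K + \<rho>)\<^sup>2"
          using c(2) \<rho> by (intro AE_I2) (auto simp: indicator_def intro!: power_mono)
      qed (use BM cM in measurable)
      have "expectation (\<lambda>\<omega>. indicator B \<omega> * (norm (G k \<omega>))\<^sup>2)
        = (\<Sum>i<n k. (\<sigma> k (Suc i) - \<sigma> k i) * expectation (\<lambda>\<omega>. indicator B \<omega> * (norm (\<eta> k i \<omega>))\<^sup>2))"
        using brownian_sum_variance[OF P st(1) s0, of "indicator B" k] B by (simp add: G_def)
      also have "\<dots> \<le> (\<Sum>i<n k. (\<sigma> k (Suc i) - \<sigma> k i) * E)"
      proof (intro sum_mono mult_left_mono)
        fix i assume i: "i \<in> {..<n k}"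
        show "0 \<le> \<sigma> k (Suc i) - \<sigma> k i" using \<sigma>mono i by simp
        show "expectation (\<lambda>\<omega>. indicator B \<omega> * (norm (\<eta> k i \<omega>))\<^sup>2) \<le> E"
          unfolding E_def using \<eta>b by (intro integral_mono' intE mult_left_mono power_mono) auto
      qed
      also have "\<dots> = (\<sigma> k (n k) - \<sigma> k 0) * E"
        by (simp add: sum_distrib_right[symmetric] sum_lessThan_telescope)
      also have "\<dots> \<le> (t - s) * E"
      proof (intro mult_right_mono)
        show "\<sigma> k (n k) - \<sigma> k 0 \<le> t - s" using \<sigma>s(1)[of k 0] \<sigma>s(2)[of k "n k"] by simp
        show "0 \<le> E" unfolding E_def by simp
      qed
      finally show ?thesis unfolding E_def .
    qed
    show "(\<lambda>k. prob {\<omega>\<in>A. norm (G k \<omega> - (J t \<omega> - J s \<omega>)) > \<delta>}) \<longlonglongrightarrow> 0"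
      if A: "A \<in> events" and good: "\<And>\<omega> u. \<omega> \<in> A \<Longrightarrow> u \<in> {s..t} \<Longrightarrow> norm (H u \<omega> - c \<omega>) \<le> \<rho>" and \<delta>: "0 < \<delta>" for A \<delta>
    proof -
      have Asub: "A \<subseteq> space M" using A sets.sets_into_space by blast
      \<comment> \<open>On \<open>A\<close> the integrand lies in the ball, so the part cut off is
        at most the approximation error. By \<open>brownian_sum_tail\<close> its stochastic sum
        \<open>Z k\<close> is then small in probability on \<open>A\<close>.\<close>
      have err: "ennreal (\<Sum>i<n k. (\<sigma> k (Suc i) - \<sigma> k i) * (norm (\<zeta> k i \<omega>))\<^sup>2) \<le> ?e k \<omega>" if \<omega>: "\<omega> \<in> A" for k \<omega>
      proof -
        have "ennreal (\<Sum>i<n k. (\<sigma> k (Suc i) - \<sigma> k i) * (norm (\<zeta> k i \<omega>))\<^sup>2)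
          = (\<integral>\<^sup>+u. ennreal (elementary_value (n k) (\<sigma> k) (\<lambda>i \<omega>. (norm (\<zeta> k i \<omega>))\<^sup>2) u \<omega>) \<partial>lborel)"
          by (rule nn_integral_elementary_value[symmetric]) (use \<sigma>mono in auto)
        also have "\<dots> \<le> ?e k \<omega>"
        proof (rule nn_integral_mono)
          fix u :: real
          show "ennreal (elementary_value (n k) (\<sigma> k) (\<lambda>i \<omega>. (norm (\<zeta> k i \<omega>))\<^sup>2) u \<omega>)
            \<le> ennreal ((norm (elementary_value (n k) (\<tau> k) (\<xi> k) u \<omega> - H u \<omega>))\<^sup>2) * indicator {0..t} u"
          proof (cases "\<exists>i<n k. u \<in> {\<sigma> k i<..\<sigma> k (Suc i)}")
            case True
            then obtain i where i: "i < n k" "u \<in> {\<sigma> k i<..\<sigma> k (Suc i)}" by blast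
            then have lt: "\<sigma> k i < \<sigma> k (Suc i)" by auto
            have u: "u \<in> {\<tau> k i<..\<tau> k (Suc i)}" "s \<le> u" "u \<le> t"
              using clip_step(2)[of s t "\<tau> k i" "\<tau> k (Suc i)" u] lt i(2) st(2) by (auto simp: \<sigma>_def)
            have "norm (\<zeta> k i \<omega>) \<le> norm (\<xi> k i \<omega> - H u \<omega>)"
              using proj_ball_nearest[OF good[OF \<omega>, of u]] u lt by (simp add: \<zeta>_def)
            then have "(norm (\<zeta> k i \<omega>))\<^sup>2 \<le> (norm (\<xi> k i \<omega> - H u \<omega>))\<^sup>2" by (intro power_mono) auto
            moreover have "elementary_value (n k) (\<tau> k) (\<xi> k) u \<omega> = \<xi> k i \<omega>"
              by (rule elementary_value_in_cell[OF \<tau>mono i(1) u(1)])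
            moreover have "elementary_value (n k) (\<sigma> k) (\<lambda>i \<omega>. (norm (\<zeta> k i \<omega>))\<^sup>2) u \<omega> = (norm (\<zeta> k i \<omega>))\<^sup>2"
              by (rule elementary_value_in_cell[OF \<sigma>mono i])
            ultimately show ?thesis using u st(1) by (simp add: ennreal_leI)
          next
            case False
            then have "elementary_value (n k) (\<sigma> k) (\<lambda>i \<omega>. (norm (\<zeta> k i \<omega>))\<^sup>2) u \<omega> = 0"
              by (auto simp: elementary_value_def indicator_def intro!: sum.neutral)
            then show ?thesis by simp
          qed
        qed
        finally show ?thesis .
      qed
      have em[measurable]: "?e k \<in> borel_measurable M" for k
        by (rule elementary_error_measurable[OF pm el]) (use st in simp)
      have Jm[measurable]: "J t \<in> borel_measurable M" "J s \<in> borel_measurable M"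
        using aJ st measurable_FD[of "J t" t borel] measurable_FD[of "J s" s borel] by (auto simp: adapted_def)
      have Im: "?I k u \<in> borel_measurable M" if "0 \<le> u" for k u
      proof -
        have "\<xi> k i \<in> borel_measurable M" if "i < n k" for i
          using el[of k] that \<tau>0[of i k] by (auto simp: elementary_process_def intro: measurable_FD)
        moreover have "W (min u (\<tau> k i)) \<in> borel_measurable M" if "i \<le> n k" for i
          using \<open>0 \<le> u\<close> \<tau>0[OF that] by (intro measurable_FD[OF W_measurable]) auto
        ultimately show ?thesis unfolding elementary_integral_def
          by (intro borel_measurable_sum borel_measurable_matrix_vector_mult borel_measurable_diff) auto
      qed
      let ?b1 = "\<lambda>k. prob {\<omega>\<in>space M. norm (?I k t \<omega> - J t \<omega>) > \<delta> / 3}"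
      let ?b2 = "\<lambda>k. prob {\<omega>\<in>space M. norm (?I k s \<omega> - J s \<omega>) > \<delta> / 3}"
      let ?b3 = "\<lambda>d k. prob {\<omega>\<in>space M. ?e k \<omega> > ennreal d}"
      have bound: "prob {\<omega>\<in>A. norm (G k \<omega> - (J t \<omega> - J s \<omega>)) > \<delta>} \<le> ?b1 k + ?b2 k + (d / (\<delta> / 3)\<^sup>2 + ?b3 d k)"
        if d: "0 < d" for d k
      proof -
        let ?A1 = "{\<omega>\<in>space M. norm (?I k t \<omega> - J t \<omega>) > \<delta> / 3}"
        let ?A2 = "{\<omega>\<in>space M. norm (?I k s \<omega> - J s \<omega>) > \<delta> / 3}"
        let ?A3 = "{\<omega>\<in>A. norm (Z k \<omega>) > \<delta> / 3}"
        have A3: "?A3 \<in> events"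
        proof -
          have "?A3 = A \<inter> {\<omega>\<in>space M. norm (Z k \<omega>) > \<delta> / 3}" using Asub by auto
          then show ?thesis using A Zm by simp
        qed
        have [measurable]: "?I k t \<in> borel_measurable M" by (rule Im) (use st in simp)
        have [measurable]: "?I k s \<in> borel_measurable M" by (rule Im) (use st in simp)
        have A1: "?A1 \<in> events" by measurable
        have A2: "?A2 \<in> events" by measurable
        note A12 = A1 A2
        have "{\<omega>\<in>A. norm (G k \<omega> - (J t \<omega> - J s \<omega>)) > \<delta>} \<subseteq> ?A1 \<union> ?A2 \<union> ?A3"
        proof
          fix \<omega> assume w: "\<omega> \<in> {\<omega>\<in>A. norm (G k \<omega> - (J t \<omega> - J s \<omega>)) > \<delta>}"
          have "G k \<omega> - (J t \<omega> - J s \<omega>) = ((?I k t \<omega> - J t \<omega>) - (?I k s \<omega> - J s \<omega>)) - Z k \<omega>"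
            using split[of k \<omega>] by (simp add: algebra_simps)
          then have "norm (G k \<omega> - (J t \<omega> - J s \<omega>))
              \<le> norm (?I k t \<omega> - J t \<omega>) + norm (?I k s \<omega> - J s \<omega>) + norm (Z k \<omega>)"
            by (metis (no_types, lifting) add_right_mono norm_triangle_ineq4 order_trans)
          then show "\<omega> \<in> ?A1 \<union> ?A2 \<union> ?A3" using w Asub by (auto simp: not_less)
        qed
        then have "prob {\<omega>\<in>A. norm (G k \<omega> - (J t \<omega> - J s \<omega>)) > \<delta>} \<le> prob (?A1 \<union> ?A2 \<union> ?A3)"
          using A12 A3 by (intro finite_measure_mono) auto
        also have "\<dots> \<le> prob ?A1 + prob ?A2 + prob ?A3"
          using A12 A3 measure_Un_le[of "?A1 \<union> ?A2" M ?A3] measure_Un_le[of ?A1 M ?A2] by auto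
        also have "prob ?A3 \<le> d / (\<delta> / 3)\<^sup>2
            + prob {\<omega>\<in>A. (\<Sum>i<n k. (\<sigma> k (Suc i) - \<sigma> k i) * (norm (\<zeta> k i \<omega>))\<^sup>2) > d}"
          unfolding Z_def by (rule brownian_sum_tail[OF PZ A d]) (use \<delta> in simp)
        also have "prob {\<omega>\<in>A. (\<Sum>i<n k. (\<sigma> k (Suc i) - \<sigma> k i) * (norm (\<zeta> k i \<omega>))\<^sup>2) > d} \<le> ?b3 d k"
        proof (rule finite_measure_mono)
          show "{\<omega>\<in>A. (\<Sum>i<n k. (\<sigma> k (Suc i) - \<sigma> k i) * (norm (\<zeta> k i \<omega>))\<^sup>2) > d} \<subseteq> {\<omega>\<in>space M. ?e k \<omega> > ennreal d}"
          proof safe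
            fix \<omega> assume w: "\<omega> \<in> A" "(\<Sum>i<n k. (\<sigma> k (Suc i) - \<sigma> k i) * (norm (\<zeta> k i \<omega>))\<^sup>2) > d"
            show "\<omega> \<in> space M" using w Asub by blast
            have "ennreal d < ennreal (\<Sum>i<n k. (\<sigma> k (Suc i) - \<sigma> k i) * (norm (\<zeta> k i \<omega>))\<^sup>2)"
              using w(2) d by (intro ennreal_lessI) auto
            also have "\<dots> \<le> ?e k \<omega>" by (rule err[OF w(1)])
            finally show "ennreal d < ?e k \<omega>" .
          qed
        qed measurable
        finally show ?thesis by simp
      qed
      show ?thesis
      proof (rule LIMSEQ_I)
        fix r :: real assume r: "0 < r"
        \<comment> \<open>Makes the term \<open>d / (\<delta> / 3)\<^sup>2\<close> equal to
          \<open>r / 2\<close>; the three remaining probabilities tend to \<open>0\<close> for this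
          fixed \<open>d\<close>.\<close>
        define d where "d = (\<delta> / 3)\<^sup>2 * (r / 2)"
        have d: "0 < d" using \<delta> r by (simp add: d_def)
        have "(\<lambda>k. ?b1 k + ?b2 k + (d / (\<delta> / 3)\<^sup>2 + ?b3 d k)) \<longlonglongrightarrow> 0 + 0 + (d / (\<delta> / 3)\<^sup>2 + 0)"
          using conv[of t "\<delta> / 3"] conv[of s "\<delta> / 3"] conv[of t d] st \<delta> d by (intro tendsto_add tendsto_const) auto
        moreover have "0 + 0 + (d / (\<delta> / 3)\<^sup>2 + 0) < r" using \<delta> r by (simp add: d_def)
        ultimately have "eventually (\<lambda>k. ?b1 k + ?b2 k + (d / (\<delta> / 3)\<^sup>2 + ?b3 d k) < r) sequentially"
          by (rule order_tendstoD(2))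
        then obtain k0 where "\<And>k. k \<ge> k0 \<Longrightarrow> ?b1 k + ?b2 k + (d / (\<delta> / 3)\<^sup>2 + ?b3 d k) < r"
          unfolding eventually_sequentially by blast
        then show "\<exists>no. \<forall>k\<ge>no. norm (prob {\<omega>\<in>A. norm (G k \<omega> - (J t \<omega> - J s \<omega>)) > \<delta>} - 0) < r"
          using bound[OF d] by (intro exI[of _ k0]) (auto intro: le_less_trans)
      qed
    qed
  qed
qed

end

subsection \<open>One step of the energy\<close>

lemma integral_increment_bound:
  fixes p :: "real \<Rightarrow> 'a::euclidean_space"
  assumes p: "continuous_on {0..} p" and t: "0 \<le> t" "0 \<le> h"
    and close: "\<And>u. u \<in> {t..t + h} \<Longrightarrow> norm (p u - p t) \<le> \<epsilon>"
  shows "norm (integral {0..t + h} p - integral {0..t} p - h *\<^sub>R p t) \<le> h * \<epsilon>"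
proof -
  have i: "p integrable_on {a..b}" if "0 \<le> a" for a b
    by (intro integrable_continuous_real continuous_on_subset[OF p]) (use that in auto)
  have "integral {0..t + h} p - integral {0..t} p = integral {t..t + h} p"
    using Henstock_Kurzweil_Integration.integral_combine[where a = 0 and c = t and b = "t + h" and f = p] t i by (simp add: algebra_simps)
  then have "((\<lambda>u. p u - p t) has_integral (integral {0..t + h} p - integral {0..t} p - h *\<^sub>R p t)) {t..t + h}"
    using has_integral_diff[OF integrable_integral[OF i[of t "t + h"]] has_integral_const_real[of "p t" t "t + h"]] t
    by simp
  moreover have "0 \<le> \<epsilon>" using close[of t] t by simp
  ultimately have "norm (integral {0..t + h} p - integral {0..t} p - h *\<^sub>R p t) \<le> \<epsilon> * measure lborel (cbox t (t + h))"
    using close by (intro has_integral_bound) auto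
  then show ?thesis using t by (simp add: mult.commute)
qed

text \<open>\<open>J\<close> is a fixed version of the Ito integral, and smoothness of the potential
  enters through \<open>descent\<close> and the Lipschitz bound on \<open>g\<close>. The sign
  \<open>0 < r\<close> lets the energy control \<open>f\<close>; \<open>r \<le> s\<close> gives
  \<open>0 \<le> m\<close> and is where the upper bound on the noise constant enters.\<close>

locale kinetic_sde = filtered_brownian_motion M F W
  for M :: "'w measure" and F :: "real \<Rightarrow> 'w measure" and W :: "real \<Rightarrow> 'w \<Rightarrow> real^'e" +
  fixes f :: "real^'d \<Rightarrow> real" and g :: "real^'d \<Rightarrow> real^'d" and S :: "real^'d \<Rightarrow> real^'e^'d"
    and X V J :: "real \<Rightarrow> 'w \<Rightarrow> real^'d" and D :: "(real^'d) set"
    and L s r \<sigma> \<mu> m K :: real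
  assumes descent: "\<And>x y. f y \<le> f x + g x \<bullet> (y - x) + s\<^sup>2 / 2 * (norm (y - x))\<^sup>2"
    and g_lipschitz: "(s\<^sup>2)-lipschitz_on UNIV g" and f_cont: "continuous_on UNIV f"
    and f_nonneg: "\<And>x. 0 \<le> f x" and S_lipschitz: "K-lipschitz_on UNIV S"
    and s_pos: "0 < s" and r_pos: "0 < r" and r_le: "r \<le> s" and r_sq: "r\<^sup>2 = s\<^sup>2 - L + s * \<sigma> / 4"
    and L_pos: "0 < L" and \<mu>_def: "\<mu> = 2 * s - r" and m_def: "m = 2 * (s - r)"
    and D_open: "open D"
    and D_gradient: "\<And>x. x \<in> D \<Longrightarrow> 2 * L * f x \<le> (norm (g x))\<^sup>2"
    and D_noise: "\<And>x. x \<in> D \<Longrightarrow> (norm (S x))\<^sup>2 \<le> \<sigma> * f x"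
    and X_adapted: "adapted F X" and X_cont: "continuous_process M X"
    and V_adapted: "adapted F V" and V_cont: "continuous_process M V"
    and ito: "ito_integral_process M F W (\<lambda>t \<omega>. S (X t \<omega>)) J"
    and sde: "AE \<omega> in M. \<forall>t\<ge>0. X t \<omega> = X 0 \<omega> + integral {0..t} (\<lambda>u. V u \<omega>) \<and>
      V t \<omega> = V 0 \<omega> - integral {0..t} (\<lambda>u. \<mu> *\<^sub>R V u \<omega> + g (X u \<omega>)) + J t \<omega>"
begin

abbreviation Y :: "real^'d \<Rightarrow> real^'d \<Rightarrow> real" where
  "Y \<equiv> energy (s + r) (s / 2) f g"

definition node :: "real \<Rightarrow> real \<Rightarrow> 'w set" where
  "node R t = {\<omega>\<in>space M. X t \<omega> \<in> D \<and> norm (V t \<omega>) \<le> R \<and> norm (g (X t \<omega>)) \<le> R \<and> norm (S (X t \<omega>)) \<le> R}"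

definition cell :: "real \<Rightarrow> real \<Rightarrow> real \<Rightarrow> 'w set" where
  "cell \<epsilon> t h = {\<omega>\<in>space M. (\<forall>u\<in>{t..t + h}. norm (X u \<omega> - X t \<omega>) \<le> \<epsilon>) \<and> (\<forall>u\<in>{t..t + h}. norm (V u \<omega> - V t \<omega>) \<le> \<epsilon>)}"

lemma \<mu>_nonneg: "0 \<le> \<mu>" and m_nonneg: "0 \<le> m"
  using s_pos r_le by (auto simp: \<mu>_def m_def)

lemma g_cont: "continuous_on UNIV g" using g_lipschitz by (rule lipschitz_on_continuous_on)
lemma S_cont: "continuous_on UNIV S" using S_lipschitz by (rule lipschitz_on_continuous_on)

lemma Y_lower: "r * f x \<le> Y x v"
proof (rule energy_lower_bound)
  show "(norm (g x))\<^sup>2 \<le> 2 * s\<^sup>2 * f x"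
    by (rule norm_gradient_sq_le[where f = f, OF descent f_nonneg]) (use s_pos in simp)
qed (rule s_pos)

lemma Y_nonneg: "0 \<le> Y x v"
  using Y_lower[of x v] f_nonneg[of x] r_pos by (meson less_imp_le mult_nonneg_nonneg order_trans)

lemma process_measurable:
  assumes "0 \<le> t"
  shows "X t \<in> borel_measurable (F t)" "V t \<in> borel_measurable (F t)"
    and "(\<lambda>\<omega>. g (X t \<omega>)) \<in> borel_measurable (F t)" "(\<lambda>\<omega>. S (X t \<omega>)) \<in> borel_measurable (F t)"
    and "(\<lambda>\<omega>. Y (X t \<omega>) (V t \<omega>)) \<in> borel_measurable M"
proof -
  show X: "X t \<in> borel_measurable (F t)" and V: "V t \<in> borel_measurable (F t)"
    using X_adapted V_adapted assms by (auto simp: adapted_def)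
  show G: "(\<lambda>\<omega>. g (X t \<omega>)) \<in> borel_measurable (F t)"
    by (rule measurable_compose[OF X borel_measurable_continuous_onI[OF g_cont]])
  show "(\<lambda>\<omega>. S (X t \<omega>)) \<in> borel_measurable (F t)"
    by (rule measurable_compose[OF X borel_measurable_continuous_onI[OF S_cont]])
  have "(\<lambda>\<omega>. f (X t \<omega>)) \<in> borel_measurable (F t)"
    by (rule measurable_compose[OF X borel_measurable_continuous_onI[OF f_cont]])
  then have "(\<lambda>\<omega>. Y (X t \<omega>) (V t \<omega>)) \<in> borel_measurable (F t)"
    unfolding energy_def using V G by measurable
  then show "(\<lambda>\<omega>. Y (X t \<omega>) (V t \<omega>)) \<in> borel_measurable M"
    using assms by (rule measurable_FD)
qed

text \<open>In \<open>D\<close> the lower bound on the gradient turns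
  \<open>norm (g x) \<le> R\<close> into a bound on \<open>f x\<close>. This is why
  \<open>node\<close> can restrict velocity, gradient and noise but not the position itself.\<close>

lemma Y_bound:
  assumes "x \<in> D" "norm v \<le> R" "norm (g x) \<le> R"
  shows "Y x v \<le> (s + r) * (R\<^sup>2 / (2 * L)) + R * R + s / 2 * R\<^sup>2"
proof -
  have R: "0 \<le> R" using assms norm_ge_zero order_trans by blast
  have "2 * L * f x \<le> R\<^sup>2"
    using D_gradient[OF assms(1)] power_mono[OF assms(3), of 2] by simp
  then have "f x \<le> R\<^sup>2 / (2 * L)" using L_pos by (simp add: field_simps)
  moreover have "g x \<bullet> v \<le> R * R"
    using norm_cauchy_schwarz[of "g x" v] mult_mono[OF assms(3,2)] R by simp
  moreover have "(norm v)\<^sup>2 \<le> R\<^sup>2" using assms(2) by (simp add: power_mono)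
  ultimately show ?thesis
    unfolding energy_def using s_pos r_pos by (intro add_mono mult_left_mono) auto
qed

lemma integrable_Y_on_node:
  assumes t: "0 \<le> t" and B: "B \<in> events" "B \<subseteq> node R t"
  shows "integrable M (\<lambda>\<omega>. indicator B \<omega> * Y (X t \<omega>) (V t \<omega>))"
proof (rule integrable_const_bound)
  let ?K = "(s + r) * (R\<^sup>2 / (2 * L)) + R * R + s / 2 * R\<^sup>2"
  have "0 \<le> ?K" using s_pos r_pos L_pos by auto
  then show "AE \<omega> in M. norm (indicator B \<omega> * Y (X t \<omega>) (V t \<omega>)) \<le> ?K"
    using B(2) Y_bound[of "X t _" "V t _" R] Y_nonneg
    by (intro AE_I2) (auto simp: indicator_def node_def abs_of_nonneg)
  show "(\<lambda>\<omega>. indicator B \<omega> * Y (X t \<omega>) (V t \<omega>)) \<in> borel_measurable M"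
    using process_measurable(5)[OF t] B(1) by measurable
qed

text \<open>\<open>m * h \<le> 1\<close> keeps the decay factor nonnegative and
  \<open>K * \<epsilon> \<le> 1\<close> keeps the oscillation of the noise coefficient below
  \<open>1\<close>. The bound \<open>1 / 2\<close> limits the Euler error to half of the distance
  \<open>1\<close> allowed in \<open>energy_local_lipschitz\<close>; the other half is left for the
  noise approximation.\<close>

definition admissible :: "real \<Rightarrow> real \<Rightarrow> bool" where
  "admissible h \<epsilon> \<longleftrightarrow> 0 < h \<and> h \<le> 1 \<and> h * (1 + \<mu> + s\<^sup>2) \<le> 1 / 2 \<and> m * h \<le> 1 \<and> 0 \<le> \<epsilon> \<and> \<epsilon> \<le> 1 \<and> K * \<epsilon> \<le> 1"

text \<open>On \<open>B'\<close> the endpoint is within \<open>h * \<epsilon>\<close> of one Euler step from time \<open>t\<close> driven by the Ito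
  increment. Off \<open>B'\<close> the nonnegative energy after this step is simply discarded, which is why no
  stopped process is needed.\<close>
lemma one_step:
  assumes "0 \<le> R"
  shows "\<exists>C\<ge>0. \<forall>t h \<epsilon> B B'. 0 \<le> t \<longrightarrow> admissible h \<epsilon> \<longrightarrow> B \<in> sets (F t) \<longrightarrow> B \<subseteq> node R t \<longrightarrow>
    B' \<in> events \<longrightarrow> B' \<subseteq> B \<inter> cell \<epsilon> t h \<inter> node R (t + h) \<longrightarrow>
      expectation (\<lambda>\<omega>. indicator B' \<omega> * Y (X (t + h) \<omega>) (V (t + h) \<omega>))
        \<le> (1 - m * h) * expectation (\<lambda>\<omega>. indicator B \<omega> * Y (X t \<omega>) (V t \<omega>)) + h * (C * (h + \<epsilon>))"
proof -
  \<comment> \<open>\<open>C1\<close> is the constant of \<open>energy_drift\<close>,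
    \<open>C2\<close> that of \<open>energy_local_lipschitz\<close>, and \<open>C3\<close> the bound
    of \<open>Y\<close> on a node. They are fixed before \<open>t\<close>, \<open>h\<close> and
    \<open>\<epsilon>\<close>, so the final constant is the same for all cells and meshes.\<close>
  define C1 where "C1 = (s + r) * s\<^sup>2 * R\<^sup>2 + s\<^sup>2 * (\<mu> + 1) * R\<^sup>2 + s * (\<mu> + 1)\<^sup>2 * R\<^sup>2 + s * (2 * R + 1)"
  define C2 where "C2 = (s + r) * (R + 2 * s\<^sup>2) + s\<^sup>2 * (R + 1) + R + 2 * (s / 2) * R"
  define C3 where "C3 = (s + r) * (R\<^sup>2 / (2 * L)) + R * R + s / 2 * R\<^sup>2"
  have K: "0 \<le> K" using S_lipschitz by (rule lipschitz_on_nonneg)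
  have C123: "0 \<le> C1" "0 \<le> C2" "0 \<le> C3"
    using s_pos r_pos L_pos \<mu>_nonneg assms by (auto simp: C1_def C2_def C3_def)
  define C where "C = C1 * (1 + K) + C2 * (1 + \<mu> + s\<^sup>2)"
  show ?thesis
  proof (intro exI[of _ C] conjI allI impI)
    show "0 \<le> C" using C123 K \<mu>_nonneg by (simp add: C_def)
    fix t h \<epsilon> B B'
    assume t: "0 \<le> t" and adm: "admissible h \<epsilon>"
      and B: "B \<in> sets (F t)" "B \<subseteq> node R t" and B': "B' \<in> events" "B' \<subseteq> B \<inter> cell \<epsilon> t h \<inter> node R (t + h)"
    have h: "0 < h" "h \<le> 1" "h * (1 + \<mu> + s\<^sup>2) \<le> 1 / 2" and \<epsilon>: "0 \<le> \<epsilon>" "\<epsilon> \<le> 1" "K * \<epsilon> \<le> 1"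
      using adm by (auto simp: admissible_def)
    have BM[measurable]: "B \<in> events" using B(1) sets_F_subset t by blast
    have th: "0 \<le> t + h" "t \<le> t + h" using t h by auto
    define \<rho> where "\<rho> = K * \<epsilon>"
    have \<rho>: "0 \<le> \<rho>" "\<rho> \<le> 1" using K \<epsilon> by (auto simp: \<rho>_def)
    \<comment> \<open>The centre of the ball must be bounded on the whole space, hence the cut-off
      outside \<open>B\<close>.\<close>
    define c where "c = (\<lambda>\<omega>. indicator B \<omega> *\<^sub>R S (X t \<omega>))"
    have cF: "c \<in> borel_measurable (F t)"
      unfolding c_def using process_measurable(4)[OF t] B(1) by measurable
    have cb: "norm (c \<omega>) \<le> R" if "\<omega> \<in> space M" for \<omega>
      using B(2) assms by (auto simp: c_def indicator_def node_def)
    obtain G where Gm: "\<And>k. G k \<in> borel_measurable M" and G2: "\<And>k. integrable M (\<lambda>\<omega>. (norm (G k \<omega>))\<^sup>2)"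
      and Gmean: "\<And>k U. U \<in> borel_measurable (F t) \<Longrightarrow> integrable M (\<lambda>\<omega>. norm (U \<omega>)) \<Longrightarrow>
        integrable M (\<lambda>\<omega>. U \<omega> \<bullet> G k \<omega>) \<and> expectation (\<lambda>\<omega>. U \<omega> \<bullet> G k \<omega>) = 0"
      and Gvar: "\<And>k B. B \<in> sets (F t) \<Longrightarrow> expectation (\<lambda>\<omega>. indicator B \<omega> * (norm (G k \<omega>))\<^sup>2)
        \<le> (t + h - t) * expectation (\<lambda>\<omega>. indicator B \<omega> * (norm (c \<omega>) + \<rho>)\<^sup>2)"
      and Glim: "\<And>A \<delta>. A \<in> events \<Longrightarrow> (\<And>\<omega> u. \<omega> \<in> A \<Longrightarrow> u \<in> {t..t + h} \<Longrightarrow> norm (S (X u \<omega>) - c \<omega>) \<le> \<rho>) \<Longrightarrow> 0 < \<delta> \<Longrightarrow>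
        (\<lambda>k. prob {\<omega>\<in>A. norm (G k \<omega> - (J (t + h) \<omega> - J t \<omega>)) > \<delta>}) \<longlonglongrightarrow> 0"
    proof (rule ito_increment_localized[OF ito t th(2) \<rho>(1) cF cb], goal_cases)
      case (2 G)
      show ?case by (rule 2(1)) (fact 2)+
    qed
    let ?x = "X t" and ?v = "V t"
    define y where "y = (\<lambda>\<omega>. ?x \<omega> + h *\<^sub>R ?v \<omega>)"
    define u where "u = (\<lambda>\<omega>. ?v \<omega> - h *\<^sub>R (\<mu> *\<^sub>R ?v \<omega> + g (?x \<omega>)))"
    \<comment> \<open>The factor of the noise in \<open>energy_add\<close> for
      \<open>b = s / 2\<close>, cut off outside \<open>B\<close>.\<close>
    define U where "U = (\<lambda>\<omega>. indicator B \<omega> *\<^sub>R (g (y \<omega>) + (2 * (s / 2)) *\<^sub>R u \<omega>))"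
    note pm = process_measurable[OF t]
    have yF: "y \<in> borel_measurable (F t)" and uF: "u \<in> borel_measurable (F t)"
      unfolding y_def u_def using pm by measurable
    have gyF: "(\<lambda>\<omega>. g (y \<omega>)) \<in> borel_measurable (F t)"
      by (rule measurable_compose[OF yF borel_measurable_continuous_onI[OF g_cont]])
    have fyF: "(\<lambda>\<omega>. f (y \<omega>)) \<in> borel_measurable (F t)"
      by (rule measurable_compose[OF yF borel_measurable_continuous_onI[OF f_cont]])
    have UF: "U \<in> borel_measurable (F t)"
      unfolding U_def using gyF uF B(1) by measurable
    have drift: "Y (y \<omega>) (u \<omega>) + s / 2 * (h * (norm (c \<omega>) + \<rho>)\<^sup>2)
        \<le> (1 - m * h) * Y (?x \<omega>) (?v \<omega>) + h * C1 * (h + \<rho>)" if "\<omega> \<in> B" for \<omega>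
    proof -
      have n: "?x \<omega> \<in> D" "norm (?v \<omega>) \<le> R" "norm (g (?x \<omega>)) \<le> R" "norm (S (?x \<omega>)) \<le> R"
        using that B(2) by (auto simp: node_def)
      have "norm (c \<omega>) = norm (S (?x \<omega>))" using that by (simp add: c_def)
      then show ?thesis
        unfolding y_def u_def C1_def
        using energy_drift[OF descent g_lipschitz s_pos _ r_sq D_gradient[OF n(1)] D_noise[OF n(1)]
            norm_ge_zero n(4) n(2) n(3) _ \<rho> \<mu>_nonneg \<mu>_def m_def, of h] h r_pos by simp
    qed
    have cint: "integrable M (\<lambda>\<omega>. indicator B \<omega> * (norm (c \<omega>) + \<rho>)\<^sup>2)"
    proof (rule integrable_const_bound[of _ "(R + \<rho>)\<^sup>2"])
      show "AE \<omega> in M. norm (indicator B \<omega> * (norm (c \<omega>) + \<rho>)\<^sup>2) \<le> (R + \<rho>)\<^sup>2"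
        using cb \<rho> by (intro AE_I2) (auto simp: indicator_def intro!: power_mono)
      show "(\<lambda>\<omega>. indicator B \<omega> * (norm (c \<omega>) + \<rho>)\<^sup>2) \<in> borel_measurable M"
        using measurable_FD[OF cF t] by measurable
    qed
    have Bint: "integrable M (\<lambda>\<omega>. indicator B \<omega> * Y (?x \<omega>) (?v \<omega>))"
      by (rule integrable_Y_on_node[OF t BM B(2)])
    \<comment> \<open>No growth bound on the Euler point is needed: the drift estimate, with its
      nonnegative noise term dropped, already dominates this nonnegative energy.\<close>
    have Dint: "integrable M (\<lambda>\<omega>. indicator B \<omega> * Y (y \<omega>) (u \<omega>))"
    proof (rule Bochner_Integration.integrable_bound)
      show "integrable M (\<lambda>\<omega>. (1 - m * h) * (indicator B \<omega> * Y (?x \<omega>) (?v \<omega>)) + h * C1 * (h + \<rho>))"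
        using Bint by simp
      have "(\<lambda>\<omega>. indicator B \<omega> * Y (y \<omega>) (u \<omega>)) \<in> borel_measurable (F t)"
        unfolding energy_def using gyF fyF uF B(1) by measurable
      then show "(\<lambda>\<omega>. indicator B \<omega> * Y (y \<omega>) (u \<omega>)) \<in> borel_measurable M"
        using t by (rule measurable_FD)
      show "AE \<omega> in M. norm (indicator B \<omega> * Y (y \<omega>) (u \<omega>))
        \<le> norm ((1 - m * h) * (indicator B \<omega> * Y (?x \<omega>) (?v \<omega>)) + h * C1 * (h + \<rho>))"
      proof (rule AE_I2)
        fix \<omega>
        have "0 \<le> h * C1 * (h + \<rho>)" using h \<rho> C123 by simp
        moreover have "0 \<le> s / 2 * (h * (norm (c \<omega>) + \<rho>)\<^sup>2)" using h s_pos by simp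
        ultimately show "norm (indicator B \<omega> * Y (y \<omega>) (u \<omega>))
            \<le> norm ((1 - m * h) * (indicator B \<omega> * Y (?x \<omega>) (?v \<omega>)) + h * C1 * (h + \<rho>))"
          using drift[of \<omega>] Y_nonneg[of "y \<omega>" "u \<omega>"] by (auto simp: indicator_def)
      qed
    qed
    have Uint: "integrable M (\<lambda>\<omega>. norm (U \<omega>))"
    proof (rule integrable_const_bound[of _ "R + s\<^sup>2 * R + s * (R + h * (\<mu> * R + R))"])
      show "(\<lambda>\<omega>. norm (U \<omega>)) \<in> borel_measurable M"
        using measurable_FD[OF UF t] by measurable
      show "AE \<omega> in M. norm (norm (U \<omega>)) \<le> R + s\<^sup>2 * R + s * (R + h * (\<mu> * R + R))"
      proof (rule AE_I2)
        fix \<omega>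
        have "norm (g (y \<omega>) + s *\<^sub>R u \<omega>) \<le> R + s\<^sup>2 * R + s * (R + h * (\<mu> * R + R))" if "\<omega> \<in> B"
        proof -
          have n: "norm (?v \<omega>) \<le> R" "norm (g (?x \<omega>)) \<le> R"
            using that B(2) by (auto simp: node_def)
          have "norm (g (y \<omega>) - g (?x \<omega>)) \<le> s\<^sup>2 * (h * norm (?v \<omega>))"
            using lipschitz_onD[OF g_lipschitz, of "y \<omega>" "?x \<omega>"] h by (simp add: y_def dist_norm)
          also have "\<dots> \<le> s\<^sup>2 * (1 * R)" using h n by (intro mult_left_mono mult_mono) auto
          finally have 1: "norm (g (y \<omega>)) \<le> R + s\<^sup>2 * R"
            using n norm_triangle_ineq2[of "g (y \<omega>)" "g (?x \<omega>)"] by simp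
          have "norm (\<mu> *\<^sub>R ?v \<omega> + g (?x \<omega>)) \<le> \<mu> * norm (?v \<omega>) + norm (g (?x \<omega>))"
            using norm_triangle_ineq[of "\<mu> *\<^sub>R ?v \<omega>" "g (?x \<omega>)"] \<mu>_nonneg by simp
          also have "\<dots> \<le> \<mu> * R + R" using n \<mu>_nonneg by (intro add_mono mult_left_mono) auto
          finally have hw: "h * norm (\<mu> *\<^sub>R ?v \<omega> + g (?x \<omega>)) \<le> h * (\<mu> * R + R)"
            using h by (intro mult_left_mono) auto
          have "norm (u \<omega>) \<le> norm (?v \<omega>) + h * norm (\<mu> *\<^sub>R ?v \<omega> + g (?x \<omega>))"
            using norm_triangle_ineq4[of "?v \<omega>" "h *\<^sub>R (\<mu> *\<^sub>R ?v \<omega> + g (?x \<omega>))"] h by (simp add: u_def)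
          then have "norm (u \<omega>) \<le> R + h * (\<mu> * R + R)" using n hw by linarith
          then have su: "s * norm (u \<omega>) \<le> s * (R + h * (\<mu> * R + R))"
            using s_pos by (intro mult_left_mono) auto
          have "norm (g (y \<omega>) + s *\<^sub>R u \<omega>) \<le> norm (g (y \<omega>)) + s * norm (u \<omega>)"
            using norm_triangle_ineq[of "g (y \<omega>)" "s *\<^sub>R u \<omega>"] s_pos by simp
          then show ?thesis using 1 su by linarith
        qed
        moreover have "0 \<le> R + s\<^sup>2 * R + s * (R + h * (\<mu> * R + R))"
          using assms s_pos h \<mu>_nonneg by simp
        ultimately show "norm (norm (U \<omega>)) \<le> R + s\<^sup>2 * R + s * (R + h * (\<mu> * R + R))"
          by (auto simp: U_def indicator_def)
      qed
    qed
    define E where "E = (1 - m * h) * expectation (\<lambda>\<omega>. indicator B \<omega> * Y (?x \<omega>) (?v \<omega>)) + h * C1 * (h + \<rho>)"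
    have GBint: "integrable M (\<lambda>\<omega>. indicator B \<omega> * (norm (G k \<omega>))\<^sup>2)" for k
      using integrable_mult_indicator[OF BM G2] by simp
    have eq: "indicator B \<omega> * Y (y \<omega>) (u \<omega> + G k \<omega>)
        = indicator B \<omega> * Y (y \<omega>) (u \<omega>) + U \<omega> \<bullet> G k \<omega> + s / 2 * (indicator B \<omega> * (norm (G k \<omega>))\<^sup>2)" for k \<omega>
      unfolding energy_add U_def by (auto simp: indicator_def)
    have Gint: "integrable M (\<lambda>\<omega>. indicator B \<omega> * Y (y \<omega>) (u \<omega> + G k \<omega>))" for k
      unfolding eq using Dint Gmean[OF UF Uint] GBint by simp
    have GE: "expectation (\<lambda>\<omega>. indicator B \<omega> * Y (y \<omega>) (u \<omega> + G k \<omega>)) \<le> E" for k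
    proof -
      have "expectation (\<lambda>\<omega>. indicator B \<omega> * Y (y \<omega>) (u \<omega> + G k \<omega>))
        = expectation (\<lambda>\<omega>. indicator B \<omega> * Y (y \<omega>) (u \<omega>))
          + s / 2 * expectation (\<lambda>\<omega>. indicator B \<omega> * (norm (G k \<omega>))\<^sup>2)"
        unfolding eq using Dint Gmean[OF UF Uint] GBint by simp
      also have "\<dots> \<le> expectation (\<lambda>\<omega>. indicator B \<omega> * Y (y \<omega>) (u \<omega>))
          + s / 2 * (h * expectation (\<lambda>\<omega>. indicator B \<omega> * (norm (c \<omega>) + \<rho>)\<^sup>2))"
        using Gvar[OF B(1), of k] s_pos by (intro add_left_mono mult_left_mono) auto
      also have "\<dots> = expectation (\<lambda>\<omega>. indicator B \<omega> * Y (y \<omega>) (u \<omega>)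
          + s / 2 * (h * (indicator B \<omega> * (norm (c \<omega>) + \<rho>)\<^sup>2)))"
        using Dint cint by simp
      also have "\<dots> \<le> expectation (\<lambda>\<omega>. (1 - m * h) * (indicator B \<omega> * Y (?x \<omega>) (?v \<omega>)) + h * C1 * (h + \<rho>))"
      proof (rule integral_mono)
        show "integrable M (\<lambda>\<omega>. indicator B \<omega> * Y (y \<omega>) (u \<omega>) + s / 2 * (h * (indicator B \<omega> * (norm (c \<omega>) + \<rho>)\<^sup>2)))"
          using Dint cint by simp
        show "integrable M (\<lambda>\<omega>. (1 - m * h) * (indicator B \<omega> * Y (?x \<omega>) (?v \<omega>)) + h * C1 * (h + \<rho>))"
          using Bint by simp
        fix \<omega>
        have "0 \<le> h * C1 * (h + \<rho>)" using h \<rho> C123 by simp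
        then show "indicator B \<omega> * Y (y \<omega>) (u \<omega>) + s / 2 * (h * (indicator B \<omega> * (norm (c \<omega>) + \<rho>)\<^sup>2))
            \<le> (1 - m * h) * (indicator B \<omega> * Y (?x \<omega>) (?v \<omega>)) + h * C1 * (h + \<rho>)"
          using drift[of \<omega>] by (auto simp: indicator_def)
      qed
      also have "\<dots> = E" unfolding E_def using Bint by (simp add: prob_space)
      finally show ?thesis .
    qed
    let ?Y' = "\<lambda>\<omega>. Y (X (t + h) \<omega>) (V (t + h) \<omega>)"
    \<comment> \<open>Dominates both Euler errors: \<open>h * \<epsilon>\<close> in the position and
      \<open>h * ((\<mu> + s\<^sup>2) * \<epsilon>)\<close> in the velocity.\<close>
    define e where "e = h * (\<epsilon> * (1 + \<mu> + s\<^sup>2))"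
    have e: "0 \<le> e" "e \<le> 1 / 2"
    proof -
      show "0 \<le> e" using h \<epsilon> \<mu>_nonneg by (simp add: e_def)
      have "e = \<epsilon> * (h * (1 + \<mu> + s\<^sup>2))" by (simp add: e_def)
      also have "\<dots> \<le> 1 * (1 / 2)" using h \<epsilon> \<mu>_nonneg by (intro mult_mono) auto
      finally show "e \<le> 1 / 2" by simp
    qed
    have split: "expectation (\<lambda>\<omega>. p \<omega> + q + C3 * indicator A \<omega>) = expectation p + q + C3 * prob A"
      if "integrable M p" "A \<in> events" for p q A
    proof -
      have "integrable M (indicator A :: 'w \<Rightarrow> real)"
        using that by (intro integrable_real_indicator) (auto simp: less_top[symmetric])
      then show ?thesis using that sets.sets_into_space[of A M] by (simp add: prob_space Int_absorb2)
    qed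
    have step: "expectation (\<lambda>\<omega>. indicator B' \<omega> * ?Y' \<omega>) \<le> E + C2 * (e + \<delta>)" if \<delta>: "0 < \<delta>" "\<delta> \<le> 1 / 2" for \<delta>
    proof -
      \<comment> \<open>\<open>G k\<close> approximates the Ito increment only in probability. Where
        it is not \<open>\<delta>\<close>-close, the energy at the endpoint is simply bounded by
        \<open>C3\<close>, since \<open>B'\<close> lies in a node, and the probability of this event
        vanishes as \<open>k\<close> grows.\<close>
      let ?bad = "\<lambda>k. {\<omega>\<in>B'. norm (G k \<omega> - (J (t + h) \<omega> - J t \<omega>)) > \<delta>}"
      have Jm: "J (t + h) \<in> borel_measurable M" "J t \<in> borel_measurable M"
        using ito t th measurable_FD[of "J t" t borel] measurable_FD[of "J (t + h)" "t + h" borel]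
        by (auto simp: ito_integral_process_def adapted_def)
      have badm: "?bad k \<in> events" for k
      proof -
        have "?bad k = B' \<inter> {\<omega>\<in>space M. norm (G k \<omega> - (J (t + h) \<omega> - J t \<omega>)) > \<delta>}"
          using B'(1) sets.sets_into_space by blast
        moreover have "{\<omega>\<in>space M. norm (G k \<omega> - (J (t + h) \<omega> - J t \<omega>)) > \<delta>} \<in> events"
          using Gm[of k] Jm by measurable
        ultimately show ?thesis using B'(1) by auto
      qed
      have "(\<lambda>k. prob (?bad k)) \<longlonglongrightarrow> 0"
      proof (rule Glim[OF B'(1) _ \<delta>(1)])
        fix \<omega> w assume w: "\<omega> \<in> B'" "w \<in> {t..t + h}"
        then have "norm (X w \<omega> - X t \<omega>) \<le> \<epsilon>" using B'(2) by (auto simp: cell_def)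
        then have "norm (S (X w \<omega>) - S (X t \<omega>)) \<le> K * \<epsilon>"
          using lipschitz_onD[OF S_lipschitz, of "X w \<omega>" "X t \<omega>"] K
          by (simp add: dist_norm) (meson mult_left_mono order_trans)
        then show "norm (S (X w \<omega>) - c \<omega>) \<le> \<rho>" using w B'(2) by (auto simp: c_def \<rho>_def)
      qed
      then have lim: "(\<lambda>k. E + C2 * (e + \<delta>) + C3 * prob (?bad k)) \<longlonglongrightarrow> E + C2 * (e + \<delta>) + C3 * 0"
        by (intro tendsto_add tendsto_mult tendsto_const)
      have bound: "expectation (\<lambda>\<omega>. indicator B' \<omega> * ?Y' \<omega>) \<le> E + C2 * (e + \<delta>) + C3 * prob (?bad k)" for k
      proof -
        have "expectation (\<lambda>\<omega>. indicator B' \<omega> * ?Y' \<omega>)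
          \<le> expectation (\<lambda>\<omega>. indicator B \<omega> * Y (y \<omega>) (u \<omega> + G k \<omega>) + C2 * (e + \<delta>) + C3 * indicator (?bad k) \<omega>)"
        proof (rule integral_mono_AE)
          show "integrable M (\<lambda>\<omega>. indicator B' \<omega> * ?Y' \<omega>)"
            by (rule integrable_Y_on_node[OF th(1) B'(1)]) (use B'(2) in blast)
          show "integrable M (\<lambda>\<omega>. indicator B \<omega> * Y (y \<omega>) (u \<omega> + G k \<omega>) + C2 * (e + \<delta>) + C3 * indicator (?bad k) \<omega>)"
            using Gint badm by (intro Bochner_Integration.integrable_add integrable_const integrable_mult_right integrable_real_indicator) (auto simp: less_top[symmetric])
          show "AE \<omega> in M. indicator B' \<omega> * ?Y' \<omega>
            \<le> indicator B \<omega> * Y (y \<omega>) (u \<omega> + G k \<omega>) + C2 * (e + \<delta>) + C3 * indicator (?bad k) \<omega>"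
            using sde AE_space
          proof eventually_elim
            case (elim \<omega>)
            have c0: "0 \<le> C2 * (e + \<delta>)" "0 \<le> indicator B \<omega> * Y (y \<omega>) (u \<omega> + G k \<omega>)"
              using C123 e \<delta> Y_nonneg by auto
            show ?case
            proof (cases "\<omega> \<in> B'")
              case False
              then show ?thesis using c0 C123 by (simp add: indicator_def)
            next
              case True
              then have wB: "\<omega> \<in> B" "\<omega> \<in> cell \<epsilon> t h" "\<omega> \<in> node R (t + h)" using B'(2) by auto
              then have n: "X (t + h) \<omega> \<in> D" "norm (V (t + h) \<omega>) \<le> R" "norm (g (X (t + h) \<omega>)) \<le> R"
                by (auto simp: node_def)
              have cl: "norm (X w \<omega> - X t \<omega>) \<le> \<epsilon>" "norm (V w \<omega> - V t \<omega>) \<le> \<epsilon>" if "w \<in> {t..t + h}" for w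
                using wB(2) that by (auto simp: cell_def)
              show ?thesis
              proof (cases "\<omega> \<in> ?bad k")
                case True
                then show ?thesis using c0 Y_bound[OF n] wB by (auto simp: C3_def)
              next
                case False
                then have GJ: "norm (G k \<omega> - (J (t + h) \<omega> - J t \<omega>)) \<le> \<delta>" using \<open>\<omega> \<in> B'\<close> by auto
                have cX: "continuous_on {0..} (\<lambda>t. X t \<omega>)" and cV: "continuous_on {0..} (\<lambda>t. V t \<omega>)"
                  using X_cont V_cont elim(2) by (auto simp: continuous_process_def)
                let ?p = "\<lambda>w. \<mu> *\<^sub>R V w \<omega> + g (X w \<omega>)"
                have cp: "continuous_on {0..} ?p"
                  by (intro continuous_intros cV continuous_on_compose2[OF g_cont cX]) auto
                have 1: "norm (X (t + h) \<omega> - y \<omega>) \<le> h * \<epsilon>"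
                proof -
                  have "X (t + h) \<omega> - y \<omega> = integral {0..t + h} (\<lambda>w. V w \<omega>) - integral {0..t} (\<lambda>w. V w \<omega>) - h *\<^sub>R V t \<omega>"
                    using elim(1)[rule_format, of t] elim(1)[rule_format, of "t + h"] t th by (simp add: y_def)
                  then show ?thesis
                    using integral_increment_bound[OF cV t, of h \<epsilon>] cl h by simp
                qed
                have 2: "norm (V (t + h) \<omega> - (u \<omega> + G k \<omega>)) \<le> h * ((\<mu> + s\<^sup>2) * \<epsilon>) + \<delta>"
                proof -
                  have "norm (?p w - ?p t) \<le> (\<mu> + s\<^sup>2) * \<epsilon>" if "w \<in> {t..t + h}" for w
                  proof -
                    have "norm (?p w - ?p t) = norm (\<mu> *\<^sub>R (V w \<omega> - V t \<omega>) + (g (X w \<omega>) - g (X t \<omega>)))"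
                      by (simp add: algebra_simps)
                    also have "\<dots> \<le> \<mu> * norm (V w \<omega> - V t \<omega>) + norm (g (X w \<omega>) - g (X t \<omega>))"
                      using norm_triangle_ineq[of "\<mu> *\<^sub>R (V w \<omega> - V t \<omega>)"] \<mu>_nonneg by (metis abs_of_nonneg norm_scaleR)
                    also have "norm (g (X w \<omega>) - g (X t \<omega>)) \<le> s\<^sup>2 * norm (X w \<omega> - X t \<omega>)"
                      using lipschitz_onD[OF g_lipschitz, of "X w \<omega>" "X t \<omega>"] by (simp add: dist_norm)
                    also have "\<mu> * norm (V w \<omega> - V t \<omega>) + s\<^sup>2 * norm (X w \<omega> - X t \<omega>) \<le> \<mu> * \<epsilon> + s\<^sup>2 * \<epsilon>"
                      using cl[OF that] \<mu>_nonneg by (intro add_mono mult_left_mono) auto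
                    finally show ?thesis by (simp add: algebra_simps)
                  qed
                  then have I: "norm (integral {0..t + h} ?p - integral {0..t} ?p - h *\<^sub>R ?p t) \<le> h * ((\<mu> + s\<^sup>2) * \<epsilon>)"
                    using integral_increment_bound[OF cp t, of h "(\<mu> + s\<^sup>2) * \<epsilon>"] h by simp
                  have "V (t + h) \<omega> - (u \<omega> + G k \<omega>)
                    = - (integral {0..t + h} ?p - integral {0..t} ?p - h *\<^sub>R ?p t) - (G k \<omega> - (J (t + h) \<omega> - J t \<omega>))"
                    using elim(1)[rule_format, of t] elim(1)[rule_format, of "t + h"] t th by (simp add: u_def)
                  then show ?thesis
                    using norm_triangle_ineq4[of "- (integral {0..t + h} ?p - integral {0..t} ?p - h *\<^sub>R ?p t)"
                        "G k \<omega> - (J (t + h) \<omega> - J t \<omega>)"] I GJ by (simp only: norm_minus_cancel)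
                qed
                have "h * \<epsilon> \<le> e" "h * ((\<mu> + s\<^sup>2) * \<epsilon>) \<le> e"
                  using h \<epsilon> \<mu>_nonneg by (auto simp: e_def algebra_simps)
                then have "?Y' \<omega> \<le> Y (y \<omega>) (u \<omega> + G k \<omega>) + C2 * (e + \<delta>)"
                  unfolding C2_def using 1 2 e \<delta> s_pos r_pos
                  by (intro energy_local_lipschitz[OF descent g_lipschitz _ _ n(2,3)]) auto
                then show ?thesis using wB \<open>\<omega> \<in> B'\<close> C123 by (simp add: indicator_def)
              qed
            qed
          qed
        qed
        also have "\<dots> = expectation (\<lambda>\<omega>. indicator B \<omega> * Y (y \<omega>) (u \<omega> + G k \<omega>)) + C2 * (e + \<delta>) + C3 * prob (?bad k)"
          by (rule split[OF Gint badm])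
        finally show ?thesis using GE[of k] by linarith
      qed
      have "expectation (\<lambda>\<omega>. indicator B' \<omega> * ?Y' \<omega>) \<le> E + C2 * (e + \<delta>) + C3 * 0"
        by (rule LIMSEQ_le_const[OF lim]) (use bound in blast)
      then show ?thesis by simp
    qed
    \<comment> \<open>The accuracy \<open>\<delta>\<close> of the noise approximation carries no
      factor \<open>h\<close>. It must be sent to \<open>0\<close> on the fixed cell, before the
      errors of all cells are summed.\<close>
    have "expectation (\<lambda>\<omega>. indicator B' \<omega> * ?Y' \<omega>) \<le> E + C2 * e"
    proof (rule field_le_epsilon)
      fix q :: real assume q: "0 < q"
      define \<delta> where "\<delta> = min (1 / 2) (q / (C2 + 1))"
      have \<delta>: "0 < \<delta>" "\<delta> \<le> 1 / 2"
        using q C123 unfolding \<delta>_def by (simp, intro min.cobounded1)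
      have "C2 * \<delta> \<le> (C2 + 1) * (q / (C2 + 1))"
        using \<delta> C123 q by (intro mult_mono) (auto simp: \<delta>_def)
      also have "\<dots> = q" using C123 by simp
      finally show "expectation (\<lambda>\<omega>. indicator B' \<omega> * ?Y' \<omega>) \<le> E + C2 * e + q"
        using step[OF \<delta>] by (simp add: algebra_simps)
    qed
    also have "\<dots> \<le> (1 - m * h) * expectation (\<lambda>\<omega>. indicator B \<omega> * Y (?x \<omega>) (?v \<omega>)) + h * (C * (h + \<epsilon>))"
    proof -
      have "C1 * (h + \<rho>) \<le> C1 * ((1 + K) * (h + \<epsilon>))"
        using C123 K h \<epsilon> by (intro mult_left_mono) (auto simp: \<rho>_def algebra_simps)
      moreover have "C2 * ((1 + \<mu> + s\<^sup>2) * \<epsilon>) \<le> C2 * ((1 + \<mu> + s\<^sup>2) * (h + \<epsilon>))"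
        using C123 \<mu>_nonneg h by (intro mult_left_mono) auto
      ultimately have "C1 * (h + \<rho>) + C2 * ((1 + \<mu> + s\<^sup>2) * \<epsilon>) \<le> C * (h + \<epsilon>)"
        unfolding C_def by (simp add: algebra_simps)
      then have "h * (C1 * (h + \<rho>) + C2 * ((1 + \<mu> + s\<^sup>2) * \<epsilon>)) \<le> h * (C * (h + \<epsilon>))"
        using h by simp
      then show ?thesis by (simp add: E_def e_def algebra_simps)
    qed
    finally show "expectation (\<lambda>\<omega>. indicator B' \<omega> * ?Y' \<omega>)
        \<le> (1 - m * h) * expectation (\<lambda>\<omega>. indicator B \<omega> * Y (?x \<omega>) (?v \<omega>)) + h * (C * (h + \<epsilon>))" .
  qed
qed

end

subsection \<open>Decay along the grid and passage to the limit\<close>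

text \<open>Continuity reduces the condition to the countably many rational times in the open
  interval, which are dense in \<open>{a..b}\<close> if \<open>a < b\<close>; for
  \<open>a = b\<close> there are none, hence the case distinction.\<close>

lemma path_bound_measurable:
  fixes q :: "real \<Rightarrow> 'w \<Rightarrow> real"
  assumes meas: "\<And>u. u \<in> {a..b} \<Longrightarrow> q u \<in> borel_measurable N"
    and cont: "\<And>\<omega>. \<omega> \<in> space N \<Longrightarrow> continuous_on {a..b} (\<lambda>u. q u \<omega>)"
  shows "{\<omega>\<in>space N. \<forall>u\<in>{a..b}. q u \<omega> \<le> c} \<in> sets N"
proof (cases "a < b")
  case False
  show ?thesis
  proof (cases "a = b")
    case True
    then have "{\<omega>\<in>space N. \<forall>u\<in>{a..b}. q u \<omega> \<le> c} = {\<omega>\<in>space N. q a \<omega> \<le> c}" by auto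
    moreover have "q a \<in> borel_measurable N" using meas True by simp
    ultimately show ?thesis by simp
  next
    case neq: False
    then have "{\<omega>\<in>space N. \<forall>u\<in>{a..b}. q u \<omega> \<le> c} = space N" using False by auto
    then show ?thesis by simp
  qed
next
  case True
  let ?Q = "{a<..<b} \<inter> \<rat>"
  have cl: "{a..b} \<subseteq> closure ?Q"
  proof
    fix x assume x: "x \<in> {a..b}"
    show "x \<in> closure ?Q"
      unfolding closure_approachable
    proof (intro allI impI)
      fix e :: real assume "0 < e"
      then have "max a (x - e) < min b (x + e)" using x True by auto
      then obtain y where "y \<in> \<rat>" "max a (x - e) < y" "y < min b (x + e)"
        using Rats_dense_in_real by blast
      then show "\<exists>y\<in>?Q. dist y x < e"
        by (intro bexI[of _ y]) (auto simp: dist_real_def)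
    qed
  qed
  have cl2: "closure ?Q \<subseteq> {a..b}" by (rule closure_minimal) auto
  have "{\<omega>\<in>space N. \<forall>u\<in>{a..b}. q u \<omega> \<le> c} = {\<omega>\<in>space N. \<forall>u\<in>?Q. q u \<omega> \<le> c}"
  proof safe
    fix \<omega> u assume w: "\<omega> \<in> space N" "\<forall>u\<in>?Q. q u \<omega> \<le> c" and u: "u \<in> {a..b}"
    show "q u \<omega> \<le> c"
      using continuous_le_on_closure[of ?Q "\<lambda>u. q u \<omega>" u c] continuous_on_subset[OF cont[OF w(1)] cl2] cl u w(2)
      by blast
  qed auto
  also have "\<dots> = space N - (\<Union>u\<in>?Q. {\<omega>\<in>space N. \<not> q u \<omega> \<le> c})" by auto
  also have "\<dots> \<in> sets N"
  proof (intro sets.Diff sets.top sets.countable_UN')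
    show "countable ?Q" by (rule countable_Int2[OF countable_rat])
    have "{\<omega>\<in>space N. \<not> q u \<omega> \<le> c} \<in> sets N" if "u \<in> ?Q" for u
    proof -
      have [measurable]: "q u \<in> borel_measurable N" using meas[of u] that by simp
      show ?thesis by measurable
    qed
    then show "(\<lambda>u. {\<omega>\<in>space N. \<not> q u \<omega> \<le> c}) ` ?Q \<subseteq> sets N" by auto
  qed
  finally show ?thesis .
qed

text \<open>Fatou's lemma with bounds that hold only eventually, in the form in which three limits
  can be nested.\<close>

lemma nn_integral_liminf_le:
  fixes u :: "nat \<Rightarrow> 'w \<Rightarrow> ennreal"
  assumes "\<And>n. u n \<in> borel_measurable M" and "eventually (\<lambda>n. (\<integral>\<^sup>+\<omega>. u n \<omega> \<partial>M) \<le> ennreal (b n)) sequentially"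
    and "b \<longlonglongrightarrow> c"
  shows "(\<integral>\<^sup>+\<omega>. liminf (\<lambda>n. u n \<omega>) \<partial>M) \<le> ennreal c"
proof -
  have "(\<integral>\<^sup>+\<omega>. liminf (\<lambda>n. u n \<omega>) \<partial>M) \<le> liminf (\<lambda>n. \<integral>\<^sup>+\<omega>. u n \<omega> \<partial>M)"
    by (rule nn_integral_liminf) (rule assms(1))
  also have "\<dots> \<le> liminf (\<lambda>n. ennreal (b n))" by (rule Liminf_mono[OF assms(2)])
  also have "\<dots> = ennreal c"
    by (rule lim_imp_Liminf) (use assms(3) in \<open>auto intro!: tendsto_ennrealI\<close>)
  finally show ?thesis .
qed

lemma liminf_eventually_const:
  fixes u :: "nat \<Rightarrow> ennreal"
  assumes "eventually (\<lambda>n. u n = c) sequentially"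
  shows "liminf u = c"
  using lim_imp_Liminf[OF sequentially_bot tendsto_eventually[OF assms]] .

text \<open>Openness of \<open>D\<close> matters for the strict inequality: a path that is in
  \<open>D\<close> at time \<open>t\<close> remains there a little longer, which moves the infimum
  strictly beyond \<open>t\<close>.\<close>

lemma exit_time_greater_iff:
  fixes X :: "real \<Rightarrow> 'w \<Rightarrow> 'a::metric_space"
  assumes X: "continuous_on {0..} (\<lambda>t. X t \<omega>)" and D: "open D" and t: "0 \<le> t"
  shows "ereal t < exit_time X D \<omega> \<longleftrightarrow> (\<forall>u\<in>{0..t}. X u \<omega> \<in> D)"
proof
  assume T: "ereal t < exit_time X D \<omega>"
  show "\<forall>u\<in>{0..t}. X u \<omega> \<in> D"
  proof (rule ballI, rule ccontr)
    fix u assume u: "u \<in> {0..t}" "X u \<omega> \<notin> D"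
    then have "exit_time X D \<omega> \<le> ereal u"
      unfolding exit_time_def by (intro Inf_lower) auto
    also have "\<dots> \<le> ereal t" using u by simp
    finally show False using T by simp
  qed
next
  assume inside: "\<forall>u\<in>{0..t}. X u \<omega> \<in> D"
  then obtain e where e: "0 < e" "ball (X t \<omega>) e \<subseteq> D" using t by (meson D openE atLeastAtMost_iff order_refl)
  obtain d where d: "0 < d" "\<And>u. u \<in> {0..} \<Longrightarrow> dist u t < d \<Longrightarrow> dist (X u \<omega>) (X t \<omega>) < e"
    using X[unfolded continuous_on_iff, rule_format, of t e] t e(1) by auto
  have "ereal (t + d) \<le> exit_time X D \<omega>"
    unfolding exit_time_def
  proof (rule Inf_greatest)
    fix y assume "y \<in> {ereal t |t. 0 \<le> t \<and> X t \<omega> \<notin> D}"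
    then obtain u where u: "y = ereal u" "0 \<le> u" "X u \<omega> \<notin> D" by auto
    have "t < u" using inside u by (metis atLeastAtMost_iff not_less)
    moreover have "\<not> dist u t < d"
      using d(2)[of u] u e(2) by (auto simp: dist_commute subset_iff)
    ultimately show "ereal (t + d) \<le> y" using u by (simp add: dist_real_def)
  qed
  moreover have "ereal t < ereal (t + d)" using d by simp
  ultimately show "ereal t < exit_time X D \<omega>" by (rule less_le_trans[rotated])
qed

context kinetic_sde
begin

definition chain :: "real \<Rightarrow> real \<Rightarrow> real \<Rightarrow> nat \<Rightarrow> 'w set" where
  "chain R \<epsilon> h n = {\<omega>. (\<forall>i\<le>n. \<omega> \<in> node R (real i * h)) \<and> (\<forall>i<n. \<omega> \<in> cell \<epsilon> (real i * h) h)}"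

definition inside :: "real \<Rightarrow> 'w set" where
  "inside t = {\<omega>\<in>space M. \<forall>u\<in>{0..t}. X u \<omega> \<in> D}"

lemma path_continuous:
  assumes "\<omega> \<in> space M"
  shows "continuous_on {0..} (\<lambda>t. X t \<omega>)" "continuous_on {0..} (\<lambda>t. V t \<omega>)"
  using X_cont V_cont assms unfolding continuous_process_def by blast+

lemma node_sets: assumes "0 \<le> t" shows "node R t \<in> sets (F t)"
proof -
  note [measurable] = process_measurable(1-4)[OF assms]
  have [measurable]: "D \<in> sets borel" using D_open by simp
  have "{\<omega>\<in>space (F t). X t \<omega> \<in> D \<and> norm (V t \<omega>) \<le> R \<and> norm (g (X t \<omega>)) \<le> R \<and> norm (S (X t \<omega>)) \<le> R} \<in> sets (F t)"
    by measurable
  then show ?thesis unfolding node_def space_F[OF assms] .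
qed

lemma cell_sets:
  assumes t: "0 \<le> t" "0 \<le> h"
  shows "cell \<epsilon> t h \<in> sets (F (t + h))"
proof -
  have th: "0 \<le> t + h" using t by simp
  have *: "{\<omega>\<in>space (F (t + h)). \<forall>u\<in>{t..t + h}. norm (Z u \<omega> - Z t \<omega>) \<le> \<epsilon>} \<in> sets (F (t + h))"
    if Z: "\<And>u. 0 \<le> u \<Longrightarrow> Z u \<in> borel_measurable (F u)" "\<And>\<omega>. \<omega> \<in> space M \<Longrightarrow> continuous_on {0..} (\<lambda>t. Z t \<omega>)"
    for Z :: "real \<Rightarrow> 'w \<Rightarrow> real^'d"
  proof (rule path_bound_measurable)
    fix u assume u: "u \<in> {t..t + h}"
    have "Z u \<in> borel_measurable (F (t + h))" "Z t \<in> borel_measurable (F (t + h))"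
      using measurable_F_mono[OF Z(1)[of u], of "t + h"] measurable_F_mono[OF Z(1)[of t], of "t + h"] u t by auto
    then show "(\<lambda>\<omega>. norm (Z u \<omega> - Z t \<omega>)) \<in> borel_measurable (F (t + h))" by measurable
  next
    fix \<omega> assume "\<omega> \<in> space (F (t + h))"
    then have "continuous_on {t..t + h} (\<lambda>u. Z u \<omega>)"
      using space_F[OF th] Z(2) continuous_on_subset t by fastforce
    then show "continuous_on {t..t + h} (\<lambda>u. norm (Z u \<omega> - Z t \<omega>))" by (intro continuous_intros)
  qed
  have "cell \<epsilon> t h = {\<omega>\<in>space (F (t + h)). \<forall>u\<in>{t..t + h}. norm (X u \<omega> - X t \<omega>) \<le> \<epsilon>}
      \<inter> {\<omega>\<in>space (F (t + h)). \<forall>u\<in>{t..t + h}. norm (V u \<omega> - V t \<omega>) \<le> \<epsilon>}"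
    by (auto simp: cell_def space_F[OF th])
  then show ?thesis
    using *[of X] *[of V] process_measurable path_continuous by auto
qed

lemma chain_Suc:
  "chain R \<epsilon> h (Suc n) = chain R \<epsilon> h n \<inter> cell \<epsilon> (real n * h) h \<inter> node R (real n * h + h)"
proof -
  have "real (Suc n) * h = real n * h + h" by (simp add: algebra_simps)
  then show ?thesis
    unfolding chain_def le_Suc_eq less_Suc_eq by auto
qed

text \<open>Adaptedness is what allows a chain to serve as the event \<open>B\<close> of
  \<open>one_step\<close> for the next cell.\<close>

lemma chain_sets: assumes "0 \<le> h" shows "chain R \<epsilon> h n \<in> sets (F (real n * h))"
proof (induction n)
  case 0
  have "chain R \<epsilon> h 0 = node R 0" by (auto simp: chain_def)
  then show ?case using node_sets[of 0] by simp
next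
  case (Suc n)
  have nh: "0 \<le> real n * h" "0 \<le> real n * h + h" using assms by auto
  have eq: "real (Suc n) * h = real n * h + h" by (simp add: algebra_simps)
  have "chain R \<epsilon> h n \<in> sets (F (real n * h + h))"
    using Suc sets_F_mono[OF nh(1), of "real n * h + h"] assms by auto
  then show ?case
    unfolding eq chain_Suc using cell_sets[OF nh(1) assms] node_sets[OF nh(2)] by auto
qed

lemma chain_subset_node: "chain R \<epsilon> h n \<subseteq> node R (real n * h)"
  unfolding chain_def by blast

text \<open>Iterates \<open>one_step\<close> with consecutive chains as \<open>B\<close> and
  \<open>B'\<close>. The factors \<open>1 - m * h\<close> lie in \<open>[0, 1]\<close>, so the
  \<open>n\<close> errors at most add up, and their product is at most
  \<open>exp (- m * (real n * h))\<close>. \<open>C\<close> depends on \<open>R\<close> but is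
  chosen before \<open>h\<close>, \<open>\<epsilon>\<close> and \<open>n\<close>.\<close>

lemma chain_decay:
  assumes Y0: "integrable M (\<lambda>\<omega>. Y (X 0 \<omega>) (V 0 \<omega>))" and "0 \<le> R"
  shows "\<exists>C\<ge>0. \<forall>h \<epsilon> n. admissible h \<epsilon> \<longrightarrow>
      expectation (\<lambda>\<omega>. indicator (chain R \<epsilon> h n) \<omega> * Y (X (real n * h) \<omega>) (V (real n * h) \<omega>))
        \<le> exp (- m * (real n * h)) * expectation (\<lambda>\<omega>. Y (X 0 \<omega>) (V 0 \<omega>)) + real n * h * (C * (h + \<epsilon>))"
proof -
  obtain C where C: "0 \<le> C"
    and st: "\<forall>t h \<epsilon> B B'. 0 \<le> t \<longrightarrow> admissible h \<epsilon> \<longrightarrow> B \<in> sets (F t) \<longrightarrow> B \<subseteq> node R t \<longrightarrow>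
    B' \<in> events \<longrightarrow> B' \<subseteq> B \<inter> cell \<epsilon> t h \<inter> node R (t + h) \<longrightarrow>
      expectation (\<lambda>\<omega>. indicator B' \<omega> * Y (X (t + h) \<omega>) (V (t + h) \<omega>))
        \<le> (1 - m * h) * expectation (\<lambda>\<omega>. indicator B \<omega> * Y (X t \<omega>) (V t \<omega>)) + h * (C * (h + \<epsilon>))"
    using one_step[OF \<open>0 \<le> R\<close>] by blast
  show ?thesis
  proof (intro exI[of _ C] conjI allI impI C)
    fix h \<epsilon> and n :: nat
    assume adm: "admissible h \<epsilon>"
    then have h: "0 < h" "m * h \<le> 1" and \<epsilon>: "0 \<le> \<epsilon>" by (auto simp: admissible_def)
    define a where "a = (\<lambda>n. expectation (\<lambda>\<omega>. indicator (chain R \<epsilon> h n) \<omega> * Y (X (real n * h) \<omega>) (V (real n * h) \<omega>)))"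
    define A where "A = expectation (\<lambda>\<omega>. Y (X 0 \<omega>) (V 0 \<omega>))"
    define e where "e = h * (C * (h + \<epsilon>))"
    have e: "0 \<le> e" using h \<epsilon> C by (simp add: e_def)
    have q: "0 \<le> 1 - m * h" "1 - m * h \<le> 1" using h m_nonneg by auto
    have A: "0 \<le> A" unfolding A_def using Y_nonneg by simp
    have chM: "chain R \<epsilon> h n \<in> events" for n
      using chain_sets[of h R \<epsilon> n] sets_F_subset[of "real n * h"] h by auto
    have a0: "a 0 \<le> A"
      unfolding a_def A_def using Y_nonneg by (intro integral_mono' Y0) (auto simp: indicator_def)
    have aS: "a (Suc n) \<le> (1 - m * h) * a n + e" for n
    proof -
      have eq: "real (Suc n) * h = real n * h + h" by (simp add: algebra_simps)
      show ?thesis unfolding a_def e_def eq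
        by (rule st[rule_format]) (use h adm chain_sets[of h R \<epsilon> n] chM[of "Suc n"] chain_subset_node in \<open>auto simp: chain_Suc\<close>)
    qed
    have "a n \<le> (1 - m * h) ^ n * A + real n * e"
    proof (induction n)
      case 0
      then show ?case using a0 by simp
    next
      case (Suc n)
      have "a (Suc n) \<le> (1 - m * h) * ((1 - m * h) ^ n * A + real n * e) + e"
        using aS[of n] mult_left_mono[OF Suc q(1)] by linarith
      also have "\<dots> = (1 - m * h) ^ Suc n * A + (1 - m * h) * (real n * e) + e" by (simp add: algebra_simps)
      also have "(1 - m * h) * (real n * e) \<le> 1 * (real n * e)"
        using q e by (intro mult_right_mono) auto
      finally show ?case by (simp add: algebra_simps)
    qed
    also have "\<dots> \<le> exp (- m * h) ^ n * A + real n * e"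
      using exp_ge_add_one_self[of "- m * h"] q A
      by (intro add_right_mono mult_right_mono power_mono) auto
    also have "exp (- m * h) ^ n = exp (- m * (real n * h))"
      by (simp add: exp_of_nat_mult[symmetric] algebra_simps)
    finally show "expectation (\<lambda>\<omega>. indicator (chain R \<epsilon> h n) \<omega> * Y (X (real n * h) \<omega>) (V (real n * h) \<omega>))
        \<le> exp (- m * (real n * h)) * expectation (\<lambda>\<omega>. Y (X 0 \<omega>) (V 0 \<omega>)) + real n * h * (C * (h + \<epsilon>))"
      unfolding a_def A_def e_def by (simp only: mult.assoc)
  qed
qed

text \<open>A path on \<open>[0, t]\<close> is bounded and uniformly continuous. The threshold for
  \<open>R\<close> comes before \<open>\<epsilon>\<close>, and both before the mesh; the limits are
  later taken in the opposite order.\<close>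

lemma eventually_chain:
  assumes \<omega>: "\<omega> \<in> inside t" and t: "0 < t"
  shows "\<exists>R0. \<forall>R \<epsilon>. R0 \<le> R \<longrightarrow> 0 < \<epsilon> \<longrightarrow> eventually (\<lambda>n. \<omega> \<in> chain R \<epsilon> (t / real n) n) sequentially"
proof -
  have sp: "\<omega> \<in> space M" and D: "\<And>u. u \<in> {0..t} \<Longrightarrow> X u \<omega> \<in> D" using \<omega> by (auto simp: inside_def)
  have cX: "continuous_on {0..t} (\<lambda>t. X t \<omega>)" and cV: "continuous_on {0..t} (\<lambda>t. V t \<omega>)"
    using path_continuous[OF sp] by (auto elim: continuous_on_subset)
  have bnd: "\<exists>b. \<forall>u\<in>{0..t}. norm (p u) \<le> b" if "continuous_on {0..t} p" for p :: "real \<Rightarrow> 'x::real_normed_vector"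
    using compact_imp_bounded[OF compact_continuous_image[OF that compact_Icc]] by (auto simp: bounded_iff)
  obtain b1 where b1: "\<And>u. u \<in> {0..t} \<Longrightarrow> norm (V u \<omega>) \<le> b1" using bnd[OF cV] by blast
  obtain b2 where b2: "\<And>u. u \<in> {0..t} \<Longrightarrow> norm (g (X u \<omega>)) \<le> b2"
    using bnd[OF continuous_on_compose2[OF g_cont cX]] by blast
  obtain b3 where b3: "\<And>u. u \<in> {0..t} \<Longrightarrow> norm (S (X u \<omega>)) \<le> b3"
    using bnd[OF continuous_on_compose2[OF S_cont cX]] by blast
  show ?thesis
  proof (intro exI[of _ "max b1 (max b2 b3)"] allI impI)
    fix R \<epsilon> :: real assume R: "max b1 (max b2 b3) \<le> R" and \<epsilon>: "0 < \<epsilon>"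
    have uX: "uniformly_continuous_on {0..t} (\<lambda>t. X t \<omega>)" and uV: "uniformly_continuous_on {0..t} (\<lambda>t. V t \<omega>)"
      using cX cV by (auto intro: compact_uniformly_continuous)
    obtain d1 where d1: "0 < d1" "\<And>u w. u \<in> {0..t} \<Longrightarrow> w \<in> {0..t} \<Longrightarrow> dist w u < d1 \<Longrightarrow> dist (X w \<omega>) (X u \<omega>) < \<epsilon>"
      using uX \<epsilon> unfolding uniformly_continuous_on_def by metis
    obtain d2 where d2: "0 < d2" "\<And>u w. u \<in> {0..t} \<Longrightarrow> w \<in> {0..t} \<Longrightarrow> dist w u < d2 \<Longrightarrow> dist (V w \<omega>) (V u \<omega>) < \<epsilon>"
      using uV \<epsilon> unfolding uniformly_continuous_on_def by metis
    have "(\<lambda>n. t / real n) \<longlonglongrightarrow> 0" by (rule lim_const_over_n)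
    then have "eventually (\<lambda>n. t / real n < min d1 d2) sequentially"
      using d1 d2 by (intro order_tendstoD(2)) auto
    then show "eventually (\<lambda>n. \<omega> \<in> chain R \<epsilon> (t / real n) n) sequentially"
      using eventually_gt_at_top[of 0]
    proof eventually_elim
      case (elim n)
      have le: "real i * (t / real n) \<in> {0..t}" if "i \<le> n" for i
      proof -
        have "real i * (t / real n) \<le> real n * (t / real n)"
          using that t by (intro mult_right_mono) auto
        then show ?thesis using elim t by simp
      qed
      have "\<omega> \<in> node R (real i * (t / real n))" if "i \<le> n" for i
        using le[OF that] sp D b1 b2 b3 R unfolding node_def by (fastforce intro: order_trans)
      moreover have "\<omega> \<in> cell \<epsilon> (real i * (t / real n)) (t / real n)" if "i < n" for i
      proof -
        let ?u = "real i * (t / real n)"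
        have u: "?u \<in> {0..t}" using le[of i] that by simp
        have "?u + t / real n = real (Suc i) * (t / real n)" by (simp add: algebra_simps add_divide_distrib)
        then have "?u + t / real n \<le> t" using le[of "Suc i"] that by simp
        then have w: "w \<in> {0..t} \<and> dist w ?u < d1 \<and> dist w ?u < d2" if "w \<in> {?u..?u + t / real n}" for w
          using that u elim(1) by (auto simp: dist_real_def)
        have "norm (X w \<omega> - X ?u \<omega>) \<le> \<epsilon> \<and> norm (V w \<omega> - V ?u \<omega>) \<le> \<epsilon>" if "w \<in> {?u..?u + t / real n}" for w
          using w[OF that] d1(2)[OF u, of w] d2(2)[OF u, of w] unfolding dist_norm by auto
        then show ?thesis unfolding cell_def using sp by blast
      qed
      ultimately show ?case by (auto simp: chain_def)
    qed
  qed
qed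

text \<open>By compactness a path that stays in \<open>D\<close> keeps a positive distance from the
  complement. This writes the event as a countable union of events covered by
  \<open>path_bound_measurable\<close>.\<close>

lemma inside_sets: assumes t: "0 \<le> t" shows "inside t \<in> events"
\<comment> \<open>\<open>infdist\<close> to the empty set is \<open>0\<close> by convention, so the
  distance argument fails for an empty complement.\<close>
proof (cases "D = UNIV")
  case True
  then show ?thesis unfolding inside_def by simp
next
  case False
  have cl: "closed (- D)" "- D \<noteq> {}" using D_open False by auto
  let ?d = "\<lambda>u \<omega>. - infdist (X u \<omega>) (- D)"
  have eq: "inside t = (\<Union>n::nat. {\<omega>\<in>space M. \<forall>u\<in>{0..t}. ?d u \<omega> \<le> - inverse (real (Suc n))})"
  proof (rule set_eqI, rule iffI)
    fix \<omega> assume w: "\<omega> \<in> inside t"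
    then have sp: "\<omega> \<in> space M" by (simp add: inside_def)
    have "continuous_on {0..t} (\<lambda>u. infdist (X u \<omega>) (- D))"
      using path_continuous(1)[OF sp] by (intro continuous_on_infdist) (auto elim: continuous_on_subset)
    then obtain u where u: "u \<in> {0..t}" "\<And>w. w \<in> {0..t} \<Longrightarrow> infdist (X u \<omega>) (- D) \<le> infdist (X w \<omega>) (- D)"
      using continuous_attains_inf[of "{0..t}" "\<lambda>u. infdist (X u \<omega>) (- D)"] t by auto
    have "X u \<omega> \<notin> - D" using w u(1) by (auto simp: inside_def)
    then have "0 < infdist (X u \<omega>) (- D)"
      using in_closed_iff_infdist_zero[OF cl] infdist_nonneg by (metis less_le)
    then obtain n where "inverse (real (Suc n)) < infdist (X u \<omega>) (- D)"
      using reals_Archimedean by blast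
    then have "\<forall>w\<in>{0..t}. ?d w \<omega> \<le> - inverse (real (Suc n))" using u(2) by force
    then show "\<omega> \<in> (\<Union>n::nat. {\<omega>\<in>space M. \<forall>u\<in>{0..t}. ?d u \<omega> \<le> - inverse (real (Suc n))})" using sp by blast
  next
    fix \<omega> assume "\<omega> \<in> (\<Union>n::nat. {\<omega>\<in>space M. \<forall>u\<in>{0..t}. ?d u \<omega> \<le> - inverse (real (Suc n))})"
    then obtain n :: nat where sp: "\<omega> \<in> space M" and "\<forall>u\<in>{0..t}. ?d u \<omega> \<le> - inverse (real (Suc n))"
      by blast
    then have n: "inverse (real (Suc n)) \<le> infdist (X u \<omega>) (- D)" if "u \<in> {0..t}" for u using that by force
    have "X u \<omega> \<in> D" if "u \<in> {0..t}" for u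
    proof (rule ccontr)
      assume "X u \<omega> \<notin> D"
      then have "infdist (X u \<omega>) (- D) = 0" by simp
      then show False using n[OF that] by (simp add: field_simps)
    qed
    then show "\<omega> \<in> inside t" using sp by (simp add: inside_def)
  qed
  have "{\<omega>\<in>space M. \<forall>u\<in>{0..t}. ?d u \<omega> \<le> - inverse (real (Suc n))} \<in> events" for n
  proof (rule path_bound_measurable)
    fix u assume "u \<in> {0..t}"
    then have "X u \<in> borel_measurable M" using measurable_FD[OF process_measurable(1)] by auto
    then show "?d u \<in> borel_measurable M"
      by (intro borel_measurable_uminus)
        (rule measurable_compose[OF _ borel_measurable_continuous_onI], auto intro!: continuous_intros)
  next
    fix \<omega> assume "\<omega> \<in> space M"
    then have "continuous_on {0..t} (\<lambda>u. X u \<omega>)"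
      by (intro continuous_on_subset[OF path_continuous(1)]) auto
    then show "continuous_on {0..t} (\<lambda>u. ?d u \<omega>)"
      by (intro continuous_on_minus continuous_on_infdist)
  qed
  then show ?thesis unfolding eq by auto
qed

text \<open>The error \<open>t * (C * (t / real n + \<epsilon>))\<close> has a constant depending on
  \<open>R\<close>. Hence the mesh goes to \<open>0\<close> first, then \<open>\<epsilon>\<close>,
  and \<open>R\<close> goes to infinity last, when no error is left.\<close>

lemma energy_decay:
  assumes Y0: "integrable M (\<lambda>\<omega>. Y (X 0 \<omega>) (V 0 \<omega>))" and t: "0 \<le> t"
  shows "(\<integral>\<^sup>+\<omega>. indicator (inside t) \<omega> * ennreal (Y (X t \<omega>) (V t \<omega>)) \<partial>M)
    \<le> ennreal (exp (- m * t) * expectation (\<lambda>\<omega>. Y (X 0 \<omega>) (V 0 \<omega>)))"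
\<comment> \<open>At \<open>t = 0\<close> the mesh \<open>t / real n\<close> would be
  \<open>0\<close>, which is not admissible.\<close>
proof (cases "t = 0")
  case True
  have "(\<integral>\<^sup>+\<omega>. indicator (inside 0) \<omega> * ennreal (Y (X 0 \<omega>) (V 0 \<omega>)) \<partial>M) \<le> (\<integral>\<^sup>+\<omega>. ennreal (Y (X 0 \<omega>) (V 0 \<omega>)) \<partial>M)"
    by (intro nn_integral_mono) (auto simp: indicator_def)
  also have "\<dots> = ennreal (expectation (\<lambda>\<omega>. Y (X 0 \<omega>) (V 0 \<omega>)))"
    by (rule nn_integral_eq_integral[OF Y0]) (simp add: Y_nonneg)
  finally show ?thesis using True by simp
next
  case False
  then have t0: "0 < t" using t by simp
  let ?y = "\<lambda>\<omega>. ennreal (Y (X t \<omega>) (V t \<omega>))"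
  define A where "A = exp (- m * t) * expectation (\<lambda>\<omega>. Y (X 0 \<omega>) (V 0 \<omega>))"
  define \<epsilon> where "\<epsilon> = (\<lambda>j. inverse (real (Suc j)))"
  define \<Phi> where "\<Phi> = (\<lambda>R j n \<omega>. indicator (chain (real R) (\<epsilon> j) (t / real n) n) \<omega> * ?y \<omega>)"
  have \<epsilon>: "0 < \<epsilon> j" "\<epsilon> j \<le> 1" for j by (auto simp: \<epsilon>_def inverse_le_1_iff)
  have \<epsilon>lim: "\<epsilon> \<longlonglongrightarrow> 0" unfolding \<epsilon>_def by (rule LIMSEQ_inverse_real_of_nat)
  have hlim: "(\<lambda>n. t / real n) \<longlonglongrightarrow> 0" by (rule lim_const_over_n)
  have chM: "chain R e (t / real n) n \<in> events" for R e n
  proof -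
    have "0 \<le> t / real n" using t by simp
    then have "chain R e (t / real n) n \<in> sets (F (real n * (t / real n)))" "0 \<le> real n * (t / real n)"
      by (rule chain_sets, intro mult_nonneg_nonneg) auto
    then show ?thesis using sets_F_subset by blast
  qed
  have ym: "?y \<in> borel_measurable M" using process_measurable(5)[OF t] by measurable
  have \<Phi>m: "\<Phi> R j n \<in> borel_measurable M" for R j n
    unfolding \<Phi>_def using chM ym by measurable
  have s1: "eventually (\<lambda>j. (\<integral>\<^sup>+\<omega>. liminf (\<lambda>n. \<Phi> R j n \<omega>) \<partial>M) \<le> ennreal (A + t * (C * \<epsilon> j))) sequentially"
    if decay: "\<forall>h \<epsilon> n. admissible h \<epsilon> \<longrightarrow>
      expectation (\<lambda>\<omega>. indicator (chain (real R) \<epsilon> h n) \<omega> * Y (X (real n * h) \<omega>) (V (real n * h) \<omega>))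
        \<le> exp (- m * (real n * h)) * expectation (\<lambda>\<omega>. Y (X 0 \<omega>) (V 0 \<omega>)) + real n * h * (C * (h + \<epsilon>))" for R C
  proof -
    have "(\<lambda>j. K * \<epsilon> j) \<longlonglongrightarrow> K * 0" by (intro tendsto_mult tendsto_const \<epsilon>lim)
    then have "eventually (\<lambda>j. K * \<epsilon> j < 1) sequentially" by (rule order_tendstoD(2)) simp
    then show ?thesis
    proof eventually_elim
      case (elim j)
      show ?case
      proof (rule nn_integral_liminf_le[OF \<Phi>m])
        have "(\<lambda>n. t / real n * (1 + \<mu> + s\<^sup>2)) \<longlonglongrightarrow> 0 * (1 + \<mu> + s\<^sup>2)" "(\<lambda>n. m * (t / real n)) \<longlonglongrightarrow> m * 0"
          by (intro tendsto_mult tendsto_const hlim)+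
        then have "eventually (\<lambda>n. t / real n * (1 + \<mu> + s\<^sup>2) < 1 / 2) sequentially"
          "eventually (\<lambda>n. m * (t / real n) < 1) sequentially" "eventually (\<lambda>n. t / real n < 1) sequentially"
          using hlim by (simp_all only: order_tendstoD(2) mult_zero_left mult_zero_right zero_less_one half_gt_zero_iff)
        then show "eventually (\<lambda>n. (\<integral>\<^sup>+\<omega>. \<Phi> R j n \<omega> \<partial>M) \<le> ennreal (A + t * (C * (t / real n + \<epsilon> j)))) sequentially"
          using eventually_gt_at_top[of 0]
        proof eventually_elim
          case (elim n)
          have nt: "real n * (t / real n) = t" using elim by simp
          have sub: "chain (real R) (\<epsilon> j) (t / real n) n \<subseteq> node (real R) t"
            using chain_subset_node[of "real R" "\<epsilon> j" "t / real n" n] nt by simp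
          have "(\<integral>\<^sup>+\<omega>. \<Phi> R j n \<omega> \<partial>M)
            = (\<integral>\<^sup>+\<omega>. ennreal (indicator (chain (real R) (\<epsilon> j) (t / real n) n) \<omega> * Y (X t \<omega>) (V t \<omega>)) \<partial>M)"
            unfolding \<Phi>_def by (intro nn_integral_cong) (auto simp: indicator_def)
          also have "\<dots> = ennreal (expectation (\<lambda>\<omega>. indicator (chain (real R) (\<epsilon> j) (t / real n) n) \<omega> * Y (X t \<omega>) (V t \<omega>)))"
            by (rule nn_integral_eq_integral[OF integrable_Y_on_node[OF t chM sub]]) (simp add: Y_nonneg)
          also have "\<dots> \<le> ennreal (A + t * (C * (t / real n + \<epsilon> j)))"
            using decay[rule_format, of "t / real n" "\<epsilon> j" n] elim \<open>K * \<epsilon> j < 1\<close> \<epsilon>[of j] t0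
            unfolding A_def nt admissible_def by (intro ennreal_leI) auto
          finally show ?case .
        qed
        have "(\<lambda>n. A + t * (C * (t / real n + \<epsilon> j))) \<longlonglongrightarrow> A + t * (C * (0 + \<epsilon> j))"
          by (intro tendsto_intros hlim)
        then show "(\<lambda>n. A + t * (C * (t / real n + \<epsilon> j))) \<longlonglongrightarrow> A + t * (C * \<epsilon> j)" by simp
      qed
    qed
  qed
  have s2: "(\<integral>\<^sup>+\<omega>. liminf (\<lambda>j. liminf (\<lambda>n. \<Phi> R j n \<omega>)) \<partial>M) \<le> ennreal A" for R
  proof -
    obtain C where decay: "\<forall>h \<epsilon> n. admissible h \<epsilon> \<longrightarrow>
      expectation (\<lambda>\<omega>. indicator (chain (real R) \<epsilon> h n) \<omega> * Y (X (real n * h) \<omega>) (V (real n * h) \<omega>))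
        \<le> exp (- m * (real n * h)) * expectation (\<lambda>\<omega>. Y (X 0 \<omega>) (V 0 \<omega>)) + real n * h * (C * (h + \<epsilon>))"
      using chain_decay[OF Y0, of "real R"] by auto
    have "(\<lambda>j. A + t * (C * \<epsilon> j)) \<longlonglongrightarrow> A + t * (C * 0)"
      by (intro tendsto_intros \<epsilon>lim)
    then show ?thesis
      by (intro nn_integral_liminf_le[OF _ s1[OF decay]]) (use \<Phi>m in \<open>auto intro!: borel_measurable_liminf\<close>)
  qed
  have s3: "(\<integral>\<^sup>+\<omega>. liminf (\<lambda>R. liminf (\<lambda>j. liminf (\<lambda>n. \<Phi> R j n \<omega>))) \<partial>M) \<le> ennreal A"
    by (rule nn_integral_liminf_le[where b = "\<lambda>_. A"]) (use \<Phi>m s2 in \<open>auto intro!: borel_measurable_liminf\<close>)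
  \<comment> \<open>For a fixed path inside \<open>D\<close> the chain indicators are eventually
    \<open>1\<close> in each of the nested limits, so the iterated liminf equals the energy;
    elsewhere the left side is \<open>0\<close>.\<close>
  have "indicator (inside t) \<omega> * ?y \<omega> \<le> liminf (\<lambda>R. liminf (\<lambda>j. liminf (\<lambda>n. \<Phi> R j n \<omega>)))" for \<omega>
  proof (cases "\<omega> \<in> inside t")
    case True
    obtain R0 where R0: "\<And>R \<epsilon>. R0 \<le> R \<Longrightarrow> 0 < \<epsilon> \<Longrightarrow> eventually (\<lambda>n. \<omega> \<in> chain R \<epsilon> (t / real n) n) sequentially"
      using eventually_chain[OF True t0] by blast
    have "liminf (\<lambda>n. \<Phi> R j n \<omega>) = ?y \<omega>" if "R0 \<le> real R" for R j
      by (rule liminf_eventually_const, rule eventually_mono[OF R0[OF that \<epsilon>(1)[of j]]]) (simp add: \<Phi>_def)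
    then have "liminf (\<lambda>j. liminf (\<lambda>n. \<Phi> R j n \<omega>)) = ?y \<omega>" if "R0 \<le> real R" for R
      using that by (intro liminf_eventually_const always_eventually) simp
    moreover have "eventually (\<lambda>R::nat. R0 \<le> real R) sequentially"
      using filterlim_real_sequentially by (simp add: filterlim_at_top)
    ultimately have "liminf (\<lambda>R. liminf (\<lambda>j. liminf (\<lambda>n. \<Phi> R j n \<omega>))) = ?y \<omega>"
      by (intro liminf_eventually_const) (auto elim: eventually_mono)
    then show ?thesis using True by simp
  qed simp
  then show ?thesis
    using order_trans[OF nn_integral_mono s3] unfolding A_def by simp
qed

text \<open>The estimate is made for the \<open>ennreal\<close>-valued integral first, so that its
  finiteness yields integrability and the bound on the expectation is not one on a default
  value.\<close>

lemma potential_decay: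
  assumes Y0: "integrable M (\<lambda>\<omega>. Y (X 0 \<omega>) (V 0 \<omega>))" and t: "0 \<le> t"
  shows "integrable M (\<lambda>\<omega>. indicator {\<omega>. exit_time X D \<omega> > ereal t} \<omega> * f (X t \<omega>)) \<and>
    expectation (\<lambda>\<omega>. indicator {\<omega>. exit_time X D \<omega> > ereal t} \<omega> * f (X t \<omega>))
      \<le> expectation (\<lambda>\<omega>. Y (X 0 \<omega>) (V 0 \<omega>)) / r * exp (- m * t)"
proof -
  let ?A = "expectation (\<lambda>\<omega>. Y (X 0 \<omega>) (V 0 \<omega>))"
  let ?i = "\<lambda>\<omega>. indicator {\<omega>. exit_time X D \<omega> > ereal t} \<omega> * f (X t \<omega>)"
  have i_eq: "?i \<omega> = indicator (inside t) \<omega> * f (X t \<omega>)" if "\<omega> \<in> space M" for \<omega>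
    using exit_time_greater_iff[where X = X and \<omega> = \<omega>, OF path_continuous(1)[OF that] D_open t] that
    by (auto simp: indicator_def inside_def)
  have "(\<lambda>\<omega>. f (X t \<omega>)) \<in> borel_measurable M"
    by (rule measurable_compose[OF measurable_FD[OF process_measurable(1)[OF t] t] borel_measurable_continuous_onI[OF f_cont]])
  then have "(\<lambda>\<omega>. indicator (inside t) \<omega> * f (X t \<omega>)) \<in> borel_measurable M"
    using inside_sets[OF t] by measurable
  then have meas: "?i \<in> borel_measurable M"
    using measurable_cong[of M ?i "\<lambda>\<omega>. indicator (inside t) \<omega> * f (X t \<omega>)" borel] i_eq by simp
  have A: "0 \<le> ?A" using Y_nonneg by simp
  have "(\<integral>\<^sup>+\<omega>. ennreal (?i \<omega>) \<partial>M) \<le> (\<integral>\<^sup>+\<omega>. ennreal (1 / r) * (indicator (inside t) \<omega> * ennreal (Y (X t \<omega>) (V t \<omega>))) \<partial>M)"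
  proof (rule nn_integral_mono)
    fix \<omega> assume w: "\<omega> \<in> space M"
    have "f (X t \<omega>) \<le> 1 / r * Y (X t \<omega>) (V t \<omega>)"
      using Y_lower[of "X t \<omega>" "V t \<omega>"] r_pos by (simp add: field_simps)
    then show "ennreal (?i \<omega>) \<le> ennreal (1 / r) * (indicator (inside t) \<omega> * ennreal (Y (X t \<omega>) (V t \<omega>)))"
      unfolding i_eq[OF w] using r_pos Y_nonneg
      by (auto simp: indicator_def ennreal_mult'[symmetric] intro!: ennreal_leI)
  qed
  also have "\<dots> = ennreal (1 / r) * (\<integral>\<^sup>+\<omega>. indicator (inside t) \<omega> * ennreal (Y (X t \<omega>) (V t \<omega>)) \<partial>M)"
    by (rule nn_integral_cmult) (use inside_sets[OF t] process_measurable(5)[OF t] in measurable)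
  also have "\<dots> \<le> ennreal (1 / r) * ennreal (exp (- m * t) * ?A)"
    by (intro mult_left_mono energy_decay[OF Y0 t]) simp
  also have "\<dots> = ennreal (?A / r * exp (- m * t))"
    using r_pos A by (simp add: ennreal_mult'[symmetric] field_simps)
  finally have nn: "(\<integral>\<^sup>+\<omega>. ennreal (?i \<omega>) \<partial>M) \<le> ennreal (?A / r * exp (- m * t))" .
  have nonneg: "0 \<le> ?i \<omega>" for \<omega> using f_nonneg by simp
  have int: "integrable M ?i"
  proof (rule integrableI_nonneg[OF meas])
    show "AE \<omega> in M. 0 \<le> ?i \<omega>" using nonneg by simp
    show "(\<integral>\<^sup>+\<omega>. ennreal (?i \<omega>) \<partial>M) < \<infinity>" by (rule le_less_trans[OF nn]) simp
  qed
  have "ennreal (expectation ?i) \<le> ennreal (?A / r * exp (- m * t))"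
    using nn nn_integral_eq_integral[OF int] nonneg by simp
  then have "expectation ?i \<le> ?A / r * exp (- m * t)"
    by (rule ennreal_le_iff[THEN iffD1, rotated]) (use A r_pos in simp)
  then show ?thesis using int by simp
qed

end

section \<open>Integrability of the initial energy and the conclusion\<close>

lemma (in finite_measure) integrable_norm_sq_of_powr4:
  fixes Z :: "'a \<Rightarrow> 'b::euclidean_space"
  assumes Z: "Z \<in> borel_measurable M" "integrable M (\<lambda>\<omega>. norm (Z \<omega>) powr 4)"
  shows "integrable M (\<lambda>\<omega>. (norm (Z \<omega>))\<^sup>2)"
proof (rule Bochner_Integration.integrable_bound)
  show "integrable M (\<lambda>\<omega>. 1 + norm (Z \<omega>) powr 4)" using Z by simp
  show "(\<lambda>\<omega>. (norm (Z \<omega>))\<^sup>2) \<in> borel_measurable M" using Z by measurable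
  have "x\<^sup>2 \<le> 1 + x powr 4" if "0 \<le> x" for x :: real
  proof (cases "x \<le> 1")
    case True
    then have "x\<^sup>2 \<le> 1" using that by (simp add: power_le_one)
    then show ?thesis using powr_ge_zero[of x 4] by linarith
  next
    case False
    then have "x\<^sup>2 \<le> x ^ 4" by (intro power_increasing) auto
    then show ?thesis using that by simp
  qed
  then show "AE \<omega> in M. norm ((norm (Z \<omega>))\<^sup>2) \<le> norm (1 + norm (Z \<omega>) powr 4)" by simp
qed

text \<open>The descent inequality at \<open>0\<close> gives \<open>f\<close> at most quadratic
  growth, and \<open>(norm (g x))\<^sup>2 \<le> 2 * s\<^sup>2 * f x\<close> transfers this to the
  cross term; thus second moments dominate the energy.\<close>

lemma (in kinetic_sde) integrable_initial_energy:
  assumes X0: "integrable M (\<lambda>\<omega>. (norm (X 0 \<omega>))\<^sup>2)" and V0: "integrable M (\<lambda>\<omega>. (norm (V 0 \<omega>))\<^sup>2)"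
  shows "integrable M (\<lambda>\<omega>. Y (X 0 \<omega>) (V 0 \<omega>))"
proof (rule Bochner_Integration.integrable_bound)
  let ?B = "\<lambda>\<omega>. (s + r + s\<^sup>2) * (f 0 + (norm (g 0))\<^sup>2 + (1 + s\<^sup>2) * (norm (X 0 \<omega>))\<^sup>2) + (1 + s) * (norm (V 0 \<omega>))\<^sup>2"
  show "integrable M ?B" using X0 V0 by simp
  show "(\<lambda>\<omega>. Y (X 0 \<omega>) (V 0 \<omega>)) \<in> borel_measurable M" by (rule process_measurable) simp
  have half: "x \<bullet> y \<le> ((norm x)\<^sup>2 + (norm y)\<^sup>2) / 2" for x y :: "real^'d"
    using norm_cauchy_schwarz[of x y] sum_squares_bound[of "norm x" "norm y"] by simp
  have "Y x v \<le> (s + r + s\<^sup>2) * (f 0 + (norm (g 0))\<^sup>2 + (1 + s\<^sup>2) * (norm x)\<^sup>2) + (1 + s) * (norm v)\<^sup>2" for x v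
  proof -
    have "f x \<le> f 0 + g 0 \<bullet> x + s\<^sup>2 / 2 * (norm x)\<^sup>2" using descent[of x 0] by simp
    also have "\<dots> \<le> f 0 + ((norm (g 0))\<^sup>2 + (norm x)\<^sup>2) / 2 + s\<^sup>2 / 2 * (norm x)\<^sup>2"
      using half[of "g 0" x] by simp
    also have "\<dots> \<le> f 0 + (norm (g 0))\<^sup>2 + (1 + s\<^sup>2) * (norm x)\<^sup>2"
    proof -
      have "c + (p + n) / 2 + q / 2 \<le> c + p + (n + q)" if "0 \<le> p" "0 \<le> n" "0 \<le> q" for c p n q :: real
        using that by (simp add: field_simps)
      from this[of "(norm (g 0))\<^sup>2" "(norm x)\<^sup>2" "s\<^sup>2 * (norm x)\<^sup>2" "f 0"]
      show ?thesis by (simp add: distrib_right)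
    qed
    finally have 1: "(s + r + s\<^sup>2) * f x \<le> (s + r + s\<^sup>2) * (f 0 + (norm (g 0))\<^sup>2 + (1 + s\<^sup>2) * (norm x)\<^sup>2)"
      using s_pos r_pos by (intro mult_left_mono) auto
    have "(norm (g x))\<^sup>2 \<le> 2 * s\<^sup>2 * f x"
      by (rule norm_gradient_sq_le[where f = f, OF descent f_nonneg]) (use s_pos in simp)
    then have 2: "g x \<bullet> v \<le> s\<^sup>2 * f x + (norm v)\<^sup>2 / 2" using half[of "g x" v] by simp
    have 3: "0 \<le> s * (norm v)\<^sup>2" "(1 + s) * (norm v)\<^sup>2 = (norm v)\<^sup>2 + s * (norm v)\<^sup>2"
      using s_pos by (simp_all add: algebra_simps)
    have "Y x v = (s + r + s\<^sup>2) * f x - s\<^sup>2 * f x + g x \<bullet> v + (s * (norm v)\<^sup>2) / 2"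
      by (simp add: energy_def algebra_simps)
    then show ?thesis using 1 2 3 zero_le_power2[of "norm v"] by linarith
  qed
  then show "AE \<omega> in M. norm (Y (X 0 \<omega>) (V 0 \<omega>)) \<le> norm (?B \<omega>)"
    using Y_nonneg by (intro AE_I2) (simp add: abs_of_nonneg order_trans[OF _ abs_ge_self])
qed

lemma (in kinetic_sde) exponential_decay:
  assumes "in_Lp 4 M (F 0) (X 0)" "in_Lp 4 M (F 0) (V 0)"
  shows "\<exists>C\<ge>0. \<forall>t\<ge>0.
    integrable M (\<lambda>\<omega>. indicator {\<omega>. exit_time X D \<omega> > ereal t} \<omega> * f (X t \<omega>)) \<and>
    expectation (\<lambda>\<omega>. indicator {\<omega>. exit_time X D \<omega> > ereal t} \<omega> * f (X t \<omega>)) \<le> C * exp (- m * t)"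
proof -
  have "integrable M (\<lambda>\<omega>. (norm (Z \<omega>))\<^sup>2)" if "in_Lp 4 M (F 0) Z" for Z :: "'w \<Rightarrow> real^'d"
  proof (rule integrable_norm_sq_of_powr4)
    show "Z \<in> borel_measurable M" "integrable M (\<lambda>\<omega>. norm (Z \<omega>) powr 4)"
      using that measurable_FD[of Z 0 borel] unfolding in_Lp_def by blast+
  qed
  then have Y0: "integrable M (\<lambda>\<omega>. Y (X 0 \<omega>) (V 0 \<omega>))"
    using assms by (intro integrable_initial_energy)
  have "0 \<le> expectation (\<lambda>\<omega>. Y (X 0 \<omega>) (V 0 \<omega>)) / r"
    using Y_nonneg r_pos by simp
  then show ?thesis using potential_decay[OF Y0] by blast
qed

theorem theorem1p2:
  fixes f :: "real^'d \<Rightarrow> real" and S :: "real^'d \<Rightarrow> real^'e^'d"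
    and M :: "'w measure" and F :: "real \<Rightarrow> 'w measure" and W :: "real \<Rightarrow> 'w \<Rightarrow> real^'e"
    and X V :: "real \<Rightarrow> 'w \<Rightarrow> real^'d" and D :: "(real^'d) set"
    and C\<^sub>L CLstar L \<sigma> \<mu> m :: real
  assumes "twice_continuously_differentiable f"
    and "C\<^sub>L-lipschitz_on UNIV (gradient f)"
    and "bdd_below (range f)" and "(INF x. f x) = 0"
    and "\<exists>K. K-lipschitz_on UNIV S"
    and "filtered_prob_space M F" and "usual_conditions M F"
    and "standard_brownian_motion M F W"
    and "in_Lp 4 M (F 0) (X 0)" and "in_Lp 4 M (F 0) (V 0)"
    and "\<mu> > 0"
    and "sde_solution M F W \<mu> f S X V"
    and "L > 0"
    and "CLstar = max C\<^sub>L (9/8 * L)"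
    and "0 < \<sigma>" and "\<sigma> < 4 * (L / sqrt CLstar)"
    and "open D"
    and "\<And>x. x \<in> D \<Longrightarrow> (norm (gradient f x))\<^sup>2 \<ge> 2 * L * f x"
    and "\<And>x. x \<in> D \<Longrightarrow> (norm (S x))\<^sup>2 \<le> \<sigma> * f x"
    and "\<mu> = 2 * sqrt CLstar - sqrt (CLstar - L + 1/4 * sqrt CLstar * \<sigma>)"
    and "m = 2 * (sqrt CLstar - sqrt (CLstar - L + 1/4 * sqrt CLstar * \<sigma>))"
  shows "\<exists>C\<ge>0. \<forall>t\<ge>0.
    integrable M (\<lambda>\<omega>. indicator {\<omega>. exit_time X D \<omega> > ereal t} \<omega> * f (X t \<omega>)) \<and>
    prob_space.expectation M (\<lambda>\<omega>. indicator {\<omega>. exit_time X D \<omega> > ereal t} \<omega> * f (X t \<omega>))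
      \<le> C * exp (- m * t)"
proof -
  define s where "s = sqrt CLstar"
  define r where "r = sqrt (CLstar - L + 1/4 * sqrt CLstar * \<sigma>)"
  note L = \<open>L > 0\<close> and D = \<open>\<And>x. x \<in> D \<Longrightarrow> (norm (gradient f x))\<^sup>2 \<ge> 2 * L * f x\<close>
  \<comment> \<open>The factor \<open>9/8 > 1\<close> makes \<open>L < CLstar\<close> strict. The
    radicand is then positive, and so is \<open>r\<close>, by which the final constant is
    divided.\<close>
  have CL: "C\<^sub>L \<le> CLstar" "L < CLstar" "0 < CLstar" using assms(14) L by auto
  have s: "0 < s" "s\<^sup>2 = CLstar" using CL by (auto simp: s_def)
  have "0 \<le> 1/4 * sqrt CLstar * \<sigma>" using CL \<open>0 < \<sigma>\<close> by simp
  then have rad: "0 < CLstar - L + 1/4 * sqrt CLstar * \<sigma>" using CL by linarith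
  then have r: "0 < r" "r\<^sup>2 = s\<^sup>2 - L + s * \<sigma> / 4"
    unfolding r_def s(2) by (auto simp: s_def)
  \<comment> \<open>The upper bound on \<open>\<sigma>\<close> amounts to
    \<open>r\<^sup>2 < s\<^sup>2\<close>, that is, to a positive decay rate
    \<open>m\<close>.\<close>
  have "\<sigma> * s < 4 * L" using \<open>\<sigma> < 4 * (L / sqrt CLstar)\<close> s by (simp add: s_def field_simps)
  then have "r\<^sup>2 \<le> s\<^sup>2" using r(2) by (simp add: algebra_simps)
  then have "r \<le> s" using s(1) by (rule power2_le_imp_le[OF _ less_imp_le])
  have grad: "GDERIV f x :> gradient f x" for x
    using assms(1) by (simp add: twice_continuously_differentiable_def)
  have lip: "(s\<^sup>2)-lipschitz_on UNIV (gradient f)"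
    using assms(2) by (rule lipschitz_on_le) (use CL s in simp)
  have f_nonneg: "0 \<le> f x" for x
    using cINF_lower[OF assms(3), of x] assms(4) by simp
  have f_cont: "continuous_on UNIV f"
    using grad unfolding gderiv_def
    by (intro differentiable_imp_continuous_on) (auto simp: differentiable_on_def differentiable_def)
  obtain K where K: "K-lipschitz_on UNIV S" using assms(5) by blast
  obtain J where J: "ito_integral_process M F W (\<lambda>t \<omega>. S (X t \<omega>)) J"
    "AE \<omega> in M. \<forall>t\<ge>0. X t \<omega> = X 0 \<omega> + integral {0..t} (\<lambda>s. V s \<omega>) \<and>
      V t \<omega> = V 0 \<omega> - integral {0..t} (\<lambda>s. \<mu> *\<^sub>R V s \<omega> + gradient f (X s \<omega>)) + J t \<omega>"
    and XV: "adapted F X" "continuous_process M X" "adapted F V" "continuous_process M V"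
    using assms(12) unfolding sde_solution_def by blast
  have \<mu>m: "\<mu> = 2 * s - r" "m = 2 * (s - r)" using assms(20,21) by (auto simp: s_def r_def)
  have ks: "kinetic_sde M F W f (gradient f) S X V J D L s r \<sigma> \<mu> m K"
  proof (intro kinetic_sde.intro filtered_brownian_motion.intro kinetic_sde_axioms.intro)
    show "filtered_prob_space M F" "standard_brownian_motion M F W" by (rule assms(6), rule assms(8))
    show "f y \<le> f x + gradient f x \<bullet> (y - x) + s\<^sup>2 / 2 * (norm (y - x))\<^sup>2" for x y
      by (rule descent_inequality[OF grad lip])
    show "0 < s" "0 < r" "r \<le> s" "r\<^sup>2 = s\<^sup>2 - L + s * \<sigma> / 4" by fact+
    show "2 * L * f x \<le> (norm (gradient f x))\<^sup>2" "(norm (S x))\<^sup>2 \<le> \<sigma> * f x" if "x \<in> D" for x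
      using D[OF that] assms(19)[OF that] by auto
    show "(s\<^sup>2)-lipschitz_on UNIV (gradient f)" "continuous_on UNIV f" "\<And>x. 0 \<le> f x" "K-lipschitz_on UNIV S"
      by (rule lip, rule f_cont, rule f_nonneg, rule K)
    show "0 < L" "\<mu> = 2 * s - r" "m = 2 * (s - r)" "open D"
      by (rule L, rule \<mu>m, rule \<mu>m, rule \<open>open D\<close>)
    show "adapted F X" "continuous_process M X" "adapted F V" "continuous_process M V"
      by (rule XV)+
    show "ito_integral_process M F W (\<lambda>t \<omega>. S (X t \<omega>)) J" by (rule J(1))
    show "AE \<omega> in M. \<forall>t\<ge>0. X t \<omega> = X 0 \<omega> + integral {0..t} (\<lambda>u. V u \<omega>) \<and>
      V t \<omega> = V 0 \<omega> - integral {0..t} (\<lambda>u. \<mu> *\<^sub>R V u \<omega> + gradient f (X u \<omega>)) + J t \<omega>"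
      by (rule J(2))
  qed
  show ?thesis by (rule kinetic_sde.exponential_decay[OF ks assms(9,10)])
qed

end
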